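(* Let $(X_1,X_2,X_3)$ have standard exponential margins and joint density $f$ given by the trivariate vine copula in which $C_{12}$ and $C_{23}$ are inverted extreme value copulas with exponent measures $V^{\{12\}},V^{\{23\}}$, and $C_{13|2}$ is an extreme value copula with exponent measure $V^{\{13|2\}}$. Assume the spectral densities satisfy the tail conditions in the context. Then the gauge function of $f$ is $$g(\mathbf x)=\left(2+s_{\rm m}^{\{13|2\}}\right)\max\left\{V^{\{12\}}(x_1^{-1},x_2^{-1}),V^{\{23\}}(x_2^{-1},x_3^{-1})\right\}-\left(1+s_{\rm m}^{\{13|2\}}\right)\min\left\{V^{\{12\}}(x_1^{-1},x_2^{-1}),V^{\{23\}}(x_2^{-1},x_3^{-1})\right\},$$ with $\min(x_1,x_2,x_3)\ge0$, where $s_{\rm m}^{\{13|2\}}=s_1^{\{13|2\}}$ if $V^{\{12\}}(x_1^{-1},x_2^{-1})\ge V^{\{23\}}(x_2^{-1},x_3^{-1})$ and $s_{\rm m}^{\{13|2\}}=s_2^{\{13|2\}}$ otherwise. Moreover, the coefficients of tail dependence of $(X_1,X_2,X_3)$ and $(X_1,X_3)$ are $$\eta_{\{1,2,3\}}=\min\left[\left\{V^{\{12\}}(1,1)\right\}^{-1},\left\{V^{\{23\}}(1,1)\right\}^{-1}\right],\qquad \eta_{\{1,3\}}=1.$$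
   Context: The gauge function of $f$ is the function $g$, homogeneous of order 1, with $-\ln f(t\mathbf x)\sim tg(\mathbf x)$ as $t\to\infty$, where $\mathbf x=(x_1,x_2,x_3)$. For $\mathcal C\subseteq\{1,2,3\}$, $|\mathcal C|\ge2$, the coefficient of tail dependence $\eta_{\mathcal C}\in(0,1]$ is defined by $\Pr(X_i>x:i\in\mathcal C)\sim L_{\mathcal C}(e^x)e^{-x/\eta_{\mathcal C}}$ as $x\to\infty$, with $L_{\mathcal C}$ slowly varying at infinity; it is obtained from the gauge function through $\eta_{\mathcal C}=\{\min g(\mathbf x)\}^{-1}$, the minimum being over $x_i\ge1$ for $i\in\mathcal C$ and $x_i\ge0$ for $i\notin\mathcal C$. Exponent measure: $V(x,y)=2\int_0^1\max\left(\frac wx,\frac{1-w}{y}\right)dH(w)$, $x,y>0$, where the spectral distribution $H$ is a probability distribution on $[0,1]$ with $\int_0^1w\,dH(w)=1/2$. The derivatives of $V$ with respect to the first, second and both arguments are assumed to exist. Reciprocals of $0$ are read as $\infty$, with $V$ then evaluated by the same integral. Tail conditions: $h^{\{12\}},h^{\{23\}},h^{\{13|2\}}$ denote the spectral densities (densities of $H$) of the three pair copula components; they place no mass on $\{0\}$ or $\{1\}$, and each satisfies $h^{\{\cdot\}}(w)\sim c_1^{\{\cdot\}}(1-w)^{s_1^{\{\cdot\}}}$ as $w\nearrow1$ and $h^{\{\cdot\}}(w)\sim c_2^{\{\cdot\}}w^{s_2^{\{\cdot\}}}$ as $w\searrow0$, for some $c_1^{\{\cdot\}},c_2^{\{\cdot\}}\in\mathbb{R}$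 and $s_1^{\{\cdot\}},s_2^{\{\cdot\}}>-1$. Extreme value copula: $C(u,v)=\exp\left\{-V\left(\frac{-1}{\ln u},\frac{-1}{\ln v}\right)\right\}$. Inverted extreme value copula: $C(u,v)=u+v-1+\exp\left[-V\left\{\frac{-1}{\ln(1-u)},\frac{-1}{\ln(1-v)}\right\}\right]$. Density $c=\partial^2C/\partial u\,\partial v$. Trivariate vine: with $F_i(x)=1-e^{-x}$, $f_i(x)=e^{-x}$, $F_{1|2}(x_1|x_2)=\partial_2C_{12}\{F_1(x_1),F_2(x_2)\}$, $F_{3|2}(x_3|x_2)=\partial_1C_{23}\{F_2(x_2),F_3(x_3)\}$, $$f(\mathbf x)=f_1(x_1)f_2(x_2)f_3(x_3)\,c_{12}\{F_1(x_1),F_2(x_2)\}\,c_{23}\{F_2(x_2),F_3(x_3)\}\,c_{13|2}\{F_{1|2}(x_1|x_2),F_{3|2}(x_3|x_2)\}.$$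
   Formalization: The gauge relation is claimed at interior points only (boundary values of g are fixed by continuity); where V^{12}=V^{23} it is claimed only if h^{13|2} is continuous and positive on (0,1); the tail constants c_1, c_2 are taken nonzero. *)

theory Defs
  imports "HOL-Probability.Probability" "HOL-Library.Landau_Symbols"
begin

unbundle asymp_equiv_syntax

section \<open>Exponent measures and spectral densities\<close>

definition spectral_distribution :: "real measure \<Rightarrow> bool" where
  "spectral_distribution H \<longleftrightarrow>
     prob_space H \<and> sets H = sets borel \<and> emeasure H {0..1} = 1 \<and> (\<integral>w. w \<partial>H) = 1 / 2"

text \<open>
  The arguments are positive or infinite. Infinity only occurs as a reciprocal of 0 and is
  represented by the real number 0: \<open>inverse 0 = 0\<close> and \<open>w / 0 = 0\<close> in HOL, so that
  an argument 0 gives the integral with \<open>w / \<infinity> = 0\<close>.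
\<close>
definition exponent_measure :: "real measure \<Rightarrow> real \<Rightarrow> real \<Rightarrow> real" where
  "exponent_measure H x y = 2 * (\<integral>w. max (w / x) ((1 - w) / y) \<partial>H)"

definition exponent_measure_differentiable :: "real measure \<Rightarrow> bool" where
  "exponent_measure_differentiable H \<longleftrightarrow>
     (\<forall>x>0. \<forall>y>0.
        (\<lambda>x'. exponent_measure H x' y) field_differentiable at x \<and>
        (\<lambda>y'. exponent_measure H x y') field_differentiable at y \<and>
        (\<lambda>x'. deriv (\<lambda>y'. exponent_measure H x' y') y) field_differentiable at x)"

text \<open>
  The density lives on the open interval, so \<open>H\<close> has no mass on \<open>{0}\<close> or \<open>{1}\<close>; values of
  \<open>h\<close> outside the open interval are irrelevant (\<open>h\<close> may be unbounded at the endpoints).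
\<close>
definition spectral_density :: "real measure \<Rightarrow> (real \<Rightarrow> real) \<Rightarrow> bool" where
  "spectral_density H h \<longleftrightarrow>
     h \<in> borel_measurable borel \<and> (\<forall>w\<in>{0<..<1}. 0 \<le> h w) \<and>
     H = density lborel (\<lambda>w. ennreal (h w) * indicator {0<..<1} w)"

text \<open>
  The constants are nonzero: with a zero constant the asymptotic relation would say that \<open>h\<close>
  vanishes near the endpoint and would put no constraint on the exponent.
\<close>
definition spectral_tails :: "(real \<Rightarrow> real) \<Rightarrow> real \<Rightarrow> real \<Rightarrow> bool" where
  "spectral_tails h s1 s2 \<longleftrightarrow>
     - 1 < s1 \<and> - 1 < s2 \<and>
     (\<exists>c1. c1 \<noteq> 0 \<and> h \<sim>[at_left 1] (\<lambda>w. c1 * (1 - w) powr s1)) \<and>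
     (\<exists>c2. c2 \<noteq> 0 \<and> h \<sim>[at_right 0] (\<lambda>w. c2 * w powr s2))"

section \<open>Copulas\<close>

definition ev_copula :: "real measure \<Rightarrow> real \<Rightarrow> real \<Rightarrow> real" where
  "ev_copula H u v = exp (- exponent_measure H (- 1 / ln u) (- 1 / ln v))"

definition inverted_ev_copula :: "real measure \<Rightarrow> real \<Rightarrow> real \<Rightarrow> real" where
  "inverted_ev_copula H u v =
     u + v - 1 + exp (- exponent_measure H (- 1 / ln (1 - u)) (- 1 / ln (1 - v)))"

definition copula_density :: "(real \<Rightarrow> real \<Rightarrow> real) \<Rightarrow> real \<Rightarrow> real \<Rightarrow> real" where
  "copula_density C u v = deriv (\<lambda>u'. deriv (\<lambda>v'. C u' v') v) u"

abbreviation exp_cdf :: "real \<Rightarrow> real" where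
  "exp_cdf x \<equiv> 1 - exp (- x)"

text \<open>\<open>C13\<close> is the copula of the first and third components given the second.\<close>
definition vine_density ::
  "(real \<Rightarrow> real \<Rightarrow> real) \<Rightarrow> (real \<Rightarrow> real \<Rightarrow> real) \<Rightarrow> (real \<Rightarrow> real \<Rightarrow> real) \<Rightarrow>
   real \<times> real \<times> real \<Rightarrow> real" where
  "vine_density C12 C23 C13 = (\<lambda>(x1, x2, x3).
     if 0 < x1 \<and> 0 < x2 \<and> 0 < x3 then
       exp (- x1) * exp (- x2) * exp (- x3)
       * copula_density C12 (exp_cdf x1) (exp_cdf x2)
       * copula_density C23 (exp_cdf x2) (exp_cdf x3)
       * copula_density C13
           (deriv (\<lambda>v. C12 (exp_cdf x1) v) (exp_cdf x2))
           (deriv (\<lambda>u. C23 u (exp_cdf x3)) (exp_cdf x2))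
     else 0)"

section \<open>Gauge functions\<close>

definition open_orthant :: "(real \<times> real \<times> real) set" where
  "open_orthant = {(x1, x2, x3). 0 < x1 \<and> 0 < x2 \<and> 0 < x3}"

definition closed_orthant :: "(real \<times> real \<times> real) set" where
  "closed_orthant = {(x1, x2, x3). 0 \<le> x1 \<and> 0 \<le> x2 \<and> 0 \<le> x3}"

text \<open>
  The limit relation is required along the rays through \<open>D\<close>, a subset of the open orthant.
  On the boundary of the orthant the density carries no information (it may vanish there, as a
  version of the density or as its limit), so there \<open>g\<close> is fixed by continuity.
\<close>
definition gauge_function_on ::
  "(real \<times> real \<times> real) set \<Rightarrow> (real \<times> real \<times> real \<Rightarrow> real) \<Rightarrow> (real \<times> real \<times> real \<Rightarrow> real) \<Rightarrow> bool" where
  "gauge_function_on D f g \<longleftrightarrow>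
     continuous_on closed_orthant g \<and>
     (\<forall>x\<in>closed_orthant. \<forall>t>0. g (t *\<^sub>R x) = t * g x) \<and>
     (\<forall>x\<in>D. (\<lambda>t. - ln (f (t *\<^sub>R x))) \<sim>[at_top] (\<lambda>t. t * g x))"

definition vine_gauge ::
  "real measure \<Rightarrow> real measure \<Rightarrow> real \<Rightarrow> real \<Rightarrow> real \<times> real \<times> real \<Rightarrow> real" where
  "vine_gauge H12 H23 s1 s2 = (\<lambda>(x1, x2, x3).
     let v12 = exponent_measure H12 (inverse x1) (inverse x2);
         v23 = exponent_measure H23 (inverse x2) (inverse x3);
         sm = (if v12 \<ge> v23 then s1 else s2)
     in (2 + sm) * max v12 v23 - (1 + sm) * min v12 v23)"

section \<open>Coefficients of tail dependence\<close>

definition slowly_varying :: "(real \<Rightarrow> real) \<Rightarrow> bool" where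
  "slowly_varying L \<longleftrightarrow>
     L \<in> borel_measurable borel \<and> (\<forall>\<^sub>F y in at_top. 0 < L y) \<and>
     (\<forall>c>0. ((\<lambda>y. L (c * y) / L y) \<longlongrightarrow> 1) at_top)"

definition tail_dependence_coefficient ::
  "'a measure \<Rightarrow> (nat \<Rightarrow> 'a \<Rightarrow> real) \<Rightarrow> nat set \<Rightarrow> real \<Rightarrow> bool" where
  "tail_dependence_coefficient M X C \<eta> \<longleftrightarrow>
     0 < \<eta> \<and> \<eta> \<le> 1 \<and>
     (\<exists>L. slowly_varying L \<and>
       (\<lambda>x. measure M {\<omega> \<in> space M. \<forall>i\<in>C. X i \<omega> > x})
         \<sim>[at_top] (\<lambda>x. L (exp x) * exp (- x / \<eta>)))"

end

theory Submission
  imports Defs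
begin

text \<open>
  Each exponent measure \<open>V\<close> enters through its stable tail dependence function
  \<open>L a b = V (1/a) (1/b) = 2 * (\<integral>w. max (w * a) ((1 - w) * b) \<partial>H)\<close>. Cutting the integral at an angle \<open>t\<close> gives
  \<open>a * A t + b * B t \<le> L a b\<close>, where \<open>A t\<close> is twice the integral of \<open>w\<close> above \<open>t\<close> and \<open>B t\<close> twice that of
  \<open>1 - w\<close> below \<open>t\<close>, and equality holds at \<open>t = b / (a + b)\<close>. So \<open>A\<close> and \<open>B\<close> at this angle are the partial derivatives of \<open>L\<close>,
  and convexity, monotonicity and homogeneity come for free (locale \<open>stable_tail\<close>). The mixed derivative of
  \<open>L\<close> is \<open>- \<kappa> t / (a + b)\<close> with \<open>\<kappa> t = t * B' t = - (1 - t) * A' t\<close>, and the tail conditions on the spectral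
  density become power laws of \<open>\<kappa>\<close> with exponents \<open>s2 + 1\<close> at 0 and \<open>s1 + 1\<close> at 1 (locale
  \<open>stable_tail_density\<close>). Both locales are invariant under exchanging the arguments of \<open>L\<close>, which
  halves all that follows; spectral measures are shown to satisfy them in locale \<open>spectral\<close>.

  Gauge function. In exponential margins an inverted extreme value copula has joint survival function
  \<open>exp (- L x y)\<close>, so the conditional survival probabilities \<open>p = P(X1 > x1 | X2 = x2)\<close> and
  \<open>q = P(X3 > x3 | X2 = x2)\<close> are \<open>exp (x2 - L)\<close> up to bounded factors. Along a ray they decay
  exponentially at rates \<open>V12 - x2\<close> and \<open>V23 - x2\<close>, and the density of \<open>C13\<close> is evaluated at
  \<open>(1 - p, 1 - q)\<close>, close to the corner \<open>(1, 1)\<close>. With \<open>a = - ln (1 - p)\<close> and \<open>b = - ln (1 - q)\<close> that density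
  behaves like \<open>\<kappa> (b / (a + b)) / (a + b)\<close>. If the two rates differ, the angle tends to an endpoint and the
  power law of \<open>\<kappa>\<close> contributes \<open>1 + s1\<close> or \<open>1 + s2\<close> times the difference of the rates; if they
  agree, the angle tends to an interior point, where \<open>\<kappa>\<close> contributes a positive constant when \<open>h13\<close> is continuous
  and positive. Adding the exponents gives
  the gauge function (\<open>ln_vine_formula_rate_neq\<close>, \<open>ln_vine_formula_rate_eq\<close>).

  Tail dependence. Integrating \<open>x1\<close> and then \<open>x3\<close> out of the density by the fundamental theorem of calculus
  (\<open>joint_survival\<close>) gives
  \<open>P(X1 > x, X2 > z, X3 > x) = \<integral>\<^sub>z\<^sup>\<infinity> exp (- y) * T (p x y) (q x y) dy\<close>, where \<open>T\<close> is the joint tail of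
  \<open>C13\<close>. Near the origin \<open>T\<close> is equivalent to the tail copula \<open>a + b - L13 a b\<close>, which is homogeneous,
  monotone and at least a multiple of \<open>min a b\<close>. For \<open>z = x\<close>, dominated convergence shows that this
  probability is asymptotic to a positive multiple of \<open>exp (- x * max (V12 1 1) (V23 1 1))\<close>
  (\<open>tail_prob_diag_limit\<close>). For \<open>z = 0\<close> the slowly varying factor need not be constant; its slow variation
  says that replacing \<open>x\<close> by \<open>x + \<delta>\<close> multiplies the probability by a factor tending to \<open>exp (- \<delta>)\<close>
  (\<open>tail_prob_shift_ratio\<close>). This holds because both \<open>p\<close> and \<open>q\<close> change by this factor uniformly in
  \<open>y \<le> \<epsilon> * x\<close>, while larger \<open>y\<close> contribute at most \<open>exp (- x * L12 1 \<epsilon>)\<close>, which is exponentially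
  smaller than the whole integral since \<open>L12 1 \<epsilon> > 1\<close>.
\<close>

section \<open>Stable tail dependence functions\<close>

text \<open>The subgradient inequality, used at \<open>x\<close> and at the neighbouring point, squeezes the difference
  quotient between \<open>G x\<close> and \<open>G v\<close>.\<close>
lemma has_real_derivative_subgradient:
  fixes F G :: "real \<Rightarrow> real"
  assumes S: "open S" "x \<in> S"
    and ge: "\<And>u v. u \<in> S \<Longrightarrow> v \<in> S \<Longrightarrow> (v - u) * G u \<le> F v - F u"
    and cont: "isCont G x"
  shows "(F has_real_derivative G x) (at x)"
proof -
  have bnd: "norm ((F v - F x) / (v - x) - G x) \<le> norm (G v - G x)" if "v \<in> S" "v \<noteq> x" for v
  proof -
    have 1: "(v - x) * G x \<le> F v - F x" using ge[OF S(2) that(1)] .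
    have 2: "F v - F x \<le> (v - x) * G v" using ge[OF that(1) S(2)] by (simp add: algebra_simps)
    show ?thesis
    proof (cases "v > x")
      case True
      then have "G x \<le> (F v - F x) / (v - x)" "(F v - F x) / (v - x) \<le> G v"
        using 1 2 by (simp_all add: field_simps)
      then show ?thesis by auto
    next
      case False
      then have "v < x" using that by auto
      then have "(F v - F x) / (v - x) \<le> G x" "G v \<le> (F v - F x) / (v - x)"
        using 1 2 by (simp_all add: field_simps)
      then show ?thesis by auto
    qed
  qed
  have lim: "((\<lambda>v. norm (G v - G x)) \<longlongrightarrow> 0) (at x)"
    using cont unfolding isCont_def by (intro tendsto_norm_zero LIM_zero)
  have "\<forall>\<^sub>F v in at x. norm ((F v - F x) / (v - x) - G x) \<le> norm (G v - G x)"
    using eventually_at_in_open[OF S] by (rule eventually_mono) (use bnd in auto)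
  then have "((\<lambda>v. (F v - F x) / (v - x) - G x) \<longlongrightarrow> 0) (at x)"
    by (rule Lim_null_comparison[OF _ lim])
  then show ?thesis
    unfolding has_field_derivative_iff by (rule LIM_zero_cancel)
qed

text \<open>An abstract form of the stable tail dependence function: \<open>L\<close> is the supremum of the linear functions
  with coefficients \<open>A t\<close>, \<open>B t\<close>, attained at the angle \<open>y / (x + y)\<close>. Everything about \<open>L\<close> follows from this
  variational formula, without going back to the integral.\<close>
locale stable_tail =
  fixes L :: "real \<Rightarrow> real \<Rightarrow> real" and A B :: "real \<Rightarrow> real"
  assumes L_ge: "x * A t + y * B t \<le> L x y"
    and L_eq: "0 \<le> x \<Longrightarrow> 0 \<le> y \<Longrightarrow> 0 < x + y \<Longrightarrow> L x y = x * A (y / (x + y)) + y * B (y / (x + y))"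
    and L_0 [simp]: "L 0 0 = 0"
    and contA: "isCont A t" and contB: "isCont B t"
    and antimonoA: "t \<le> t' \<Longrightarrow> A t' \<le> A t" and monoB: "t \<le> t' \<Longrightarrow> B t \<le> B t'"
    and ends [simp]: "A 0 = 1" "A 1 = 0" "B 0 = 0" "B 1 = 1"
begin

text \<open>Exchanging the two arguments maps the angle \<open>t\<close> to \<open>1 - t\<close>; every statement about one argument or
  one endpoint is transferred to the other in this way.\<close>
lemma reflect: "stable_tail (\<lambda>x y. L y x) (\<lambda>t. B (1 - t)) (\<lambda>t. A (1 - t))"
proof
  fix x y t t' :: real
  show "x * B (1 - t) + y * A (1 - t) \<le> L y x" using L_ge[of y "1-t" x] by simp
  show "L y x = x * B (1 - y / (x + y)) + y * A (1 - y / (x + y))"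
    if "0 \<le> x" "0 \<le> y" "0 < x + y"
  proof -
    have "1 - y / (x + y) = x / (y + x)" using that by (simp add: field_simps)
    then show ?thesis using L_eq[of y x] that by (simp add: add.commute)
  qed
  show "isCont (\<lambda>t. B (1 - t)) t" 
    by (rule isCont_o2[where g=B]) (auto intro: contB)
  show "isCont (\<lambda>t. A (1 - t)) t" 
    by (rule isCont_o2[where g=A]) (auto intro: contA)
qed (use antimonoA monoB in auto)

lemma A_bounds: "0 \<le> t \<Longrightarrow> t \<le> 1 \<Longrightarrow> 0 \<le> A t" "0 \<le> t \<Longrightarrow> A t \<le> 1"
  and B_bounds: "0 \<le> t \<Longrightarrow> 0 \<le> B t" "t \<le> 1 \<Longrightarrow> B t \<le> 1"
  using antimonoA[of t 1] antimonoA[of 0 t] monoB[of 0 t] monoB[of t 1] by auto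

lemma angle_in_open_unit: "0 < x \<Longrightarrow> 0 < y \<Longrightarrow> 0 < y / (x + y) \<and> y / (x + y) < (1::real)"
  by (simp add: field_simps)

lemma angle_in_unit: "0 \<le> x \<Longrightarrow> 0 \<le> y \<Longrightarrow> 0 \<le> y / (x + y) \<and> y / (x + y) \<le> (1::real)"
  by (cases "x + y = 0") (auto simp: field_simps)

lemma L_homogeneous:
  assumes "0 < t" "0 \<le> x" "0 \<le> y"
  shows "L (t * x) (t * y) = t * L x y"
proof (cases "x + y = 0")
  case True then show ?thesis using assms by (auto simp: add_nonneg_eq_0_iff)
next
  case False
  then have "0 < x + y" using assms by auto
  moreover from this have "0 < t * x + t * y" using assms by (simp flip: distrib_left)
  moreover have "(t * y) / (t * x + t * y) = y / (x + y)"
    using assms by (simp flip: distrib_left)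
  ultimately show ?thesis using assms by (simp add: L_eq algebra_simps)
qed

text \<open>The variational formula makes \<open>(A t, B t)\<close> a subgradient of \<open>L\<close> at every point with angle \<open>t\<close>.\<close>
lemma L_diff_ge:
  assumes "0 \<le> x" "0 \<le> y" "0 < x + y"
  shows "(x' - x) * A (y / (x + y)) + (y' - y) * B (y / (x + y)) \<le> L x' y' - L x y"
  using L_ge[of x' "y / (x + y)" y'] L_eq[OF assms] by (simp add: algebra_simps)

lemma L_le_add: "0 \<le> x \<Longrightarrow> 0 \<le> y \<Longrightarrow> L x y \<le> x + y"
proof (cases "x + y = 0")
  case False
  assume *: "0 \<le> x" "0 \<le> y"
  then have "0 < x + y" using False by auto
  then show ?thesis using * L_eq[of x y] A_bounds[of "y/(x+y)"] B_bounds[of "y/(x+y)"] angle_in_unit[of x y]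
    by (auto intro!: add_mono mult_left_le)
qed (auto simp: add_nonneg_eq_0_iff)

lemma L_ge_fst: "x \<le> L x y" and L_ge_snd: "y \<le> L x y"
  using L_ge[of x 0 y] L_ge[of x 1 y] by auto

lemma L_mono_fst: assumes "0 \<le> x" "0 \<le> y" "x \<le> x'" shows "L x y \<le> L x' y"
proof (cases "x + y = 0")
  case True then show ?thesis using assms L_ge_fst[of x' y] by (auto simp: add_nonneg_eq_0_iff)
next
  case False
  then show ?thesis using L_diff_ge[of x y x' y] A_bounds[of "y/(x+y)"] angle_in_unit[of x y] assms
    by (smt (verit) mult_eq_0_iff mult_nonneg_nonneg)
qed

lemma L_mono_snd: assumes "0 \<le> x" "0 \<le> y" "y \<le> y'" shows "L x y \<le> L x y'"
  using stable_tail.L_mono_fst[OF reflect, of y x y'] assms by simp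

lemma L_add_fst_le:
  assumes "0 \<le> x" "0 \<le> y" "0 \<le> d" shows "L (x + d) y \<le> L x y + d"
proof (cases "x + d + y = 0")
  case True then show ?thesis using assms by (auto simp: add_nonneg_eq_0_iff)
next
  case False
  have "(x - (x + d)) * A (y / (x + d + y)) + (y - y) * B (y / (x + d + y)) \<le> L x y - L (x + d) y"
    using assms False by (intro L_diff_ge) auto
  moreover have "d * A (y / (x + d + y)) \<le> d"
    using assms A_bounds[of "y/(x+d+y)"] angle_in_unit[of "x+d" y] by (intro mult_left_le) auto
  ultimately show ?thesis by simp
qed

lemma L_add_snd_le:
  assumes "0 \<le> x" "0 \<le> y" "0 \<le> d" shows "L x (y + d) \<le> L x y + d"
  using stable_tail.L_add_fst_le[OF reflect, of y x d] assms by simp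

lemma L_lipschitz:
  assumes "0 \<le> x" "0 \<le> y" "0 \<le> x'" "0 \<le> y'"
  shows "\<bar>L x y - L x' y'\<bar> \<le> \<bar>x - x'\<bar> + \<bar>y - y'\<bar>"
proof -
  have *: "L x y \<le> L x' y' + \<bar>x - x'\<bar> + \<bar>y - y'\<bar>"
    if "0 \<le> x" "0 \<le> y" "0 \<le> x'" "0 \<le> y'" for x y x' y'
  proof -
    have "L x y \<le> L (x' + \<bar>x - x'\<bar>) y" using that by (intro L_mono_fst) auto
    also have "\<dots> \<le> L x' y + \<bar>x - x'\<bar>" using that by (intro L_add_fst_le) auto
    also have "L x' y \<le> L x' (y' + \<bar>y - y'\<bar>)" using that by (intro L_mono_snd) auto
    also have "\<dots> \<le> L x' y' + \<bar>y - y'\<bar>" using that by (intro L_add_snd_le) auto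
    finally show ?thesis by simp
  qed
  show ?thesis using *[OF assms] *[OF assms(3,4,1,2)] by auto
qed

lemma tendsto_L:
  assumes "(u \<longlongrightarrow> x) F" "(v \<longlongrightarrow> y) F" "\<forall>\<^sub>F i in F. 0 \<le> u i" "\<forall>\<^sub>F i in F. 0 \<le> v i" "0 \<le> x" "0 \<le> y"
  shows "((\<lambda>i. L (u i) (v i)) \<longlongrightarrow> L x y) F"
proof -
  have lim: "((\<lambda>i. \<bar>u i - x\<bar> + \<bar>v i - y\<bar>) \<longlongrightarrow> 0) F"
    using tendsto_add[OF tendsto_rabs_zero[OF LIM_zero[OF assms(1)]] tendsto_rabs_zero[OF LIM_zero[OF assms(2)]]]
    by simp
  have "\<forall>\<^sub>F i in F. norm (L (u i) (v i) - L x y) \<le> \<bar>u i - x\<bar> + \<bar>v i - y\<bar>"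
    using assms(3,4) by eventually_elim (use L_lipschitz assms(5,6) in auto)
  then have "((\<lambda>i. L (u i) (v i) - L x y) \<longlongrightarrow> 0) F"
    by (rule Lim_null_comparison[OF _ lim])
  then show ?thesis by (rule LIM_zero_cancel)
qed

lemma continuous_on_L [continuous_intros]:
  assumes "continuous_on S u" "continuous_on S v" "\<And>i. i \<in> S \<Longrightarrow> 0 \<le> u i" "\<And>i. i \<in> S \<Longrightarrow> 0 \<le> v i"
  shows "continuous_on S (\<lambda>i. L (u i) (v i))"
  unfolding continuous_on_def
proof
  fix i assume "i \<in> S"
  with assms show "((\<lambda>i. L (u i) (v i)) \<longlongrightarrow> L (u i) (v i)) (at i within S)"
    unfolding continuous_on_def by (intro tendsto_L) (auto simp: eventually_at_filter)
qed

lemma continuous_on_A [continuous_intros]: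
  assumes "continuous_on S u" shows "continuous_on S (\<lambda>i. A (u i))"
  by (rule continuous_on_compose2[OF _ assms, where g=A and t=UNIV])
    (auto intro: contA continuous_at_imp_continuous_on)

lemma continuous_on_B [continuous_intros]:
  assumes "continuous_on S u" shows "continuous_on S (\<lambda>i. B (u i))"
  by (rule continuous_on_compose2[OF _ assms, where g=B and t=UNIV])
    (auto intro: contB continuous_at_imp_continuous_on)

lemma has_derivative_L_fst:
  assumes "0 < x" "0 < y"
  shows "((\<lambda>x. L x y) has_real_derivative A (y / (x + y))) (at x)"
proof (rule has_real_derivative_subgradient[where S="{0<..}" and G="\<lambda>x. A (y / (x + y))"])
  fix u v :: real assume "u \<in> {0<..}" "v \<in> {0<..}"
  then show "(v - u) * A (y / (u + y)) \<le> L v y - L u y" using L_diff_ge[of u y v y] assms by auto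
next
  show "isCont (\<lambda>x. A (y / (x + y))) x"
  proof (rule isCont_o2[where g=A])
    show "isCont (\<lambda>x. y / (x + y)) x" using assms by (intro continuous_intros) auto
  qed (rule contA)
qed (use assms in auto)

lemma has_derivative_L_snd:
  assumes "0 < x" "0 < y"
  shows "((\<lambda>y. L x y) has_real_derivative B (y / (x + y))) (at y)"
proof -
  have "1 - x / (y + x) = y / (x + y)" using assms by (simp add: field_simps)
  then show ?thesis using stable_tail.has_derivative_L_fst[OF reflect, of y x] assms by simp
qed

end

lemma filterlim_one_minus_right_left: "filterlim (\<lambda>t::real. 1 - t) (at_left 1) (at_right 0)"
  unfolding filterlim_at
  by (auto intro!: tendsto_eq_intros simp: eventually_at_filter)

lemma filterlim_one_minus_left_right: "filterlim (\<lambda>t::real. 1 - t) (at_right 0) (at_left 1)"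
  unfolding filterlim_at
  by (auto intro!: tendsto_eq_intros simp: eventually_at_filter)

lemma eventually_at_right_0_lt_1: "\<forall>\<^sub>F t in at_right (0::real). 0 < t \<and> t < 1"
  by (rule eventually_mono[OF eventually_at_right_real[of 0 1]]) auto

lemma eventually_at_left_1_gt_0: "\<forall>\<^sub>F t in at_left (1::real). 0 < t \<and> t < 1"
  by (rule eventually_mono[OF eventually_at_left_real[of 0 1]]) auto

context stable_tail
begin

text \<open>If \<open>exp (- L x y)\<close> is the joint survival function of two standard exponential variables, this is the
  probability that the first exceeds \<open>x\<close> given that the second equals \<open>y\<close>.\<close>
definition cond_surv :: "real \<Rightarrow> real \<Rightarrow> real" where
  "cond_surv x y = B (y / (x + y)) * exp (y - L x y)"

lemma reflect_angle: "0 < x + y \<Longrightarrow> 1 - x / (y + x) = y / (x + y :: real)"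
  by (simp add: field_simps)

end

text \<open>Since \<open>\<kappa> t = t * B' t\<close>, and also \<open>\<kappa> t = - (1 - t) * A' t\<close> by lemma \<open>has_derivative_A\<close> below, this normalisation is
  symmetric under reflection. For a spectral density \<open>h\<close> that is continuous at \<open>t\<close> it equals
  \<open>2 * t * (1 - t) * h t\<close>.\<close>
locale stable_tail_density = stable_tail +
  fixes \<kappa> :: "real \<Rightarrow> real" and s1 s2 :: real
  assumes dB: "0 < t \<Longrightarrow> t < 1 \<Longrightarrow> (B has_real_derivative \<kappa> t / t) (at t)"
    and s_gt: "- 1 < s1" "- 1 < s2"
    and \<kappa>_right: "\<exists>k>0. ((\<lambda>t. \<kappa> t / t powr (s2 + 1)) \<longlongrightarrow> k) (at_right 0)"
    and \<kappa>_left: "\<exists>k>0. ((\<lambda>t. \<kappa> t / (1 - t) powr (s1 + 1)) \<longlongrightarrow> k) (at_left 1)"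
begin

text \<open>The density, that is the mixed partial derivative, of the joint survival function \<open>exp (- L x y)\<close>.\<close>
definition surv_dens :: "real \<Rightarrow> real \<Rightarrow> real" where
  "surv_dens x y = exp (- L x y) *
     (A (y / (x + y)) * B (y / (x + y)) + \<kappa> (y / (x + y)) / (x + y))"

text \<open>Along the segment \<open>t \<mapsto> L (1 - t) t\<close> the derivative is \<open>B - A\<close>, which is enough to express \<open>A\<close> through \<open>L\<close>
  and \<open>B\<close> and hence to differentiate it. In particular the two mixed second derivatives of \<open>L\<close> agree, which the
  vine density relies on: it contains one of them for the pair (2,3), and is integrated through the other.\<close>
lemma has_derivative_A:
  assumes "0 < t" "t < 1"
  shows "(A has_real_derivative - \<kappa> t / (1 - t)) (at t)"
proof -
  define F where "F t = L (1 - t) t" for t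
  have F_eq: "F t = (1 - t) * A t + t * B t" if "0 < t" "t < 1" for t
    using L_eq[of "1 - t" t] that by (simp add: F_def)
  have "(F has_real_derivative B t - A t) (at t)"
  proof (rule has_real_derivative_subgradient[where S="{0<..<1}" and G="\<lambda>t. B t - A t"])
    fix u v :: real assume "u \<in> {0<..<1}" "v \<in> {0<..<1}"
    then show "(v - u) * (B u - A u) \<le> F v - F u"
      using L_diff_ge[of "1 - u" u "1 - v" v] by (auto simp: F_def algebra_simps)
  next
    show "isCont (\<lambda>t. B t - A t) t" by (intro continuous_intros contA contB)
  qed (use assms in auto)
  then have "((\<lambda>t. (F t - t * B t) / (1 - t)) has_real_derivative
     (((B t - A t) - (1 * B t + \<kappa> t / t * t)) * (1 - t) - (F t - t * B t) * (0 - 1)) / ((1 - t) * (1 - t))) (at t)"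
    using assms by (intro DERIV_divide DERIV_diff DERIV_mult dB DERIV_const DERIV_ident) auto
  also have "(((B t - A t) - (1 * B t + \<kappa> t / t * t)) * (1 - t) - (F t - t * B t) * (0 - 1)) / ((1 - t) * (1 - t))
     = - \<kappa> t / (1 - t)"
  proof -
    have "((B t - A t) - (1 * B t + \<kappa> t / t * t)) * (1 - t) - (F t - t * B t) * (0 - 1) = - \<kappa> t * (1 - t)"
      using assms by (simp add: F_eq algebra_simps)
    then show ?thesis using assms by simp
  qed
  finally show ?thesis
    by (rule has_field_derivative_transform_within_open[where S="{0<..<1}"])
      (use assms in \<open>auto simp: F_eq\<close>)
qed

lemma reflect_density:
  "stable_tail_density (\<lambda>x y. L y x) (\<lambda>t. B (1 - t)) (\<lambda>t. A (1 - t)) (\<lambda>t. \<kappa> (1 - t)) s2 s1"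
proof -
  interpret R: stable_tail "\<lambda>x y. L y x" "\<lambda>t. B (1 - t)" "\<lambda>t. A (1 - t)"
  by (rule reflect)
  show ?thesis
  proof
    fix t :: real assume t: "0 < t" "t < 1"
    have "((\<lambda>t. A (1 - t)) has_real_derivative (- \<kappa> (1 - t) / (1 - (1 - t))) * (0 - 1)) (at t)"
      using t by (intro DERIV_chain2[where f=A] has_derivative_A DERIV_diff DERIV_const DERIV_ident) auto
    then show "((\<lambda>t. A (1 - t)) has_real_derivative \<kappa> (1 - t) / t) (at t)" by simp
  next
    obtain k where "k > 0" and k: "((\<lambda>t. \<kappa> t / (1 - t) powr (s1 + 1)) \<longlongrightarrow> k) (at_left 1)"
      using \<kappa>_left by blast
    then show "\<exists>k>0. ((\<lambda>t. \<kappa> (1 - t) / t powr (s1 + 1)) \<longlongrightarrow> k) (at_right 0)"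
      using filterlim_compose[OF k filterlim_one_minus_right_left] by auto
  next
    obtain k where "k > 0" and k: "((\<lambda>t. \<kappa> t / t powr (s2 + 1)) \<longlongrightarrow> k) (at_right 0)"
      using \<kappa>_right by blast
    then show "\<exists>k>0. ((\<lambda>t. \<kappa> (1 - t) / (1 - t) powr (s2 + 1)) \<longlongrightarrow> k) (at_left 1)"
      using filterlim_compose[OF k filterlim_one_minus_left_right] by auto
  qed (use s_gt in auto)
qed

lemma \<kappa>_nonneg: assumes "0 < t" "t < 1" shows "0 \<le> \<kappa> t"
proof -
  have "0 \<le> \<kappa> t / t"
    by (rule mono_on_imp_deriv_nonneg[OF _ dB[OF assms], of "{0..1}"])
      (use assms in \<open>auto intro!: mono_onI monoB\<close>)
  then show ?thesis using assms by (simp add: zero_le_divide_iff)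
qed

lemma \<kappa>_pos_right: obtains d where "0 < d" "d \<le> 1" "\<And>t. 0 < t \<Longrightarrow> t < d \<Longrightarrow> 0 < \<kappa> t"
proof -
  obtain k where "k > 0" and k: "((\<lambda>t. \<kappa> t / t powr (s2 + 1)) \<longlongrightarrow> k) (at_right 0)"
    using \<kappa>_right by blast
  have "\<forall>\<^sub>F t in at_right 0. 0 < \<kappa> t / t powr (s2 + 1)"
    using order_tendstoD(1)[OF k \<open>k > 0\<close>] .
  then have "\<forall>\<^sub>F t in at_right 0. 0 < \<kappa> t"
    by eventually_elim (auto simp: zero_less_divide_iff)
  then obtain d where "d > 0" "\<And>t. 0 < t \<Longrightarrow> t < d \<Longrightarrow> 0 < \<kappa> t"
    by (auto simp: eventually_at_right_field)
  then show ?thesis by (intro that[of "min d 1"]) auto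
qed

text \<open>\<open>\<kappa>\<close> is positive near 0 by its power law, so \<open>B\<close> increases strictly there.\<close>
lemma B_pos: assumes "0 < t" shows "0 < B t"
proof -
  obtain d where d: "0 < d" "d \<le> 1" "\<And>t. 0 < t \<Longrightarrow> t < d \<Longrightarrow> 0 < \<kappa> t"
    using \<kappa>_pos_right by blast
  have "B 0 < B (min t d)"
  proof (rule DERIV_pos_imp_increasing_open[where f=B])
    fix x assume "0 < x" "x < min t d"
    then show "\<exists>y. (B has_real_derivative y) (at x) \<and> 0 < y"
      using d dB[of x] by (intro exI[of _ "\<kappa> x / x"]) auto
  qed (use d assms in \<open>auto intro!: continuous_on_B continuous_on_id\<close>)
  then show ?thesis using monoB[of "min t d" t] by auto
qed

lemma A_lt_1: assumes "0 < t" shows "A t < 1"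
proof -
  obtain d where d: "0 < d" "d \<le> 1" "\<And>t. 0 < t \<Longrightarrow> t < d \<Longrightarrow> 0 < \<kappa> t"
    using \<kappa>_pos_right by blast
  have "A 0 > A (min t d)"
  proof (rule DERIV_neg_imp_decreasing_open[where f=A])
    fix x assume "0 < x" "x < min t d"
    then show "\<exists>y. (A has_real_derivative y) (at x) \<and> y < 0"
      using d has_derivative_A[of x] by (intro exI[of _ "- \<kappa> x / (1 - x)"]) (auto simp: divide_neg_pos)
  qed (use d assms in \<open>auto intro!: continuous_on_A continuous_on_id\<close>)
  then show ?thesis using antimonoA[of "min t d" t] by auto
qed

lemma A_pos: "t < 1 \<Longrightarrow> 0 < A t"
  using stable_tail_density.B_pos[OF reflect_density, of "1 - t"] by simp

lemma B_lt_1: "t < 1 \<Longrightarrow> B t < 1"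
  using stable_tail_density.A_lt_1[OF reflect_density, of "1 - t"] by simp

text \<open>Comparison with the point \<open>x / 2\<close>, where the derivative \<open>A\<close> is already positive.\<close>
lemma L_gt_snd: assumes "0 < x" "0 \<le> y" shows "y < L x y"
proof -
  have "x / 2 * A (y / (x / 2 + y)) \<le> L x y - L (x / 2) y"
    using L_diff_ge[of "x / 2" y x y] assms by auto
  moreover have "0 < A (y / (x / 2 + y))" using assms by (intro A_pos) (auto simp: field_simps)
  ultimately show ?thesis using L_ge_snd[of y "x / 2"] assms
    by (smt (verit) half_gt_zero mult_pos_pos)
qed

lemma L_gt_fst: "0 \<le> x \<Longrightarrow> 0 < y \<Longrightarrow> x < L x y"
  using stable_tail_density.L_gt_snd[OF reflect_density, of y x] by simp

lemma cond_surv_bounds: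
  assumes "0 < x" "0 < y" shows "0 < cond_surv x y" "cond_surv x y < 1" "cond_surv x y \<le> exp (y - L x y)"
proof -
  show "0 < cond_surv x y" using B_pos angle_in_open_unit[OF assms] by (auto simp: cond_surv_def)
  show le: "cond_surv x y \<le> exp (y - L x y)"
    unfolding cond_surv_def using B_bounds angle_in_unit[of x y] assms by (intro mult_left_le_one_le) auto
  have "exp (y - L x y) < 1" using L_gt_snd[of x y] assms by auto
  then show "cond_surv x y < 1" using le by linarith
qed

lemma surv_dens_pos: assumes "0 < x" "0 < y" shows "0 < surv_dens x y"
  using A_pos[of "y / (x + y)"] B_pos[of "y / (x + y)"] \<kappa>_nonneg[of "y / (x + y)"] angle_in_open_unit[OF assms] assms
  unfolding surv_dens_def by (intro mult_pos_pos add_pos_nonneg) auto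

lemma surv_dens_reflect:
  assumes "0 < x" "0 < y"
  shows "stable_tail_density.surv_dens (\<lambda>x y. L y x) (\<lambda>t. B (1 - t)) (\<lambda>t. A (1 - t)) (\<lambda>t. \<kappa> (1 - t)) x y = surv_dens y x"
  using assms reflect_angle[of y x]
  unfolding stable_tail_density.surv_dens_def[OF reflect_density] surv_dens_def by (simp add: ac_simps)

lemma angle_derivative:
  assumes "0 < x" "0 < (y::real)"
  shows "((\<lambda>x. y / (x + y)) has_real_derivative - y / (x + y)^2) (at x)"
  using assms by (auto intro!: derivative_eq_intros simp: power2_eq_square)

lemma has_derivative_cond_surv:
  assumes "0 < x" "0 < y"
  shows "((\<lambda>x. cond_surv x y) has_real_derivative - (exp y * surv_dens x y)) (at x)"
proof -
  let ?T = "y / (x + y)"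
  have "((\<lambda>x. B (y / (x + y)) * exp (y - L x y)) has_real_derivative
      \<kappa> ?T / ?T * (- y / (x + y)^2) * exp (y - L x y) + exp (y - L x y) * (0 - A ?T) * B ?T) (at x)"
    using angle_in_open_unit[OF assms] assms
    by (intro DERIV_mult DERIV_chain2[where f=B] dB angle_derivative DERIV_fun_exp DERIV_diff
        DERIV_const has_derivative_L_fst) auto
  moreover have "\<kappa> ?T / ?T * (- y / (x + y)^2) = - \<kappa> ?T / (x + y)"
    using assms by (auto simp: power2_eq_square)
  then have "\<kappa> ?T / ?T * (- y / (x + y)^2) * exp (y - L x y) + exp (y - L x y) * (0 - A ?T) * B ?T
      = - (exp y * surv_dens x y)"
    using exp_add[of y "- L x y"] by (simp add: surv_dens_def algebra_simps)
  ultimately show ?thesis by (simp add: cond_surv_def)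
qed

text \<open>The power law of \<open>B' t = \<kappa> t / t\<close> integrates to one of \<open>B\<close> by l'Hospital's rule.\<close>
lemma B_asymp: "\<exists>k>0. ((\<lambda>t. B t / t powr (s2 + 1)) \<longlongrightarrow> k) (at_right 0)"
proof -
  obtain k where "k > 0" and k: "((\<lambda>t. \<kappa> t / t powr (s2 + 1)) \<longlongrightarrow> k) (at_right 0)"
    using \<kappa>_right by blast
  have "((\<lambda>t. B t / t powr (s2 + 1)) \<longlongrightarrow> k / (s2 + 1)) (at_right 0)"
  proof (rule lhopital_right_0)
    have "(B \<longlongrightarrow> B 0) (at 0)" using contB[of 0] by (simp add: isCont_def)
    then show "(B \<longlongrightarrow> 0) (at_right 0)" by (auto intro: tendsto_mono[OF at_le])
    show "((\<lambda>t. t powr (s2 + 1)) \<longlongrightarrow> 0) (at_right 0)"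
      using s_gt eventually_at_right_0_lt_1
      by (intro tendsto_zero_powrI[where b="s2+1"]) (auto intro: tendsto_ident_at elim: eventually_mono)
    show "\<forall>\<^sub>F t in at_right 0. t powr (s2 + 1) \<noteq> 0"
      using eventually_at_right_0_lt_1 by eventually_elim auto
    show "\<forall>\<^sub>F t in at_right 0. (s2 + 1) * t powr s2 \<noteq> 0"
      using eventually_at_right_0_lt_1 by eventually_elim (use s_gt in auto)
    show "\<forall>\<^sub>F t in at_right 0. (B has_real_derivative \<kappa> t / t) (at t)"
      using eventually_at_right_0_lt_1 by eventually_elim (auto intro: dB)
    show "\<forall>\<^sub>F t in at_right 0. ((\<lambda>t. t powr (s2 + 1)) has_real_derivative (s2 + 1) * t powr s2) (at t)"
      using eventually_at_right_0_lt_1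
      by eventually_elim (auto intro!: derivative_eq_intros)
    have "((\<lambda>t. \<kappa> t / t powr (s2 + 1) / (s2 + 1)) \<longlongrightarrow> k / (s2 + 1)) (at_right 0)"
      using k s_gt by (intro tendsto_divide) auto
    moreover have "\<forall>\<^sub>F t in at_right 0. \<kappa> t / t powr (s2 + 1) / (s2 + 1) = \<kappa> t / t / ((s2 + 1) * t powr s2)"
      using eventually_at_right_0_lt_1 by eventually_elim (simp add: powr_add field_simps)
    ultimately show "((\<lambda>t. \<kappa> t / t / ((s2 + 1) * t powr s2)) \<longlongrightarrow> k / (s2 + 1)) (at_right 0)"
      by (rule Lim_transform_eventually)
  qed
  then show ?thesis using \<open>k > 0\<close> s_gt by (intro exI[of _ "k / (s2 + 1)"]) auto
qed

lemma A_asymp: "\<exists>k>0. ((\<lambda>t. A t / (1 - t) powr (s1 + 1)) \<longlongrightarrow> k) (at_left 1)"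
proof -
  obtain k where "k > 0" and k: "((\<lambda>t. A (1 - t) / t powr (s1 + 1)) \<longlongrightarrow> k) (at_right 0)"
    using stable_tail_density.B_asymp[OF reflect_density] by blast
  then show ?thesis
    using filterlim_compose[OF k filterlim_one_minus_left_right] by auto
qed

end

section \<open>Spectral measures\<close>

definition stdf :: "real measure \<Rightarrow> real \<Rightarrow> real \<Rightarrow> real" where
  "stdf H a b = exponent_measure H (inverse a) (inverse b)"

definition upper_mass :: "real measure \<Rightarrow> real \<Rightarrow> real" where
  "upper_mass H t = 2 * (\<integral>w. w * indicator {t<..} w \<partial>H)"

definition lower_mass :: "real measure \<Rightarrow> real \<Rightarrow> real" where
  "lower_mass H t = 2 * (\<integral>w. (1 - w) * indicator {..t} w \<partial>H)"

locale spectral =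
  fixes H :: "real measure" and h :: "real \<Rightarrow> real" and s1 s2 :: real
  assumes distr: "spectral_distribution H"
    and diff: "exponent_measure_differentiable H"
    and dens: "spectral_density H h"
    and tails: "spectral_tails h s1 s2"
begin

abbreviation "L \<equiv> stdf H"
abbreviation "A \<equiv> upper_mass H"
abbreviation "B \<equiv> lower_mass H"

sublocale real_distribution H
proof -
  interpret prob_space H using distr by (simp add: spectral_distribution_def)
  show "real_distribution H"
    using distr by unfold_locales (auto simp: spectral_distribution_def dest: sets_eq_imp_space_eq)
qed

text \<open>The spectral density cut to the open unit interval, so that it is nonnegative everywhere.\<close>
definition density01 :: "real \<Rightarrow> real" where "density01 w = h w * indicator {0<..<1} w"

lemma density01_meas [measurable]: "density01 \<in> borel_measurable borel"
proof -
  have [measurable]: "h \<in> borel_measurable borel" using dens by (simp add: spectral_density_def)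
  show ?thesis unfolding density01_def[abs_def] by measurable
qed

lemma density01_nonneg: "0 \<le> density01 w"
  using dens by (auto simp: density01_def spectral_density_def split: split_indicator)

lemma H_eq: "H = density lborel (\<lambda>w. ennreal (density01 w))"
proof -
  have "ennreal (h w) * indicator {0<..<1} w = ennreal (density01 w)" for w
  by (simp add: density01_def split: split_indicator)
  then show ?thesis using dens by (simp add: spectral_density_def)
qed

lemma meas_H: "g \<in> borel_measurable borel \<Longrightarrow> g \<in> borel_measurable H"
  using distr by (simp add: spectral_distribution_def measurable_def cong: measurable_cong_sets)

lemma AE_unit: "AE w in H. 0 < w \<and> w < 1"
proof -
  have "AE w in lborel. 0 < ennreal (density01 w) \<longrightarrow> 0 < w \<and> w < 1"
    by (intro always_eventually) (auto simp: density01_def indicator_def)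
  then show ?thesis by (subst H_eq) (simp add: AE_density del: AE_conj_iff)
qed

lemma integrable_unit:
  fixes g :: "real \<Rightarrow> real"
  assumes "g \<in> borel_measurable borel" "\<And>w. 0 < w \<Longrightarrow> w < 1 \<Longrightarrow> \<bar>g w\<bar> \<le> K"
  shows "integrable H g"
proof (rule integrable_const_bound)
  show "AE w in H. norm (g w) \<le> K" using AE_unit by eventually_elim (use assms in simp)
qed (use assms meas_H in simp)

lemma integral_cong_unit:
  fixes g k :: "real \<Rightarrow> real"
  assumes "g \<in> borel_measurable borel" "k \<in> borel_measurable borel" "\<And>w. 0 < w \<Longrightarrow> w < 1 \<Longrightarrow> g w = k w"
  shows "(\<integral>w. g w \<partial>H) = (\<integral>w. k w \<partial>H)"
proof (rule integral_cong_AE)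
  show "AE w in H. g w = k w" using AE_unit by eventually_elim (use assms in simp)
qed (use assms meas_H in simp_all)

lemma integrable_upper: "integrable H (\<lambda>w. w * indicator {t<..} w)"
  and integrable_lower: "integrable H (\<lambda>w. (1 - w) * indicator {..t} w)"
  and integrable_max: "integrable H (\<lambda>w. max (w * x) ((1 - w) * y))"
proof -
  show "integrable H (\<lambda>w. w * indicator {t<..} w)" "integrable H (\<lambda>w. (1 - w) * indicator {..t} w)"
    by (rule integrable_unit[where K=1]; simp split: split_indicator)+
  show "integrable H (\<lambda>w. max (w * x) ((1 - w) * y))"
  proof (rule integrable_unit[where K="\<bar>x\<bar> + \<bar>y\<bar>"])
    fix w :: real assume w: "0 < w" "w < 1"
    have "\<bar>w * x\<bar> \<le> \<bar>x\<bar>" "\<bar>(1 - w) * y\<bar> \<le> \<bar>y\<bar>"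
      using w by (auto simp: abs_mult intro!: mult_left_le_one_le)
    then show "\<bar>max (w * x) ((1 - w) * y)\<bar> \<le> \<bar>x\<bar> + \<bar>y\<bar>"
      by (auto simp: max_def)
  qed simp
qed

lemma L_eq_integral: "L x y = 2 * (\<integral>w. max (w * x) ((1 - w) * y) \<partial>H)"
  by (simp add: stdf_def exponent_measure_def divide_inverse)

lemma linear_combination:
  "x * A t + y * B t = 2 * (\<integral>w. x * (w * indicator {t<..} w) + y * ((1 - w) * indicator {..t} w) \<partial>H)"
proof -
  have "(\<integral>w. x * (w * indicator {t<..} w) + y * ((1 - w) * indicator {..t} w) \<partial>H)
      = x * (\<integral>w. w * indicator {t<..} w \<partial>H) + y * (\<integral>w. (1 - w) * indicator {..t} w \<partial>H)"
    using integrable_upper[of t] integrable_lower[of t] by simp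
  then show ?thesis by (simp add: upper_mass_def lower_mass_def)
qed

lemma B_diff:
  assumes "t \<le> t'"
  shows "B t' - B t = 2 * (\<integral>w. (1 - w) * indicator {t<..t'} w \<partial>H)"
proof -
  have "B t' - B t = 2 * (\<integral>w. (1 - w) * indicator {..t'} w - (1 - w) * indicator {..t} w \<partial>H)"
    using integrable_lower by (simp add: lower_mass_def)
  also have "(\<integral>w. (1 - w) * indicator {..t'} w - (1 - w) * indicator {..t} w \<partial>H) = (\<integral>w. (1 - w) * indicator {t<..t'} w \<partial>H)"
    using assms by (intro Bochner_Integration.integral_cong) (auto split: split_indicator)
  finally show ?thesis .
qed

lemma A_diff:
  assumes "t \<le> t'"
  shows "A t - A t' = 2 * (\<integral>w. w * indicator {t<..t'} w \<partial>H)"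
proof -
  have "A t - A t' = 2 * (\<integral>w. w * indicator {t<..} w - w * indicator {t'<..} w \<partial>H)"
    using integrable_upper by (simp add: upper_mass_def)
  also have "(\<integral>w. w * indicator {t<..} w - w * indicator {t'<..} w \<partial>H) = (\<integral>w. w * indicator {t<..t'} w \<partial>H)"
    using assms by (intro Bochner_Integration.integral_cong) (auto split: split_indicator)
  finally show ?thesis .
qed

lemma interval_integral_bounds:
  fixes g :: "real \<Rightarrow> real"
  assumes "g \<in> borel_measurable borel" "\<And>w. 0 < w \<Longrightarrow> w < 1 \<Longrightarrow> 0 \<le> g w \<and> g w \<le> 1" "t \<le> t'"
  shows "0 \<le> (\<integral>w. g w * indicator {t<..t'} w \<partial>H)"
    "(\<integral>w. g w * indicator {t<..t'} w \<partial>H) \<le> cdf H t' - cdf H t"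
proof -
  show "0 \<le> (\<integral>w. g w * indicator {t<..t'} w \<partial>H)"
  proof (rule integral_nonneg_AE)
    show "AE w in H. 0 \<le> g w * indicator {t<..t'} w"
      using AE_unit by eventually_elim (use assms in \<open>auto split: split_indicator\<close>)
  qed
  have "(\<integral>w. g w * indicator {t<..t'} w \<partial>H) \<le> (\<integral>w. indicator {t<..t'} w \<partial>H)"
  proof (rule integral_mono_AE)
    show "integrable H (\<lambda>w. g w * indicator {t<..t'} w)"
      using assms by (intro integrable_unit[where K=1]) (auto split: split_indicator)
    show "integrable H (indicat_real {t<..t'})" by (intro integrable_unit[where K=1]) auto
    show "AE w in H. g w * indicator {t<..t'} w \<le> indicat_real {t<..t'} w"
      using AE_unit by eventually_elim (use assms in \<open>auto split: split_indicator\<close>)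
  qed
  also have "\<dots> = measure H {t<..t'}" by simp
  also have "\<dots> = cdf H t' - cdf H t"
    using cdf_diff_eq[of t t'] assms by (cases "t = t'") auto
  finally show "(\<integral>w. g w * indicator {t<..t'} w \<partial>H) \<le> cdf H t' - cdf H t" .
qed

lemma no_atoms: "measure H {t} = 0"
proof -
  have "emeasure H {t} = (\<integral>\<^sup>+w. ennreal (density01 w) * indicator {t} w \<partial>lborel)"
    by (subst H_eq) (simp add: emeasure_density)
  also have "\<dots> = (\<integral>\<^sup>+w. 0 \<partial>(lborel :: real measure))"
    by (rule nn_integral_cong_AE, rule eventually_mono[OF AE_lborel_singleton[of t]]) (simp split: split_indicator)
  finally show ?thesis by (simp add: measure_def)
qed

lemma isCont_of_cdf_bound:
  fixes F :: "real \<Rightarrow> real"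
  assumes "\<And>u v. u \<le> v \<Longrightarrow> \<bar>F v - F u\<bar> \<le> 2 * (cdf H v - cdf H u)"
  shows "isCont F t"
proof -
  have "isCont (cdf H) t" using no_atoms by (simp add: isCont_cdf)
  then have "((\<lambda>u. norm (2 * (cdf H u - cdf H t))) \<longlongrightarrow> norm (2 * (cdf H t - cdf H t))) (at t)"
    unfolding isCont_def by (intro tendsto_intros)
  then have lim: "((\<lambda>u. norm (2 * (cdf H u - cdf H t))) \<longlongrightarrow> 0) (at t)" by simp
  have bnd: "norm (F u - F t) \<le> norm (2 * (cdf H u - cdf H t))" for u
    using assms[of t u] assms[of u t] by (cases "u \<le> t") auto
  have "((\<lambda>u. F u - F t) \<longlongrightarrow> 0) (at t)"
    by (rule Lim_null_comparison[OF _ lim]) (use bnd in \<open>auto intro: always_eventually\<close>)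
  then show ?thesis unfolding isCont_def by (rule LIM_zero_cancel)
qed

sublocale T: stable_tail L A B
proof
  fix x y t t' :: real
  have "(\<integral>w. x * (w * indicator {t<..} w) + y * ((1 - w) * indicator {..t} w) \<partial>H)
      \<le> (\<integral>w. max (w * x) ((1 - w) * y) \<partial>H)"
  proof (rule integral_mono)
    show "integrable H (\<lambda>w. x * (w * indicator {t<..} w) + y * ((1 - w) * indicator {..t} w))"
      by (intro Bochner_Integration.integrable_add integrable_mult_right impI integrable_upper integrable_lower)
  qed (rule integrable_max, auto split: split_indicator simp: mult.commute)
  then show "x * A t + y * B t \<le> L x y" unfolding linear_combination L_eq_integral by simp
  show "L x y = x * A (y / (x + y)) + y * B (y / (x + y))" if xy: "0 \<le> x" "0 \<le> y" "0 < x + y"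
    unfolding linear_combination L_eq_integral
  proof (intro arg_cong[where f="(*) 2"] Bochner_Integration.integral_cong refl)
    fix w :: real
    have "y / (x + y) < w \<longleftrightarrow> (1 - w) * y < w * x"
      using xy by (simp add: pos_divide_less_eq algebra_simps)
    then show "max (w * x) ((1 - w) * y) =
        x * (w * indicator {y / (x + y)<..} w) + y * ((1 - w) * indicator {..y / (x + y)} w)"
      by (auto split: split_indicator simp: mult.commute max_def)
  qed
  show "L 0 0 = 0" by (simp add: L_eq_integral)
  have A: "0 \<le> A u - A v \<and> A u - A v \<le> 2 * (cdf H v - cdf H u)"
    and B: "0 \<le> B v - B u \<and> B v - B u \<le> 2 * (cdf H v - cdf H u)" if "u \<le> v" for u v
    unfolding A_diff[OF that] B_diff[OF that]
    using interval_integral_bounds[of "\<lambda>w. w" u v] interval_integral_bounds[of "\<lambda>w. 1 - w" u v] that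
    by auto
  show "isCont A t" using A by (intro isCont_of_cdf_bound) (smt (verit))
  show "isCont B t" using B by (intro isCont_of_cdf_bound) (smt (verit))
  show "A t' \<le> A t" "B t \<le> B t'" if "t \<le> t'" using A B that by fastforce+
  have mean: "(\<integral>w. w \<partial>H) = 1 / 2" using distr by (simp add: spectral_distribution_def)
  have "(\<integral>w. w * indicator {0<..} w \<partial>H) = (\<integral>w. w \<partial>H)"
    by (rule integral_cong_unit) auto
  then show "A 0 = 1" using mean by (simp add: upper_mass_def)
  have "(\<integral>w. w * indicator {1<..} w \<partial>H) = (\<integral>w. 0 \<partial>H)"
    by (rule integral_cong_unit) auto
  then show "A 1 = 0" by (simp add: upper_mass_def)
  have "(\<integral>w. (1 - w) * indicator {..0} w \<partial>H) = (\<integral>w. 0 \<partial>H)"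
    by (rule integral_cong_unit) auto
  then show "B 0 = 0" by (simp add: lower_mass_def)
  have "(\<integral>w. (1 - w) * indicator {..1} w \<partial>H) = (\<integral>w. 1 - w \<partial>H)"
    by (rule integral_cong_unit) auto
  also have "\<dots> = (\<integral>w. 1 \<partial>H) - (\<integral>w. w \<partial>H)"
    by (intro Bochner_Integration.integral_diff integrable_unit[where K=1]) auto
  also have "\<dots> = 1 / 2" using mean prob_space by simp
  finally show "B 1 = 1" by (simp add: lower_mass_def)
qed

lemma exponent_measure_eq: "exponent_measure H x y = L (inverse x) (inverse y)"
  by (simp add: stdf_def)

lemma deriv_exponent_measure:
  assumes "0 < x" "0 < y"
  shows "deriv (\<lambda>y'. exponent_measure H x y') y = - B (x / (x + y)) / y^2"
proof (rule DERIV_imp_deriv)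
  have T: "inverse y / (inverse x + inverse y) = x / (x + y)" using assms by (simp add: field_simps)
  have "((\<lambda>y'. L (inverse x) (inverse y')) has_real_derivative
      B (inverse y / (inverse x + inverse y)) * - (inverse y * 1 * inverse y)) (at y)"
    using assms by (intro DERIV_chain2[where f="L (inverse x)"] T.has_derivative_L_snd DERIV_inverse') auto
  then show "((\<lambda>y'. exponent_measure H x y') has_real_derivative - B (x / (x + y)) / y^2) (at y)"
    unfolding exponent_measure_eq T by (simp add: power2_eq_square field_simps)
qed

text \<open>The assumed second derivative of the exponent measure is the derivative of \<open>x \<mapsto> - B (x / (x + y)) / y^2\<close>. With
  \<open>y = 1 - t\<close> the argument \<open>s * y / (1 - s)\<close> is the one whose angle is \<open>s\<close>.\<close>
lemma B_differentiable:
  assumes t: "0 < t" "t < 1" shows "(B has_real_derivative deriv B t) (at t)"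
proof -
  define y where "y = 1 - t"
  define \<phi> where "\<phi> x = deriv (\<lambda>y'. exponent_measure H x y') y" for x
  have y: "0 < y" using t by (simp add: y_def)
  have "\<phi> field_differentiable at t"
    using diff t y unfolding exponent_measure_differentiable_def \<phi>_def[abs_def] by blast
  then obtain D where D: "(\<phi> has_real_derivative D) (at t)"
    by (auto simp: field_differentiable_def)
  have at: "t * y / (1 - t) = t" using t by (simp add: y_def)
  have "((\<lambda>s. s * y / (1 - s)) has_real_derivative (1 * y * (1 - t) - t * y * (0 - 1)) / ((1 - t) * (1 - t))) (at t)"
    using t by (intro DERIV_divide DERIV_cmult_right DERIV_diff DERIV_ident DERIV_const) auto
  then obtain E where E: "((\<lambda>s. s * y / (1 - s)) has_real_derivative E) (at t)" by blast
  have "((\<lambda>s. - (y^2) * \<phi> (s * y / (1 - s))) has_real_derivative - (y^2) * (D * E)) (at t)"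
    using D by (intro DERIV_cmult DERIV_chain2[where f=\<phi>] E) (simp add: at)
  then have "(B has_real_derivative - (y^2) * (D * E)) (at t)"
  proof (rule has_field_derivative_transform_within_open[where S="{0<..<1}"])
    fix s :: real assume s: "s \<in> {0<..<1}"
    then have x: "0 < s * y / (1 - s)" using y by simp
    have "s * y / (1 - s) / (s * y / (1 - s) + y) = s" using s y by (simp add: field_simps)
    then show "- (y^2) * \<phi> (s * y / (1 - s)) = B s"
      unfolding \<phi>_def deriv_exponent_measure[OF x y] using y by simp
  qed (use t in auto)
  then show ?thesis using DERIV_imp_deriv by fastforce
qed

lemma B_increment:
  assumes "0 < t" "t \<le> t'" "t' < 1"
  shows "B t' - B t = 2 * (\<integral>w. (1 - w) * h w * indicator {t<..t'} w \<partial>lborel)"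
    and "integrable lborel (\<lambda>w. (1 - w) * h w * indicator {t<..t'} w)"
proof -
  have eq: "density01 w *\<^sub>R ((1 - w) * indicator {t<..t'} w) = (1 - w) * h w * indicator {t<..t'} w" for w
    using assms by (auto simp: density01_def split: split_indicator)
  have "(\<integral>w. (1 - w) * indicator {t<..t'} w \<partial>H) = (\<integral>w. density01 w *\<^sub>R ((1 - w) * indicator {t<..t'} w) \<partial>lborel)"
    by (subst H_eq, rule integral_density) (auto simp: density01_nonneg)
  then show "B t' - B t = 2 * (\<integral>w. (1 - w) * h w * indicator {t<..t'} w \<partial>lborel)"
    unfolding B_diff[OF assms(2)] eq by simp
  have "integrable H (\<lambda>w. (1 - w) * indicator {t<..t'} w)"
    by (rule integrable_unit[where K=1]) (auto split: split_indicator)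
  then have "integrable lborel (\<lambda>w. density01 w *\<^sub>R ((1 - w) * indicator {t<..t'} w))"
    by (subst (asm) H_eq, subst (asm) integrable_density) (auto simp: density01_nonneg)
  then show "integrable lborel (\<lambda>w. (1 - w) * h w * indicator {t<..t'} w)" unfolding eq .
qed

text \<open>\<open>h\<close> is one of many versions of the density, so \<open>deriv B t = 2 * (1 - t) * h t\<close> may fail at a given point.
  What holds at every point is that local bounds on the version carry over to the derivative, through the
  increments of \<open>B\<close>. The sign \<open>sgn'\<close> treats lower and upper bounds together.\<close>
lemma deriv_B_bound:
  assumes t: "0 < t" "t < 1" and ev: "\<forall>\<^sub>F w in nhds t. sgn' * r \<le> sgn' * ((1 - w) * h w)" and "sgn' = 1 \<or> sgn' = -1"
  shows "sgn' * (2 * r) \<le> sgn' * deriv B t"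
proof -
  obtain d where d: "0 < d" "\<And>w. dist w t < d \<Longrightarrow> sgn' * r \<le> sgn' * ((1 - w) * h w)"
    using ev by (auto simp: eventually_nhds_metric)
  have "((\<lambda>e. (B (t + e) - B t) / e) \<longlongrightarrow> deriv B t) (at 0)"
    using B_differentiable[OF t] by (simp add: DERIV_def)
  then have "((\<lambda>e. (B (t + e) - B t) / e) \<longlongrightarrow> deriv B t) (at_right 0)"
    by (rule tendsto_mono[OF at_le, rotated]) simp
  then have lim: "((\<lambda>e. sgn' * ((B (t + e) - B t) / e)) \<longlongrightarrow> sgn' * deriv B t) (at_right 0)"
    by (intro tendsto_intros)
  show ?thesis
  proof (rule tendsto_lowerbound[OF lim])
    have "\<forall>\<^sub>F e in at_right 0. e \<in> {0<..<min d (1 - t)}"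
      using d t by (intro eventually_at_right_real) auto
    then show "\<forall>\<^sub>F e in at_right 0. sgn' * (2 * r) \<le> sgn' * ((B (t + e) - B t) / e)"
    proof eventually_elim
      case (elim e)
      then have e: "0 < e" "e < d" "t + e < 1" by auto
      note inc = B_increment[of t "t + e"]
      have "(\<integral>w. sgn' * r * indicator {t<..t + e} w \<partial>lborel) \<le> (\<integral>w. sgn' * ((1 - w) * h w * indicator {t<..t + e} w) \<partial>lborel)"
        using inc(2) e t d(2) by (intro integral_mono) (auto split: split_indicator simp: dist_real_def)
      then have "sgn' * r * e \<le> sgn' * (\<integral>w. (1 - w) * h w * indicator {t<..t + e} w \<partial>lborel)"
        using e by simp
      then have "sgn' * (2 * r) * e \<le> sgn' * (B (t + e) - B t)" using inc(1) e t by (simp add: mult_ac)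
      then have "sgn' * (2 * r) \<le> sgn' * (B (t + e) - B t) / e" using e by (simp add: pos_le_divide_eq)
      then show ?case by simp
    qed
  qed simp
qed

lemma deriv_B_ge:
  assumes t: "0 < t" "t < 1" and \<phi>: "isCont \<phi> t" "\<forall>\<^sub>F w in nhds t. \<phi> w \<le> (1 - w) * h w"
  shows "2 * \<phi> t \<le> deriv B t"
proof -
  have "r \<le> deriv B t / 2" if "r < \<phi> t" for r
  proof -
    have "\<forall>\<^sub>F w in nhds t. r < \<phi> w"
      using \<phi>(1) that unfolding isCont_def tendsto_at_iff_tendsto_nhds by (auto dest: order_tendstoD)
    then have "\<forall>\<^sub>F w in nhds t. 1 * r \<le> 1 * ((1 - w) * h w)"
      using \<phi>(2) by eventually_elim auto
    from deriv_B_bound[OF t this] show ?thesis by simp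
  qed
  then have "\<phi> t \<le> deriv B t / 2" by (rule dense_le)
  then show ?thesis by simp
qed

lemma deriv_B_le:
  assumes t: "0 < t" "t < 1" and \<phi>: "isCont \<phi> t" "\<forall>\<^sub>F w in nhds t. (1 - w) * h w \<le> \<phi> w"
  shows "deriv B t \<le> 2 * \<phi> t"
proof -
  have "deriv B t / 2 \<le> r" if "\<phi> t < r" for r
  proof -
    have "\<forall>\<^sub>F w in nhds t. \<phi> w < r"
      using \<phi>(1) that unfolding isCont_def tendsto_at_iff_tendsto_nhds by (auto dest: order_tendstoD)
    then have "\<forall>\<^sub>F w in nhds t. - 1 * r \<le> - 1 * ((1 - w) * h w)"
      using \<phi>(2) by eventually_elim auto
    from deriv_B_bound[OF t this] show ?thesis by simp
  qed
  then have "deriv B t / 2 \<le> \<phi> t" by (rule dense_ge)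
  then show ?thesis by simp
qed

text \<open>The asymptotic relation for \<open>h\<close> holds on a one-sided neighbourhood of the endpoint, hence near each of its
  points; this is the condition \<open>nested\<close>, and it lets the local bounds carry the relation over to the
  derivative.\<close>
lemma deriv_B_tail:
  assumes nested: "\<And>P. eventually P F \<Longrightarrow> \<forall>\<^sub>F t in F. \<forall>\<^sub>F w in nhds t. P w"
    and unit: "\<forall>\<^sub>F t in F. 0 < t \<and> t < (1::real)"
    and \<psi>: "\<And>t. 0 < t \<Longrightarrow> t < 1 \<Longrightarrow> isCont \<psi> t" "\<And>t. 0 < t \<Longrightarrow> t < 1 \<Longrightarrow> 0 < \<psi> t"
    and lim: "((\<lambda>w. h w / \<psi> w) \<longlongrightarrow> c) F"
  shows "((\<lambda>t. deriv B t / (2 * (1 - t) * \<psi> t)) \<longlongrightarrow> c) F"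
proof (rule tendstoI)
  fix e :: real assume "0 < e"
  define d where "d = e / 2"
  have d: "0 < d" "d < e" using \<open>0 < e\<close> by (auto simp: d_def)
  have "\<forall>\<^sub>F w in F. c - d < h w / \<psi> w \<and> h w / \<psi> w < c + d"
    using d by (intro eventually_conj order_tendstoD[OF lim]) auto
  then have "\<forall>\<^sub>F w in F. (c - d < h w / \<psi> w \<and> h w / \<psi> w < c + d) \<and> 0 < w \<and> w < 1"
    using unit by (rule eventually_conj)
  then have ev: "\<forall>\<^sub>F t in F. \<forall>\<^sub>F w in nhds t. (c - d < h w / \<psi> w \<and> h w / \<psi> w < c + d) \<and> 0 < w \<and> w < 1"
    by (rule nested)
  show "\<forall>\<^sub>F t in F. dist (deriv B t / (2 * (1 - t) * \<psi> t)) c < e"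
    using ev unit
  proof eventually_elim
    case (elim t)
    then have t: "0 < t" "t < 1" by auto
    have bounds: "\<forall>\<^sub>F w in nhds t. (1 - w) * ((c - d) * \<psi> w) \<le> (1 - w) * h w"
      "\<forall>\<^sub>F w in nhds t. (1 - w) * h w \<le> (1 - w) * ((c + d) * \<psi> w)"
      using elim(1)
      by (eventually_elim, use \<psi>(2) in \<open>auto simp: pos_less_divide_eq pos_divide_less_eq intro!: mult_left_mono\<close>)+
    have "2 * ((1 - t) * ((c - d) * \<psi> t)) \<le> deriv B t"
      by (rule deriv_B_ge[OF t _ bounds(1)]) (intro continuous_intros \<psi> t)
    then have "(c - d) * (2 * (1 - t) * \<psi> t) \<le> deriv B t" by (simp only: mult_ac)
    then have 1: "c - d \<le> deriv B t / (2 * (1 - t) * \<psi> t)"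
      using \<psi>(2)[OF t] t by (subst pos_le_divide_eq) auto
    have "deriv B t \<le> 2 * ((1 - t) * ((c + d) * \<psi> t))"
      by (rule deriv_B_le[OF t _ bounds(2)]) (intro continuous_intros \<psi> t)
    then have "deriv B t \<le> (c + d) * (2 * (1 - t) * \<psi> t)" by (simp only: mult_ac)
    then have 2: "deriv B t / (2 * (1 - t) * \<psi> t) \<le> c + d"
      using \<psi>(2)[OF t] t by (subst pos_divide_le_eq) auto
    show ?case using 1 2 d unfolding dist_real_def by linarith
  qed
qed

lemma nested_at_left: "eventually P (at_left x) \<Longrightarrow> \<forall>\<^sub>F t in at_left x. \<forall>\<^sub>F w in nhds t. P w" for x :: real
proof -
  assume "eventually P (at_left x)"
  then obtain b where b: "b < x" "\<And>y. b < y \<Longrightarrow> y < x \<Longrightarrow> P y"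
    by (auto simp: eventually_at_left_field)
  show ?thesis
    unfolding eventually_at_left_field
  proof (intro exI[of _ b] conjI allI impI b(1))
    fix t assume "b < t" "t < x"
    then have "\<forall>\<^sub>F w in nhds t. w \<in> {b<..<x}" by (intro eventually_nhds_in_open) auto
    then show "\<forall>\<^sub>F w in nhds t. P w" by eventually_elim (use b in auto)
  qed
qed

lemma nested_at_right: "eventually P (at_right x) \<Longrightarrow> \<forall>\<^sub>F t in at_right x. \<forall>\<^sub>F w in nhds t. P w" for x :: real
proof -
  assume "eventually P (at_right x)"
  then obtain b where b: "x < b" "\<And>y. x < y \<Longrightarrow> y < b \<Longrightarrow> P y"
    by (auto simp: eventually_at_right_field)
  show ?thesis
    unfolding eventually_at_right_field
  proof (intro exI[of _ b] conjI allI impI b(1))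
    fix t assume "x < t" "t < b"
    then have "\<forall>\<^sub>F w in nhds t. w \<in> {x<..<b}" by (intro eventually_nhds_in_open) auto
    then show "\<forall>\<^sub>F w in nhds t. P w" by eventually_elim (use b in auto)
  qed
qed

text \<open>The constant is positive because \<open>h\<close> is nonnegative.\<close>
lemma tail_limit:
  assumes eq: "h \<sim>[F] (\<lambda>w. c * \<psi> w)" and "c \<noteq> 0" and unit: "\<forall>\<^sub>F t in F. 0 < t \<and> t < (1::real)"
    and \<psi>: "\<And>t. 0 < t \<Longrightarrow> t < 1 \<Longrightarrow> 0 < \<psi> t" and "F \<noteq> bot"
  shows "0 < c" "((\<lambda>w. h w / \<psi> w) \<longlongrightarrow> c) F"
proof -
  have "((\<lambda>w. c * (if h w = 0 \<and> c * \<psi> w = 0 then 1 else h w / (c * \<psi> w))) \<longlongrightarrow> c * 1) F"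
    using eq unfolding asymp_equiv_def by (intro tendsto_intros)
  moreover have "\<forall>\<^sub>F w in F. c * (if h w = 0 \<and> c * \<psi> w = 0 then 1 else h w / (c * \<psi> w)) = h w / \<psi> w"
    using unit
  proof eventually_elim
    case (elim w)
    then have "0 < \<psi> w" by (simp add: \<psi>)
    then show ?case using \<open>c \<noteq> 0\<close> by simp
  qed
  ultimately show lim: "((\<lambda>w. h w / \<psi> w) \<longlongrightarrow> c) F"
    by (auto intro: Lim_transform_eventually)
  have h: "0 \<le> h w" if "0 < w" "w < 1" for w using dens that by (simp add: spectral_density_def)
  have "\<forall>\<^sub>F w in F. 0 \<le> h w / \<psi> w"
    using unit by eventually_elim (use \<psi> h in \<open>auto intro: divide_nonneg_pos\<close>)
  then have "0 \<le> c" by (rule tendsto_lowerbound[OF lim]) (rule \<open>F \<noteq> bot\<close>)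
  then show "0 < c" using \<open>c \<noteq> 0\<close> by simp
qed

sublocale S: stable_tail_density L A B "\<lambda>t. t * deriv B t" s1 s2
proof
  show "(B has_real_derivative t * deriv B t / t) (at t)" if "0 < t" "t < 1" for t
    using B_differentiable[OF that] that by simp
  show s: "-1 < s1" "-1 < s2" using tails by (auto simp: spectral_tails_def)
  obtain c2 where c2: "c2 \<noteq> 0" "h \<sim>[at_right 0] (\<lambda>w. c2 * w powr s2)"
    using tails by (auto simp: spectral_tails_def)
  have t2: "0 < c2" "((\<lambda>w. h w / w powr s2) \<longlongrightarrow> c2) (at_right 0)"
    using tail_limit[OF c2(2,1) eventually_at_right_0_lt_1] by auto
  have "((\<lambda>t. deriv B t / (2 * (1 - t) * t powr s2)) \<longlongrightarrow> c2) (at_right 0)"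
    by (rule deriv_B_tail[OF nested_at_right eventually_at_right_0_lt_1 _ _ t2(2)])
      (auto intro!: continuous_intros)
  then have "((\<lambda>t. 2 * (1 - t) * (deriv B t / (2 * (1 - t) * t powr s2))) \<longlongrightarrow> 2 * (1 - 0) * c2) (at_right 0)"
    by (intro tendsto_intros)
  moreover have "\<forall>\<^sub>F t in at_right 0. 2 * (1 - t) * (deriv B t / (2 * (1 - t) * t powr s2)) = t * deriv B t / t powr (s2 + 1)"
    using eventually_at_right_0_lt_1 by eventually_elim (simp add: powr_add)
  ultimately have "((\<lambda>t. t * deriv B t / t powr (s2 + 1)) \<longlongrightarrow> 2 * c2) (at_right 0)"
    by (auto intro: Lim_transform_eventually)
  then show "\<exists>k>0. ((\<lambda>t. t * deriv B t / t powr (s2 + 1)) \<longlongrightarrow> k) (at_right 0)"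
    using t2(1) by (intro exI[of _ "2 * c2"]) auto
  obtain c1 where c1: "c1 \<noteq> 0" "h \<sim>[at_left 1] (\<lambda>w. c1 * (1 - w) powr s1)"
    using tails by (auto simp: spectral_tails_def)
  have t1: "0 < c1" "((\<lambda>w. h w / (1 - w) powr s1) \<longlongrightarrow> c1) (at_left 1)"
    using tail_limit[OF c1(2,1) eventually_at_left_1_gt_0] by auto
  have "((\<lambda>t. deriv B t / (2 * (1 - t) * (1 - t) powr s1)) \<longlongrightarrow> c1) (at_left 1)"
    by (rule deriv_B_tail[OF nested_at_left eventually_at_left_1_gt_0 _ _ t1(2)])
      (auto intro!: continuous_intros)
  then have "((\<lambda>t. 2 * t * (deriv B t / (2 * (1 - t) * (1 - t) powr s1))) \<longlongrightarrow> 2 * 1 * c1) (at_left 1)"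
    by (intro tendsto_intros)
  moreover have "\<forall>\<^sub>F t in at_left 1. 2 * t * (deriv B t / (2 * (1 - t) * (1 - t) powr s1)) = t * deriv B t / (1 - t) powr (s1 + 1)"
    using eventually_at_left_1_gt_0
  proof eventually_elim
    case (elim t)
    have "2 * t * (D / (2 * u * P)) = t * D / (P * u)" for u P D :: real by simp
    from this[of "deriv B t" "1 - t" "(1 - t) powr s1"] elim show ?case by (simp only: powr_add) simp
  qed
  ultimately have "((\<lambda>t. t * deriv B t / (1 - t) powr (s1 + 1)) \<longlongrightarrow> 2 * c1) (at_left 1)"
    by (auto intro: Lim_transform_eventually)
  then show "\<exists>k>0. ((\<lambda>t. t * deriv B t / (1 - t) powr (s1 + 1)) \<longlongrightarrow> k) (at_left 1)"
    using t1(1) by (intro exI[of _ "2 * c1"]) auto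
qed

lemma deriv_B_interior:
  assumes "continuous_on {0<..<1} h" "\<forall>w\<in>{0<..<1}. 0 < h w" and t: "0 < t" "t < 1"
  shows "isCont (\<lambda>t. t * deriv B t) t" "0 < t * deriv B t"
proof -
  have h: "isCont h w" if "0 < w" "w < 1" for w
    using assms(1) that by (simp add: continuous_on_eq_continuous_at)
  have eq: "deriv B w = 2 * ((1 - w) * h w)" if w: "0 < w" "w < 1" for w
  proof (rule antisym)
    have c: "isCont (\<lambda>w. (1 - w) * h w) w" by (intro continuous_intros h w)
    show "deriv B w \<le> 2 * ((1 - w) * h w)" by (rule deriv_B_le[OF w c]) simp
    show "2 * ((1 - w) * h w) \<le> deriv B w" by (rule deriv_B_ge[OF w c]) simp
  qed
  show "0 < t * deriv B t" using eq[OF t] assms t by simp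
  have "isCont (\<lambda>t. t * (2 * ((1 - t) * h t))) t" by (intro continuous_intros h t)
  moreover have "\<forall>\<^sub>F w in nhds t. w \<in> {0<..<1}"
    using t by (intro eventually_nhds_in_open) auto
  then have "\<forall>\<^sub>F w in nhds t. w * deriv B w = w * (2 * ((1 - w) * h w))"
    by eventually_elim (use eq in auto)
  ultimately show "isCont (\<lambda>t. t * deriv B t) t" by (subst isCont_cong)
qed

end

section \<open>Exponential rates of the mixed derivative\<close>

lemma tendsto_ln_max_rate:
  fixes a b :: "real \<Rightarrow> real"
  assumes pos: "\<forall>\<^sub>F t in at_top. 0 < a t" "\<forall>\<^sub>F t in at_top. 0 < b t"
    and a: "((\<lambda>t. ln (a t) / t) \<longlongrightarrow> - \<alpha>) at_top" and b: "((\<lambda>t. ln (b t) / t) \<longlongrightarrow> - \<beta>) at_top"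
  shows "((\<lambda>t. ln (a t + b t) / t) \<longlongrightarrow> - min \<alpha> \<beta>) at_top"
proof (rule tendsto_sandwich)
  have max: "((\<lambda>t. max (ln (a t) / t) (ln (b t) / t)) \<longlongrightarrow> - min \<alpha> \<beta>) at_top"
    using tendsto_max[OF a b] by (simp add: minus_min_eq_max)
  show "((\<lambda>t. max (ln (a t) / t) (ln (b t) / t)) \<longlongrightarrow> - min \<alpha> \<beta>) at_top"
    by (rule max)
  have "((\<lambda>t. ln 2 / t) \<longlongrightarrow> (0::real)) at_top"
    by (intro tendsto_divide_0[OF tendsto_const]) (simp add: filterlim_at_top_imp_at_infinity filterlim_ident)
  from tendsto_add[OF this max]
  show "((\<lambda>t. ln 2 / t + max (ln (a t) / t) (ln (b t) / t)) \<longlongrightarrow> - min \<alpha> \<beta>) at_top" by simp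
  show "\<forall>\<^sub>F t in at_top. max (ln (a t) / t) (ln (b t) / t) \<le> ln (a t + b t) / t"
    using pos eventually_gt_at_top[of 0] by eventually_elim (auto simp: divide_right_mono)
  show "\<forall>\<^sub>F t in at_top. ln (a t + b t) / t \<le> ln 2 / t + max (ln (a t) / t) (ln (b t) / t)"
    using pos eventually_gt_at_top[of 0]
  proof eventually_elim
    case (elim t)
    have "ln (a t + b t) \<le> ln (2 * max (a t) (b t))" using elim by (subst ln_le_cancel_iff) auto
    also have "\<dots> = ln 2 + max (ln (a t)) (ln (b t))" using elim by (auto simp: ln_mult max_def)
    finally have "ln (a t + b t) / t \<le> (ln 2 + max (ln (a t)) (ln (b t))) / t"
      using elim by (intro divide_right_mono) auto
    also have "\<dots> = ln 2 / t + max (ln (a t) / t) (ln (b t) / t)"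
      using elim by (simp add: add_divide_distrib max_divide_distrib_right)
    finally show ?case .
  qed
qed

lemma tendsto_0_of_ln_rate:
  fixes c :: "real \<Rightarrow> real"
  assumes pos: "\<forall>\<^sub>F t in at_top. 0 < c t" and "((\<lambda>t. ln (c t) / t) \<longlongrightarrow> \<gamma>) at_top" "\<gamma> < 0"
  shows "(c \<longlongrightarrow> 0) at_top"
proof -
  have "filterlim (\<lambda>t. ln (c t) / t * t) at_bot at_top"
    by (rule filterlim_tendsto_neg_mult_at_bot[OF assms(2,3) filterlim_ident])
  then have "((\<lambda>t. exp (ln (c t) / t * t)) \<longlongrightarrow> 0) at_top"
    by (rule filterlim_compose[OF exp_at_bot])
  then show ?thesis
    by (rule Lim_transform_eventually)
      (use pos eventually_gt_at_top[of 0] in eventually_elim, auto)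
qed

lemma ln_rate_of_limit:
  fixes c :: "real \<Rightarrow> real"
  assumes "(c \<longlongrightarrow> k) at_top" "0 < k"
  shows "((\<lambda>t. ln (c t) / t) \<longlongrightarrow> 0) at_top"
  using assms by (intro real_tendsto_divide_at_top[OF tendsto_ln filterlim_ident]) auto

context stable_tail_density
begin

text \<open>Writing \<open>surv_dens a b = exp (- L a b) * \<Psi> / (a + b) * ((a + b) * A * B / \<Psi> + \<kappa> / \<Psi>)\<close>, the last factor
  tends to \<open>k\<close> because \<open>a + b\<close> tends to 0: the product of the first derivatives is negligible against
  the mixed derivative, and the rate is that of \<open>\<Psi> / (a + b)\<close>. The scale \<open>\<Psi>\<close> is the power
  law of \<open>\<kappa>\<close> when the angle tends to an endpoint, and constant when it stays inside.\<close>
lemma surv_dens_ln_rate_general: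
  fixes a b :: "real \<Rightarrow> real"
  assumes pos: "\<forall>\<^sub>F t in at_top. 0 < a t" "\<forall>\<^sub>F t in at_top. 0 < b t"
    and a: "((\<lambda>t. ln (a t) / t) \<longlongrightarrow> - \<alpha>) at_top" and b: "((\<lambda>t. ln (b t) / t) \<longlongrightarrow> - \<beta>) at_top"
    and rates: "0 < \<alpha>" "0 < \<beta>"
    and T_def: "\<And>t. T t = b t / (a t + b t)"
    and \<Psi>_pos: "\<forall>\<^sub>F t in at_top. 0 < \<Psi> t"
    and \<Psi>: "((\<lambda>t. ln (\<Psi> t) / t) \<longlongrightarrow> \<psi>) at_top"
    and AB: "((\<lambda>t. A (T t) * B (T t) / \<Psi> t) \<longlongrightarrow> c) at_top"
    and \<kappa>: "((\<lambda>t. \<kappa> (T t) / \<Psi> t) \<longlongrightarrow> k) at_top" "0 < k"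
  shows "((\<lambda>t. ln (surv_dens (a t) (b t)) / t) \<longlongrightarrow> \<psi> + min \<alpha> \<beta>) at_top"
proof -
  have lim: "(a \<longlongrightarrow> 0) at_top" "(b \<longlongrightarrow> 0) at_top"
    using tendsto_0_of_ln_rate[OF pos(1) a] tendsto_0_of_ln_rate[OF pos(2) b] rates by auto
  have "((\<lambda>t. L (a t) (b t)) \<longlongrightarrow> L 0 0) at_top"
    using lim pos by (intro tendsto_L) (auto elim: eventually_mono)
  then have limL: "((\<lambda>t. L (a t) (b t) / t) \<longlongrightarrow> 0) at_top"
    by (intro real_tendsto_divide_at_top[OF _ filterlim_ident])
  define M where "M t = (a t + b t) * (A (T t) * B (T t) / \<Psi> t) + \<kappa> (T t) / \<Psi> t" for t
  have "(M \<longlongrightarrow> (0 + 0) * c + k) at_top"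
    unfolding M_def by (intro tendsto_intros lim AB \<kappa>)
  then have M: "(M \<longlongrightarrow> k) at_top" by simp
  have "((\<lambda>t. ln (\<Psi> t) / t - ln (a t + b t) / t + ln (M t) / t - L (a t) (b t) / t) \<longlongrightarrow> \<psi> - (- min \<alpha> \<beta>) + 0 - 0) at_top"
    by (intro tendsto_intros \<Psi> tendsto_ln_max_rate[OF pos a b] ln_rate_of_limit[OF M \<kappa>(2)] limL)
  moreover have "\<forall>\<^sub>F t in at_top. ln (\<Psi> t) / t - ln (a t + b t) / t + ln (M t) / t - L (a t) (b t) / t = ln (surv_dens (a t) (b t)) / t"
    using pos \<Psi>_pos order_tendstoD(1)[OF M \<kappa>(2)]
  proof eventually_elim
    case (elim t)
    have "surv_dens (a t) (b t) = exp (- L (a t) (b t)) * (\<Psi> t / (a t + b t) * M t)"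
    proof -
      have "p + q / s = r / s * (s * (p / r) + q / r)" if "0 < s" "0 < r" for p q r s :: real
        using that by (simp add: field_simps)
      from this[of "a t + b t" "\<Psi> t" "A (T t) * B (T t)" "\<kappa> (T t)"]
      show ?thesis using elim by (simp add: surv_dens_def M_def T_def)
    qed
    also have "ln \<dots> = ln (\<Psi> t) - ln (a t + b t) + ln (M t) - L (a t) (b t)"
      using elim by (simp add: ln_mult_pos ln_div)
    finally show ?case by (simp add: diff_divide_distrib add_divide_distrib)
  qed
  ultimately show ?thesis by (auto intro: Lim_transform_eventually)
qed

lemma surv_dens_ln_rate_greater:
  fixes a b :: "real \<Rightarrow> real"
  assumes pos: "\<forall>\<^sub>F t in at_top. 0 < a t" "\<forall>\<^sub>F t in at_top. 0 < b t"
    and a: "((\<lambda>t. ln (a t) / t) \<longlongrightarrow> - \<alpha>) at_top" and b: "((\<lambda>t. ln (b t) / t) \<longlongrightarrow> - \<beta>) at_top"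
    and rates: "0 < \<beta>" "\<beta> < \<alpha>"
  shows "((\<lambda>t. ln (surv_dens (a t) (b t)) / t) \<longlongrightarrow> (s1 + 1) * (\<beta> - \<alpha>) + \<beta>) at_top"
proof -
  define T where "T t = b t / (a t + b t)" for t
  have T1: "\<forall>\<^sub>F t in at_top. 1 - T t = a t / (a t + b t) \<and> 0 < 1 - T t"
    using pos by eventually_elim (auto simp: T_def field_simps)
  have r: "((\<lambda>t. ln (1 - T t) / t) \<longlongrightarrow> \<beta> - \<alpha>) at_top"
  proof (rule Lim_transform_eventually)
    show "((\<lambda>t. ln (a t) / t - ln (a t + b t) / t) \<longlongrightarrow> \<beta> - \<alpha>) at_top"
      using tendsto_diff[OF a tendsto_ln_max_rate[OF pos a b]] rates by (simp add: min_def)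
    show "\<forall>\<^sub>F t in at_top. ln (a t) / t - ln (a t + b t) / t = ln (1 - T t) / t"
      using T1 pos by eventually_elim (simp add: ln_div diff_divide_distrib)
  qed
  have "\<forall>\<^sub>F t in at_top. 0 < 1 - T t" using T1 by (rule eventually_mono) simp
  then have "((\<lambda>t. 1 - T t) \<longlongrightarrow> 0) at_top"
    using r by (rule tendsto_0_of_ln_rate) (use rates in simp)
  from tendsto_diff[OF tendsto_const[of 1] this] have T: "(T \<longlongrightarrow> 1) at_top" by simp
  then have TF: "filterlim T (at_left 1) at_top"
    unfolding filterlim_at using T1 by (auto elim: eventually_mono)
  obtain k where k: "k > 0" "((\<lambda>t. \<kappa> t / (1 - t) powr (s1 + 1)) \<longlongrightarrow> k) (at_left 1)"
    using \<kappa>_left by blast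
  obtain c where c: "((\<lambda>t. A t / (1 - t) powr (s1 + 1)) \<longlongrightarrow> c) (at_left 1)"
    using A_asymp by blast
  have "((\<lambda>t. ln (surv_dens (a t) (b t)) / t) \<longlongrightarrow> (s1 + 1) * (\<beta> - \<alpha>) + min \<alpha> \<beta>) at_top"
  proof (rule surv_dens_ln_rate_general[OF pos a b _ _ T_def])
    show "\<forall>\<^sub>F t in at_top. 0 < (1 - T t) powr (s1 + 1)" using T1 by eventually_elim auto
    show "((\<lambda>t. ln ((1 - T t) powr (s1 + 1)) / t) \<longlongrightarrow> (s1 + 1) * (\<beta> - \<alpha>)) at_top"
    proof (rule Lim_transform_eventually)
      show "((\<lambda>t. (s1 + 1) * (ln (1 - T t) / t)) \<longlongrightarrow> (s1 + 1) * (\<beta> - \<alpha>)) at_top"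
        by (intro tendsto_intros r)
      show "\<forall>\<^sub>F t in at_top. (s1 + 1) * (ln (1 - T t) / t) = ln ((1 - T t) powr (s1 + 1)) / t"
        using T1 by eventually_elim (simp add: ln_powr)
    qed
    show "((\<lambda>t. \<kappa> (T t) / (1 - T t) powr (s1 + 1)) \<longlongrightarrow> k) at_top"
      by (rule filterlim_compose[OF k(2) TF])
    have "((\<lambda>t. A (T t) / (1 - T t) powr (s1 + 1)) \<longlongrightarrow> c) at_top"
      by (rule filterlim_compose[OF c TF])
    from tendsto_mult[OF this isCont_tendsto_compose[OF contB T]]
    show "((\<lambda>t. A (T t) * B (T t) / (1 - T t) powr (s1 + 1)) \<longlongrightarrow> c) at_top" by simp
  qed (use rates k in auto)
  then show ?thesis using rates by (simp add: min_def)
qed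

lemma surv_dens_ln_rate_less:
  fixes a b :: "real \<Rightarrow> real"
  assumes pos: "\<forall>\<^sub>F t in at_top. 0 < a t" "\<forall>\<^sub>F t in at_top. 0 < b t"
    and a: "((\<lambda>t. ln (a t) / t) \<longlongrightarrow> - \<alpha>) at_top" and b: "((\<lambda>t. ln (b t) / t) \<longlongrightarrow> - \<beta>) at_top"
    and rates: "0 < \<alpha>" "\<alpha> < \<beta>"
  shows "((\<lambda>t. ln (surv_dens (a t) (b t)) / t) \<longlongrightarrow> (s2 + 1) * (\<alpha> - \<beta>) + \<alpha>) at_top"
proof (rule Lim_transform_eventually)
  show "((\<lambda>t. ln (stable_tail_density.surv_dens (\<lambda>x y. L y x) (\<lambda>t. B (1 - t)) (\<lambda>t. A (1 - t))
      (\<lambda>t. \<kappa> (1 - t)) (b t) (a t)) / t) \<longlongrightarrow> (s2 + 1) * (\<alpha> - \<beta>) + \<alpha>) at_top"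
    using assms by (intro stable_tail_density.surv_dens_ln_rate_greater[OF reflect_density]) auto
qed (use pos in eventually_elim, simp add: surv_dens_reflect)

lemma surv_dens_ln_rate_equal:
  fixes a b :: "real \<Rightarrow> real"
  assumes pos: "\<forall>\<^sub>F t in at_top. 0 < a t" "\<forall>\<^sub>F t in at_top. 0 < b t"
    and a: "((\<lambda>t. ln (a t) / t) \<longlongrightarrow> - \<alpha>) at_top" and b: "((\<lambda>t. ln (b t) / t) \<longlongrightarrow> - \<alpha>) at_top"
    and rate: "0 < \<alpha>"
    and T: "((\<lambda>t. b t / (a t + b t)) \<longlongrightarrow> T0) at_top"
    and \<kappa>: "isCont \<kappa> T0" "0 < \<kappa> T0"
  shows "((\<lambda>t. ln (surv_dens (a t) (b t)) / t) \<longlongrightarrow> \<alpha>) at_top"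
proof -
  have "((\<lambda>t. ln (surv_dens (a t) (b t)) / t) \<longlongrightarrow> 0 + min \<alpha> \<alpha>) at_top"
  proof (rule surv_dens_ln_rate_general[OF pos a b _ _ refl, where \<Psi>="\<lambda>_. 1"])
    show "((\<lambda>t. \<kappa> (b t / (a t + b t)) / 1) \<longlongrightarrow> \<kappa> T0) at_top"
      using isCont_tendsto_compose[OF \<kappa>(1) T] by simp
    show "((\<lambda>t. A (b t / (a t + b t)) * B (b t / (a t + b t)) / 1) \<longlongrightarrow> A T0 * B T0 / 1) at_top"
      by (intro tendsto_intros isCont_tendsto_compose[OF contA T] isCont_tendsto_compose[OF contB T]) auto
  qed (use rate \<kappa> in auto)
  then show ?thesis by simp
qed

end

section \<open>Extreme value and inverted extreme value copulas\<close>

lemma neg_ln_bounds: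
  assumes "0 < (p::real)" "p < 1" shows "p \<le> - ln (1 - p)" "- ln (1 - p) \<le> p / (1 - p)"
proof -
  show "p \<le> - ln (1 - p)" using ln_le_minus_one[of "1 - p"] assms by simp
  have "ln (1 / (1 - p)) \<le> 1 / (1 - p) - 1" using assms by (intro ln_le_minus_one) auto
  also have "\<dots> = p / (1 - p)" using assms by (simp add: field_simps)
  finally show "- ln (1 - p) \<le> p / (1 - p)" using assms by (simp add: ln_div)
qed

context stable_tail_density
begin

definition ev :: "real \<Rightarrow> real \<Rightarrow> real" where
  "ev u v = exp (- L (- ln u) (- ln v))"

definition iev :: "real \<Rightarrow> real \<Rightarrow> real" where
  "iev u v = u + v - 1 + exp (- L (- ln (1 - u)) (- ln (1 - v)))"

lemma has_derivative_ev_snd: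
  assumes "0 < u" "u < 1" "0 < v" "v < 1"
  shows "((\<lambda>v. ev u v) has_real_derivative cond_surv (- ln u) (- ln v)) (at v)"
proof -
  let ?B = "B (- ln v / (- ln u + - ln v))"
  have pos: "0 < - ln u" "0 < - ln v" using assms by auto
  have "((\<lambda>v. exp (- L (- ln u) (- ln v))) has_real_derivative
      exp (- L (- ln u) (- ln v)) * - (?B * - (1 / v))) (at v)"
    using pos assms
    by (intro DERIV_fun_exp DERIV_minus DERIV_chain2[where f="L (- ln u)"] has_derivative_L_snd)
      (auto intro!: derivative_eq_intros)
  moreover have "exp (- L (- ln u) (- ln v)) * - (?B * - (1 / v)) = cond_surv (- ln u) (- ln v)"
    using assms by (simp add: cond_surv_def exp_diff exp_minus field_simps)
  ultimately show ?thesis unfolding ev_def by simp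
qed

lemma has_derivative_cond_surv_ln:
  assumes "0 < u" "u < 1" "0 < v" "v < 1"
  shows "((\<lambda>u. cond_surv (- ln u) (- ln v)) has_real_derivative surv_dens (- ln u) (- ln v) / (u * v)) (at u)"
proof -
  have pos: "0 < - ln u" "0 < - ln v" using assms by auto
  have "((\<lambda>u. cond_surv (- ln u) (- ln v)) has_real_derivative
      - (exp (- ln v) * surv_dens (- ln u) (- ln v)) * - (1 / u)) (at u)"
    using pos assms
    by (intro DERIV_chain2[where f="\<lambda>x. cond_surv x (- ln v)"] has_derivative_cond_surv)
      (auto intro!: derivative_eq_intros)
  moreover have "- (exp (- ln v) * surv_dens (- ln u) (- ln v)) * - (1 / u) = surv_dens (- ln u) (- ln v) / (u * v)"
    using assms by (simp add: exp_minus field_simps)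
  ultimately show ?thesis by simp
qed

text \<open>The inner derivative of the copula is \<open>cond_surv (- ln u) (- ln v)\<close>, so the outer one is its derivative.\<close>
lemma copula_density_ev:
  assumes "0 < u" "u < 1" "0 < v" "v < 1"
  shows "copula_density ev u v = surv_dens (- ln u) (- ln v) / (u * v)"
proof -
  have "((\<lambda>u'. deriv (\<lambda>v'. ev u' v') v) has_real_derivative surv_dens (- ln u) (- ln v) / (u * v)) (at u)"
    by (rule has_field_derivative_transform_within_open[OF has_derivative_cond_surv_ln[OF assms], where S="{0<..<1}"])
      (use assms in \<open>auto intro!: DERIV_imp_deriv[symmetric] has_derivative_ev_snd\<close>)
  then show ?thesis unfolding copula_density_def by (rule DERIV_imp_deriv)
qed

lemma has_derivative_neg_ln_1_minus:
  "(v::real) < 1 \<Longrightarrow> ((\<lambda>v. - ln (1 - v)) has_real_derivative 1 / (1 - v)) (at v)"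
  by (auto intro!: derivative_eq_intros)

lemma has_derivative_iev_snd:
  assumes "0 < u" "u < 1" "0 < y"
  shows "((\<lambda>v. iev u v) has_real_derivative 1 - cond_surv (- ln (1 - u)) y) (at (exp_cdf y))"
proof -
  let ?x = "- ln (1 - u)"
  have x: "0 < ?x" using assms by auto
  have "((\<lambda>v. u + v - 1 + exp (- L ?x (- ln (1 - v)))) has_real_derivative
      0 + 1 - 0 + exp (- L ?x (- ln (1 - exp_cdf y))) * - (B (y / (?x + y)) * (1 / (1 - exp_cdf y)))) (at (exp_cdf y))"
    using x assms
    by (intro DERIV_add DERIV_diff DERIV_const DERIV_ident DERIV_fun_exp DERIV_minus
        DERIV_chain2[where f="L ?x"] has_derivative_neg_ln_1_minus)
      (use has_derivative_L_snd[OF x assms(3)] assms in auto)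
  moreover have "0 + 1 - 0 + exp (- L ?x (- ln (1 - exp_cdf y))) * - (B (y / (?x + y)) * (1 / (1 - exp_cdf y))) = 1 - cond_surv ?x y"
  proof -
    have e: "1 / (1 - exp_cdf y) = exp y" by (simp add: exp_minus field_simps)
    have l: "- ln (1 - exp_cdf y) = y" by simp
    show ?thesis unfolding e l cond_surv_def by (simp add: exp_diff exp_minus field_simps)
  qed
  ultimately show ?thesis unfolding iev_def by simp
qed

text \<open>The conditional distribution of the second variable given the first one is that of the reflected
  function.\<close>
lemma has_derivative_iev_fst:
  assumes "0 < x" "0 < v" "v < 1"
  shows "((\<lambda>u. iev u v) has_real_derivative
    1 - stable_tail.cond_surv (\<lambda>x y. L y x) (\<lambda>t. A (1 - t)) (- ln (1 - v)) x) (at (exp_cdf x))"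
proof -
  interpret R: stable_tail_density "\<lambda>x y. L y x" "\<lambda>t. B (1 - t)" "\<lambda>t. A (1 - t)" "\<lambda>t. \<kappa> (1 - t)" s2 s1
    by (rule reflect_density)
  have "R.iev v u = iev u v" for u by (simp add: R.iev_def iev_def)
  then show ?thesis using R.has_derivative_iev_snd[OF assms(2,3,1)] by simp
qed

lemma copula_density_iev:
  assumes "0 < x" "0 < y"
  shows "copula_density iev (exp_cdf x) (exp_cdf y) = exp (x + y) * surv_dens x y"
proof -
  have "((\<lambda>u. 1 - cond_surv (- ln (1 - u)) y) has_real_derivative
      0 - - (exp y * surv_dens x y) * (1 / (1 - exp_cdf x))) (at (exp_cdf x))"
    using assms
    by (intro DERIV_diff DERIV_const DERIV_chain2[where f="\<lambda>x. cond_surv x y"]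
        has_derivative_neg_ln_1_minus) (auto intro: has_derivative_cond_surv)
  moreover have "0 - - (exp y * surv_dens x y) * (1 / (1 - exp_cdf x)) = exp (x + y) * surv_dens x y"
    by (simp add: exp_add exp_minus field_simps)
  ultimately have "((\<lambda>u. 1 - cond_surv (- ln (1 - u)) y) has_real_derivative exp (x + y) * surv_dens x y) (at (exp_cdf x))"
    by simp
  then have "((\<lambda>u'. deriv (\<lambda>v'. iev u' v') (exp_cdf y)) has_real_derivative exp (x + y) * surv_dens x y) (at (exp_cdf x))"
    by (rule has_field_derivative_transform_within_open[where S="{0<..<1}"])
      (use assms in \<open>auto intro!: DERIV_imp_deriv[symmetric] has_derivative_iev_snd\<close>)
  then show ?thesis unfolding copula_density_def by (rule DERIV_imp_deriv)
qed

lemma L_axis: "0 \<le> y \<Longrightarrow> L 0 y = y" "0 \<le> x \<Longrightarrow> L x 0 = x"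
  using L_ge_snd[of y 0] L_le_add[of 0 y] L_ge_fst[of x 0] L_le_add[of x 0] by auto

lemma tendsto_cond_surv_0:
  assumes "0 < b" and a: "(a \<longlongrightarrow> 0) F" "\<forall>\<^sub>F i in F. 0 < a i"
  shows "((\<lambda>i. cond_surv (a i) b) \<longlongrightarrow> 1) F"
proof -
  have "((\<lambda>i. b / (a i + b)) \<longlongrightarrow> b / (0 + b)) F"
    using assms by (intro tendsto_intros) auto
  then have "((\<lambda>i. b / (a i + b)) \<longlongrightarrow> 1) F" using assms by simp
  from isCont_tendsto_compose[OF contB this] have "((\<lambda>i. B (b / (a i + b))) \<longlongrightarrow> 1) F" by simp
  moreover have "((\<lambda>i. exp (b - L (a i) b)) \<longlongrightarrow> exp (b - L 0 b)) F"
    using assms by (intro tendsto_intros tendsto_L) (auto elim: eventually_mono)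
  then have "((\<lambda>i. exp (b - L (a i) b)) \<longlongrightarrow> 1) F" using assms by (simp add: L_axis)
  ultimately show ?thesis unfolding cond_surv_def using tendsto_mult by fastforce
qed

lemma tendsto_cond_surv_at_top:
  assumes "0 < y" shows "((\<lambda>x. cond_surv x y) \<longlongrightarrow> 0) at_top"
proof (rule tendsto_sandwich[OF _ _ tendsto_const])
  show "\<forall>\<^sub>F x in at_top. 0 \<le> cond_surv x y"
    using eventually_gt_at_top[of 0] by eventually_elim (simp add: assms cond_surv_bounds less_imp_le)
  show "\<forall>\<^sub>F x in at_top. cond_surv x y \<le> exp (y - x)"
    using eventually_gt_at_top[of 0]
  proof eventually_elim
    case (elim x)
    have "cond_surv x y \<le> exp (y - L x y)" using elim assms by (intro cond_surv_bounds)
    also have "\<dots> \<le> exp (y - x)" using L_ge_fst[of x y] by simp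
    finally show ?case .
  qed
  have "((\<lambda>x::real. exp (- x)) \<longlongrightarrow> 0) at_top"
    by (rule filterlim_compose[OF exp_at_bot filterlim_uminus_at_bot_at_top])
  from tendsto_mult_right_zero[OF this, of "exp y"]
  show "((\<lambda>x. exp (y - x)) \<longlongrightarrow> 0) at_top"
    by (simp add: exp_diff exp_minus divide_inverse)
qed

lemma continuous_on_cond_surv:
  assumes "continuous_on S u" "continuous_on S v" "\<And>i. i \<in> S \<Longrightarrow> 0 < u i" "\<And>i. i \<in> S \<Longrightarrow> 0 < v i"
  shows "continuous_on S (\<lambda>i. cond_surv (u i) (v i))"
proof -
  have "u i + v i \<noteq> 0" if "i \<in> S" for i using assms(3,4)[OF that] by simp
  then show ?thesis
    unfolding cond_surv_def using assms
    by (intro continuous_intros continuous_on_B continuous_on_L) (auto intro: less_imp_le)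
qed

lemma nn_integral_cond_surv:
  assumes "0 < x" "0 < z"
  shows "(\<integral>\<^sup>+y. ennreal (exp (- y) * cond_surv x y) * indicator {z..} y \<partial>lborel) = ennreal (exp (- L x z))"
proof -
  define f where "f y = indicat_real {z..} y * (exp (- y) * cond_surv x y)" for y
  have "(\<integral>\<^sup>+y. ennreal (f y) * indicator {z..} y \<partial>lborel) = ennreal (0 - (- exp (- L x z)))"
  proof (rule nn_integral_FTC_atLeast)
    show "f \<in> borel_measurable borel"
    proof -
      have "continuous_on {z..} (\<lambda>y. exp (- y) * cond_surv x y)"
        using assms by (intro continuous_intros continuous_on_cond_surv) auto
      from borel_measurable_continuous_on_indicator[OF _ this] show ?thesis
        unfolding f_def by simp
    qed
    fix y assume y: "z \<le> y"
    then have "0 < y" using assms by auto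
    have "((\<lambda>y. - exp (- L x y)) has_real_derivative - (exp (- L x y) * - B (y / (x + y)))) (at y)"
      using \<open>0 < y\<close> assms by (intro DERIV_minus DERIV_fun_exp has_derivative_L_snd)
    moreover have "- (exp (- L x y) * - B (y / (x + y))) = f y"
      using y by (simp add: f_def cond_surv_def exp_diff exp_minus field_simps)
    ultimately show "((\<lambda>y. - exp (- L x y)) has_real_derivative f y) (at y)" by simp
    show "0 \<le> f y" using cond_surv_bounds[of x y] \<open>0 < y\<close> assms by (simp add: f_def)
  next
    have "((\<lambda>y. exp (- L x y)) \<longlongrightarrow> 0) at_top"
    proof (rule tendsto_sandwich[OF _ _ tendsto_const])
      show "\<forall>\<^sub>F y in at_top. 0 \<le> exp (- L x y)" by simp
      show "\<forall>\<^sub>F y in at_top. exp (- L x y) \<le> exp (- y)"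
        by (intro always_eventually allI) (simp add: L_ge_snd)
      show "((\<lambda>y::real. exp (- y)) \<longlongrightarrow> 0) at_top"
        by (rule filterlim_compose[OF exp_at_bot filterlim_uminus_at_bot_at_top])
    qed
    from tendsto_minus[OF this]
    show "((\<lambda>y. - exp (- L x y)) \<longlongrightarrow> 0) at_top" by simp
  qed
  also have "(\<integral>\<^sup>+y. ennreal (f y) * indicator {z..} y \<partial>lborel)
      = (\<integral>\<^sup>+y. ennreal (exp (- y) * cond_surv x y) * indicator {z..} y \<partial>lborel)"
    by (intro nn_integral_cong) (auto simp: f_def split: split_indicator)
  finally show ?thesis by simp
qed

text \<open>The probability that both variables of the extreme value copula exceed levels with exceedance
  probabilities \<open>p\<close> and \<open>q\<close>.\<close>
definition joint_tail :: "real \<Rightarrow> real \<Rightarrow> real" where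
  "joint_tail p q = p + q - 1 + ev (1 - p) (1 - q)"

text \<open>The limit of \<open>joint_tail (s * a) (s * b) / s\<close> as \<open>s\<close> tends to 0.\<close>
definition tail_copula :: "real \<Rightarrow> real \<Rightarrow> real" where
  "tail_copula a b = a + b - L a b"

text \<open>A lower bound for the tail copula at \<open>(1, y)\<close> and \<open>(x, 1)\<close> with \<open>x, y \<ge> 1\<close>. It is positive because the spectral
  measure is not concentrated on the two endpoints.\<close>
definition \<rho> :: real where
  "\<rho> = min (1 - A (1/2)) (1 - B (1/2))"

lemma \<rho>_pos: "0 < \<rho>" using A_lt_1[of "1/2"] B_lt_1[of "1/2"] by (simp add: \<rho>_def)

lemma tail_copula_ge: assumes "0 < a" "0 < b" shows "\<rho> * min a b \<le> tail_copula a b"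
proof -
  let ?T = "b / (a + b)"
  have "L a b = a * A ?T + b * B ?T" using L_eq assms by auto
  then have eq: "tail_copula a b = a * (1 - A ?T) + b * (1 - B ?T)"
    by (simp add: tail_copula_def algebra_simps)
  have le: "A ?T \<le> 1" "B ?T \<le> 1" using A_bounds B_bounds angle_in_unit[of a b] assms by auto
  show ?thesis
  proof (cases "?T \<le> 1/2")
    case True
    then have "\<rho> * min a b \<le> (1 - B ?T) * b"
      using monoB[of ?T "1/2"] assms le by (intro mult_mono) (auto simp: \<rho>_def)
    also have "\<dots> \<le> tail_copula a b" using eq le assms by (simp add: mult.commute)
    finally show ?thesis .
  next
    case False
    then have "\<rho> * min a b \<le> (1 - A ?T) * a"
      using antimonoA[of "1/2" ?T] assms le by (intro mult_mono) (auto simp: \<rho>_def)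
    also have "\<dots> \<le> tail_copula a b" using eq le assms by (simp add: mult.commute)
    finally show ?thesis .
  qed
qed

lemma tail_copula_pos: "0 < a \<Longrightarrow> 0 < b \<Longrightarrow> 0 < tail_copula a b"
  using tail_copula_ge[of a b] \<rho>_pos by (smt (verit) min_def mult_pos_pos)

lemma tail_copula_le: "tail_copula a b \<le> a" "tail_copula a b \<le> b"
  using L_ge_fst[of a b] L_ge_snd[of b a] by (auto simp: tail_copula_def)

lemma tail_copula_homogeneous: "0 < t \<Longrightarrow> 0 \<le> a \<Longrightarrow> 0 \<le> b \<Longrightarrow> tail_copula (t * a) (t * b) = t * tail_copula a b"
  by (simp add: tail_copula_def L_homogeneous right_diff_distrib distrib_left)

lemma tail_copula_mono:
  assumes "0 \<le> a" "0 \<le> b" "a \<le> a'" "b \<le> b'" shows "tail_copula a b \<le> tail_copula a' b'"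
proof -
  have "L a' b' \<le> L a' b + (b' - b)" using L_add_snd_le[of a' b "b' - b"] assms by simp
  also have "L a' b \<le> L a b + (a' - a)" using L_add_fst_le[of a b "a' - a"] assms by simp
  finally show ?thesis by (simp add: tail_copula_def)
qed

text \<open>Independence plus a correction: in terms of \<open>a = - ln (1 - p)\<close> and \<open>b = - ln (1 - q)\<close> the copula is
  \<open>exp (- a) * exp (- b) * exp (R a b)\<close>, with \<open>R\<close> the tail copula.\<close>
lemma joint_tail_eq:
  assumes "0 < p" "p < 1" "0 < q" "q < 1"
  shows "joint_tail p q = p * q + (1 - p) * (1 - q) * (exp (tail_copula (- ln (1 - p)) (- ln (1 - q))) - 1)"
proof -
  have "ev (1 - p) (1 - q) = exp (ln (1 - p)) * exp (ln (1 - q)) * exp (tail_copula (- ln (1 - p)) (- ln (1 - q)))"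
    unfolding ev_def tail_copula_def by (simp flip: exp_add)
  also have "\<dots> = (1 - p) * (1 - q) * exp (tail_copula (- ln (1 - p)) (- ln (1 - q)))"
    using assms by simp
  finally show ?thesis by (simp add: joint_tail_def algebra_simps)
qed

lemma joint_tail_le:
  assumes "0 < p" "p < 1" "0 < q" "q < 1"
  shows "joint_tail p q \<le> p" "joint_tail p q \<le> q"
proof -
  have "ev (1 - p) (1 - q) \<le> exp (- (- ln (1 - q)))" unfolding ev_def
    using L_ge_snd[of "- ln (1 - q)" "- ln (1 - p)"] by simp
  then show "joint_tail p q \<le> p" using assms by (simp add: joint_tail_def)
  have "ev (1 - p) (1 - q) \<le> exp (- (- ln (1 - p)))" unfolding ev_def
    using L_ge_fst[of "- ln (1 - p)" "- ln (1 - q)"] by simp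
  then show "joint_tail p q \<le> q" using assms by (simp add: joint_tail_def)
qed

lemma joint_tail_pos:
  assumes "0 < p" "p < 1" "0 < q" "q < 1" shows "0 < joint_tail p q"
proof -
  have "0 < tail_copula (- ln (1 - p)) (- ln (1 - q))" using assms by (intro tail_copula_pos) auto
  then show ?thesis unfolding joint_tail_eq[OF assms] using assms by (intro add_pos_pos mult_pos_pos) auto
qed

lemma joint_tail_ge:
  assumes "0 < p" "p < 1" "0 < q" "q < 1"
  shows "(1 - p) * (1 - q) * tail_copula p q \<le> joint_tail p q"
proof -
  let ?a = "- ln (1 - p)" and ?b = "- ln (1 - q)"
  have "tail_copula p q \<le> tail_copula ?a ?b"
    using assms neg_ln_bounds[of p] neg_ln_bounds[of q] by (intro tail_copula_mono) auto
  also have "\<dots> \<le> exp (tail_copula ?a ?b) - 1"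
    using exp_ge_add_one_self[of "tail_copula ?a ?b"] by linarith
  finally have "(1 - p) * (1 - q) * tail_copula p q \<le> (1 - p) * (1 - q) * (exp (tail_copula ?a ?b) - 1)"
    using assms by (intro mult_left_mono) auto
  also have "\<dots> \<le> joint_tail p q" unfolding joint_tail_eq[OF assms] using assms by simp
  finally show ?thesis .
qed

lemma joint_tail_le_tail_copula:
  assumes d: "0 < d" "d < 1" and "0 < p" "p \<le> d" "0 < q" "q \<le> d"
  shows "joint_tail p q \<le> (d / \<rho> + exp (d / (1 - d)) / (1 - d)) * tail_copula p q"
proof -
  let ?a = "- ln (1 - p)" and ?b = "- ln (1 - q)"
  have pq: "0 < p" "p < 1" "0 < q" "q < 1" using assms by auto
  have R0: "0 \<le> tail_copula p q"
    using tail_copula_pos[OF pq(1,3)] by simp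
  have a: "0 \<le> ?a" "?a \<le> 1 / (1 - d) * p" and b: "0 \<le> ?b" "?b \<le> 1 / (1 - d) * q"
  proof -
    show "0 \<le> ?a" "0 \<le> ?b" using pq by auto
    have "?a \<le> p / (1 - p)" using neg_ln_bounds pq by blast
    also have "\<dots> \<le> p / (1 - d)" using assms by (intro divide_left_mono mult_pos_pos) auto
    finally show "?a \<le> 1 / (1 - d) * p" by simp
    have "?b \<le> q / (1 - q)" using neg_ln_bounds pq by blast
    also have "\<dots> \<le> q / (1 - d)" using assms by (intro divide_left_mono mult_pos_pos) auto
    finally show "?b \<le> 1 / (1 - d) * q" by simp
  qed
  have "tail_copula ?a ?b \<le> tail_copula (1 / (1 - d) * p) (1 / (1 - d) * q)"
    using a b by (intro tail_copula_mono)
  also have "\<dots> = 1 / (1 - d) * tail_copula p q" using pq d by (intro tail_copula_homogeneous) auto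
  finally have Rab: "tail_copula ?a ?b \<le> tail_copula p q / (1 - d)" by simp
  have "0 \<le> tail_copula ?a ?b" using pq by (intro less_imp_le[OF tail_copula_pos]) auto
  have "tail_copula ?a ?b \<le> 1 / (1 - d) * p" using tail_copula_le(1) a(2) by (rule order_trans)
  also have "\<dots> \<le> d / (1 - d)" using assms by (simp add: divide_right_mono)
  finally have Rd: "tail_copula ?a ?b \<le> d / (1 - d)" .
  have "exp (tail_copula ?a ?b) - 1 \<le> tail_copula ?a ?b * exp (tail_copula ?a ?b)"
    using exp_ge_add_one_self[of "- tail_copula ?a ?b"] by (simp add: exp_minus field_simps)
  also have "\<dots> \<le> tail_copula p q / (1 - d) * exp (d / (1 - d))"
    using Rab Rd \<open>0 \<le> tail_copula ?a ?b\<close> R0 d by (intro mult_mono) auto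
  finally have 1: "exp (tail_copula ?a ?b) - 1 \<le> tail_copula p q / (1 - d) * exp (d / (1 - d))" .
  have "(1 - p) * (1 - q) * (exp (tail_copula ?a ?b) - 1) \<le> 1 * (exp (tail_copula ?a ?b) - 1)"
    using pq \<open>0 \<le> tail_copula ?a ?b\<close> by (intro mult_right_mono mult_le_one) auto
  also have "\<dots> \<le> tail_copula p q / (1 - d) * exp (d / (1 - d))" using 1 by simp
  finally have 2: "(1 - p) * (1 - q) * (exp (tail_copula ?a ?b) - 1) \<le> tail_copula p q / (1 - d) * exp (d / (1 - d))" .
  have "p * q = max p q * min p q" by (cases "p \<le> q") (auto simp: max_def min_def)
  also have "\<dots> \<le> d * (tail_copula p q / \<rho>)"
    using tail_copula_ge[OF pq(1,3)] \<rho>_pos assms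
    by (intro mult_mono) (auto simp: pos_le_divide_eq mult.commute)
  finally have 3: "p * q \<le> d * (tail_copula p q / \<rho>)" .
  show ?thesis unfolding joint_tail_eq[OF pq] using 2 3 by (simp add: algebra_simps)
qed

text \<open>The equivalence is uniform over all ratios \<open>p / q\<close>. This uses that the tail copula is at least
  \<open>\<rho> * min p q\<close>, which beats the independence term \<open>p * q\<close>.\<close>
lemma joint_tail_asymp:
  assumes "0 < \<omega>"
  obtains d where "0 < d" "d < 1"
    "\<And>p q. 0 < p \<Longrightarrow> p \<le> d \<Longrightarrow> 0 < q \<Longrightarrow> q \<le> d \<Longrightarrow> (1 - \<omega>) * tail_copula p q \<le> joint_tail p q \<and> joint_tail p q \<le> (1 + \<omega>) * tail_copula p q"
proof -
  have "((\<lambda>d. d / \<rho> + exp (d / (1 - d)) / (1 - d)) \<longlongrightarrow> 0 / \<rho> + exp (0 / (1 - 0)) / (1 - 0)) (at_right 0)"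
    using \<rho>_pos by (intro tendsto_intros) auto
  then have 1: "\<forall>\<^sub>F d in at_right 0. d / \<rho> + exp (d / (1 - d)) / (1 - d) < 1 + \<omega>"
    using assms by (intro order_tendstoD(2)[where y="0 / \<rho> + exp (0 / (1 - 0)) / (1 - 0)"]) auto
  have "((\<lambda>d::real. (1 - d) * (1 - d)) \<longlongrightarrow> (1 - 0) * (1 - 0)) (at_right 0)"
    by (intro tendsto_intros)
  then have 2: "\<forall>\<^sub>F d::real in at_right 0. 1 - \<omega> < (1 - d) * (1 - d)"
    using assms by (intro order_tendstoD(1)[where y="(1 - 0) * (1 - 0)"]) auto
  have "\<exists>d. (d / \<rho> + exp (d / (1 - d)) / (1 - d) < 1 + \<omega> \<and> 1 - \<omega> < (1 - d) * (1 - d)) \<and> 0 < d \<and> d < 1"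
    by (rule eventually_happens'[OF _ eventually_conj[OF eventually_conj[OF 1 2] eventually_at_right_0_lt_1]]) simp
  then obtain d where d: "d / \<rho> + exp (d / (1 - d)) / (1 - d) < 1 + \<omega>" "1 - \<omega> < (1 - d) * (1 - d)" "0 < d" "d < 1"
    by blast
  show ?thesis
  proof (rule that[OF d(3,4)])
    fix p q assume *: "0 < p" "p \<le> d" "0 < q" "q \<le> d"
    have R0: "0 \<le> tail_copula p q"
      using tail_copula_pos[OF *(1,3)] by simp
    have "(1 - \<omega>) * tail_copula p q \<le> (1 - d) * (1 - d) * tail_copula p q"
      using d R0 by (intro mult_right_mono) auto
    also have "\<dots> \<le> (1 - p) * (1 - q) * tail_copula p q"
      using d * R0 by (intro mult_right_mono mult_mono) auto
    also have "\<dots> \<le> joint_tail p q" using * d by (intro joint_tail_ge) auto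
    finally have "(1 - \<omega>) * tail_copula p q \<le> joint_tail p q" .
    moreover have "joint_tail p q \<le> (d / \<rho> + exp (d / (1 - d)) / (1 - d)) * tail_copula p q"
      using * d by (intro joint_tail_le_tail_copula)
    moreover have "\<dots> \<le> (1 + \<omega>) * tail_copula p q" using d R0 by (intro mult_right_mono) auto
    ultimately show "(1 - \<omega>) * tail_copula p q \<le> joint_tail p q \<and> joint_tail p q \<le> (1 + \<omega>) * tail_copula p q" by linarith
  qed
qed

end

section \<open>The vine density along rays\<close>

lemma angle_scale: "0 < t \<Longrightarrow> t * y / (t * x + t * y) = y / (x + y :: real)"
  by (simp flip: distrib_left)

lemma neg_ln_equiv:
  fixes p :: "'a \<Rightarrow> real"
  assumes p: "(p \<longlongrightarrow> 0) F" "\<forall>\<^sub>F i in F. 0 < p i"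
  shows "((\<lambda>i. - ln (1 - p i) / p i) \<longlongrightarrow> 1) F"
proof (rule tendsto_sandwich)
  have ev: "\<forall>\<^sub>F i in F. 0 < p i \<and> p i < 1"
    using eventually_conj[OF p(2) order_tendstoD(2)[OF p(1) zero_less_one]] .
  show "\<forall>\<^sub>F i in F. 1 \<le> - ln (1 - p i) / p i"
    using ev
  proof eventually_elim
    case (elim i)
    then have "p i \<le> - ln (1 - p i)" by (intro neg_ln_bounds) auto
    then show ?case using elim by (subst pos_le_divide_eq) auto
  qed
  show "\<forall>\<^sub>F i in F. - ln (1 - p i) / p i \<le> 1 / (1 - p i)"
    using ev
  proof eventually_elim
    case (elim i)
    then have "- ln (1 - p i) \<le> p i / (1 - p i)" by (intro neg_ln_bounds) auto
    then show ?case using elim by (subst pos_divide_le_eq) auto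
  qed
  have "((\<lambda>i. 1 / (1 - p i)) \<longlongrightarrow> 1 / (1 - 0)) F"
    using p by (intro tendsto_intros) auto
  then show "((\<lambda>i. 1 / (1 - p i)) \<longlongrightarrow> 1) F" by simp
qed auto

lemma tendsto_const_over_t: "((\<lambda>t::real. c / t) \<longlongrightarrow> (0::real)) at_top"
  by (intro tendsto_divide_0[OF tendsto_const]) (simp add: filterlim_at_top_imp_at_infinity filterlim_ident)

lemma tendsto_exp_decay: assumes "0 < (c::real)" shows "((\<lambda>x. exp (- (x * c))) \<longlongrightarrow> 0) at_top"
proof -
  have "filterlim (\<lambda>x. x * c) at_top at_top"
    using assms by (intro filterlim_at_top_mult_tendsto_pos[OF tendsto_const _ filterlim_ident])
  then have "filterlim (\<lambda>x. - (x * c)) at_bot at_top" by (simp add: filterlim_uminus_at_top)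
  then show ?thesis by (rule filterlim_compose[OF exp_at_bot])
qed

context stable_tail_density
begin

lemma ln_surv_dens_rate:
  assumes "0 < x" "0 < y"
  shows "((\<lambda>t. ln (surv_dens (t * x) (t * y)) / t) \<longlongrightarrow> - L x y) at_top"
proof -
  let ?T = "y / (x + y)"
  define M where "M t = A ?T * B ?T + \<kappa> ?T / (x + y) / t" for t
  have pos: "0 < A ?T * B ?T" using A_pos B_pos angle_in_open_unit[OF assms] by simp
  have "(M \<longlongrightarrow> A ?T * B ?T + 0) at_top"
    unfolding M_def by (intro tendsto_add tendsto_const tendsto_const_over_t)
  then have M: "(M \<longlongrightarrow> A ?T * B ?T) at_top" by simp
  have "((\<lambda>t. - L x y + ln (M t) / t) \<longlongrightarrow> - L x y + 0) at_top"
    by (intro tendsto_intros ln_rate_of_limit[OF M pos])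
  moreover have "\<forall>\<^sub>F t in at_top. - L x y + ln (M t) / t = ln (surv_dens (t * x) (t * y)) / t"
    using order_tendstoD(1)[OF M pos] eventually_gt_at_top[of 0]
  proof eventually_elim
    case (elim t)
    have "surv_dens (t * x) (t * y) = exp (- (t * L x y)) * M t"
      using elim assms by (simp add: surv_dens_def M_def L_homogeneous angle_scale flip: distrib_left)
    then show ?case using elim by (simp add: ln_mult_pos diff_divide_distrib)
  qed
  ultimately show ?thesis by (auto intro: Lim_transform_eventually)
qed

lemma cond_surv_scale:
  "0 < t \<Longrightarrow> 0 < x \<Longrightarrow> 0 < y \<Longrightarrow> cond_surv (t * x) (t * y) = B (y / (x + y)) * exp (- t * (L x y - y))"
  by (simp add: cond_surv_def L_homogeneous angle_scale algebra_simps)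

text \<open>On a ray the angle is fixed, so \<open>cond_surv\<close> is an exact exponential; passing from \<open>p\<close> to
  \<open>- ln (1 - p)\<close> changes neither the rate nor the limit of ratios.\<close>
lemma cond_surv_ray:
  assumes "0 < x" "0 < y"
  shows "((\<lambda>t. cond_surv (t * x) (t * y)) \<longlongrightarrow> 0) at_top"
    and "((\<lambda>t. ln (- ln (1 - cond_surv (t * x) (t * y))) / t) \<longlongrightarrow> - (L x y - y)) at_top"
    and "((\<lambda>t. - ln (1 - cond_surv (t * x) (t * y)) / cond_surv (t * x) (t * y)) \<longlongrightarrow> 1) at_top"
proof -
  let ?p = "\<lambda>t. cond_surv (t * x) (t * y)"
  have pos: "0 < B (y / (x + y))" using B_pos angle_in_open_unit[OF assms] by simp
  have ev: "\<forall>\<^sub>F t in at_top. 0 < ?p t"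
    using eventually_gt_at_top[of 0] by eventually_elim (simp add: assms cond_surv_bounds)
  have "((\<lambda>t. ln (B (y / (x + y))) / t + - (L x y - y)) \<longlongrightarrow> 0 + - (L x y - y)) at_top"
    by (intro tendsto_add tendsto_const tendsto_const_over_t)
  moreover have "\<forall>\<^sub>F t in at_top. ln (B (y / (x + y))) / t + - (L x y - y) = ln (?p t) / t"
    using eventually_gt_at_top[of 0]
    by eventually_elim (use assms pos in \<open>simp add: cond_surv_scale ln_mult_pos add_divide_distrib diff_divide_distrib\<close>)
  ultimately have lnp: "((\<lambda>t. ln (?p t) / t) \<longlongrightarrow> - (L x y - y)) at_top"
    by (auto intro: Lim_transform_eventually)
  show lim: "(?p \<longlongrightarrow> 0) at_top"
    using tendsto_0_of_ln_rate[OF ev lnp] L_gt_snd[of x y] assms by simp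
  show r: "((\<lambda>t. - ln (1 - ?p t) / ?p t) \<longlongrightarrow> 1) at_top"
    by (rule neg_ln_equiv[OF lim ev])
  have "((\<lambda>t. ln (- ln (1 - ?p t) / ?p t) / t + ln (?p t) / t) \<longlongrightarrow> 0 + - (L x y - y)) at_top"
    by (intro tendsto_add lnp ln_rate_of_limit[OF r]) simp
  moreover have "\<forall>\<^sub>F t in at_top. ln (- ln (1 - ?p t) / ?p t) / t + ln (?p t) / t = ln (- ln (1 - ?p t)) / t"
    using eventually_gt_at_top[of 0]
  proof eventually_elim
    case (elim t)
    then have "0 < ?p t" "?p t < 1" using cond_surv_bounds[of "t * x" "t * y"] assms by auto
    then have "0 < - ln (1 - ?p t)" by simp
    then have "ln (- ln (1 - ?p t) / ?p t) = ln (- ln (1 - ?p t)) - ln (?p t)"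
      using \<open>0 < ?p t\<close> by (rule ln_divide_pos)
    then show ?case by (simp add: diff_divide_distrib)
  qed
  ultimately show "((\<lambda>t. ln (- ln (1 - ?p t)) / t) \<longlongrightarrow> - (L x y - y)) at_top"
    by (auto intro: Lim_transform_eventually)
qed

end

text \<open>The instances \<open>P\<close> and \<open>C\<close> stand for the pairs (1,2) and (1,3) given 2; \<open>Q\<close> is the reflection of
  the pair (2,3), so that in both \<open>P\<close> and \<open>Q\<close> the conditioning variable \<open>x2\<close> is the second argument.\<close>
locale vine =
  P: stable_tail_density LP AP BP \<kappa>P p1 p2 +
  Q: stable_tail_density LQ AQ BQ \<kappa>Q q1 q2 +
  C: stable_tail_density LC AC BC \<kappa>C s1 s2
  for LP AP BP \<kappa>P p1 p2 LQ AQ BQ \<kappa>Q q1 q2 LC AC BC \<kappa>C s1 s2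
begin

definition vine_formula :: "real \<Rightarrow> real \<Rightarrow> real \<Rightarrow> real" where
  "vine_formula x1 x2 x3 = exp (- x2) * (exp x2 * P.surv_dens x1 x2) * (exp x2 * Q.surv_dens x3 x2) *
     (C.surv_dens (- ln (1 - P.cond_surv x1 x2)) (- ln (1 - Q.cond_surv x3 x2))
       / ((1 - P.cond_surv x1 x2) * (1 - Q.cond_surv x3 x2)))"

lemma ln_vine_formula_rate:
  assumes x: "0 < x1" "0 < x2" "0 < x3"
    and C: "((\<lambda>t. ln (C.surv_dens (- ln (1 - P.cond_surv (t * x1) (t * x2))) (- ln (1 - Q.cond_surv (t * x3) (t * x2)))) / t) \<longlongrightarrow> c) at_top"
  shows "((\<lambda>t. - ln (vine_formula (t * x1) (t * x2) (t * x3)) / t) \<longlongrightarrow> LP x1 x2 + LQ x3 x2 - x2 - c) at_top"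
proof -
  let ?u = "\<lambda>t. 1 - P.cond_surv (t * x1) (t * x2)" and ?v = "\<lambda>t. 1 - Q.cond_surv (t * x3) (t * x2)"
  have "(?u \<longlongrightarrow> 1 - 0) at_top" "(?v \<longlongrightarrow> 1 - 0) at_top"
    by (intro tendsto_intros P.cond_surv_ray Q.cond_surv_ray x)+
  then have uv: "((\<lambda>t. ln (?u t) / t) \<longlongrightarrow> 0) at_top" "((\<lambda>t. ln (?v t) / t) \<longlongrightarrow> 0) at_top"
    using ln_rate_of_limit[of ?u 1] ln_rate_of_limit[of ?v 1] by auto
  have "((\<lambda>t. - x2 - ln (P.surv_dens (t * x1) (t * x2)) / t - ln (Q.surv_dens (t * x3) (t * x2)) / t
       - ln (C.surv_dens (- ln (?u t)) (- ln (?v t))) / t + ln (?u t) / t + ln (?v t) / t)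
      \<longlongrightarrow> - x2 - (- LP x1 x2) - (- LQ x3 x2) - c + 0 + 0) at_top"
    by (intro tendsto_intros P.ln_surv_dens_rate Q.ln_surv_dens_rate C uv x)
  moreover have "\<forall>\<^sub>F t in at_top. - x2 - ln (P.surv_dens (t * x1) (t * x2)) / t - ln (Q.surv_dens (t * x3) (t * x2)) / t
       - ln (C.surv_dens (- ln (?u t)) (- ln (?v t))) / t + ln (?u t) / t + ln (?v t) / t
      = - ln (vine_formula (t * x1) (t * x2) (t * x3)) / t"
    using eventually_gt_at_top[of 0]
  proof eventually_elim
    case (elim t)
    have t: "0 < t * x1" "0 < t * x2" "0 < t * x3" using elim x by auto
    have uv: "0 < ?u t" "?u t < 1" "0 < ?v t" "?v t < 1"
      using P.cond_surv_bounds[OF t(1,2)] Q.cond_surv_bounds[OF t(3,2)] by auto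
    have pos: "0 < P.surv_dens (t * x1) (t * x2)" "0 < Q.surv_dens (t * x3) (t * x2)"
      "0 < C.surv_dens (- ln (?u t)) (- ln (?v t))"
      using P.surv_dens_pos[OF t(1,2)] Q.surv_dens_pos[OF t(3,2)] C.surv_dens_pos uv by auto
    have "ln (vine_formula (t * x1) (t * x2) (t * x3)) = t * x2 + ln (P.surv_dens (t * x1) (t * x2)) + ln (Q.surv_dens (t * x3) (t * x2))
       + ln (C.surv_dens (- ln (?u t)) (- ln (?v t))) - ln (?u t) - ln (?v t)"
      unfolding vine_formula_def using pos uv by (simp add: ln_mult_pos ln_div)
    then show ?case using elim by (simp add: add_divide_distrib diff_divide_distrib)
  qed
  ultimately show ?thesis by (auto intro: Lim_transform_eventually simp: algebra_simps)
qed

lemma ray_pos: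
  assumes x: "0 < x1" "0 < x2" "0 < x3"
  shows "\<forall>\<^sub>F t in at_top. 0 < - ln (1 - P.cond_surv (t * x1) (t * x2))"
    "\<forall>\<^sub>F t in at_top. 0 < - ln (1 - Q.cond_surv (t * x3) (t * x2))"
  using eventually_gt_at_top[of 0]
  by (eventually_elim, use P.cond_surv_bounds Q.cond_surv_bounds x in simp)+

lemma ln_vine_formula_rate_neq:
  assumes x: "0 < x1" "0 < x2" "0 < x3" and neq: "LP x1 x2 \<noteq> LQ x3 x2"
  shows "((\<lambda>t. - ln (vine_formula (t * x1) (t * x2) (t * x3)) / t) \<longlongrightarrow>
    (let sm = if LP x1 x2 \<ge> LQ x3 x2 then s1 else s2
     in (2 + sm) * max (LP x1 x2) (LQ x3 x2) - (1 + sm) * min (LP x1 x2) (LQ x3 x2))) at_top"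
proof (cases "LP x1 x2 > LQ x3 x2")
  case True
  have "((\<lambda>t. ln (C.surv_dens (- ln (1 - P.cond_surv (t * x1) (t * x2))) (- ln (1 - Q.cond_surv (t * x3) (t * x2)))) / t)
    \<longlongrightarrow> (s1 + 1) * ((LQ x3 x2 - x2) - (LP x1 x2 - x2)) + (LQ x3 x2 - x2)) at_top"
    using True Q.L_gt_snd[of x3 x2] x
    by (intro C.surv_dens_ln_rate_greater ray_pos P.cond_surv_ray Q.cond_surv_ray) auto
  from ln_vine_formula_rate[OF x this] True show ?thesis by (simp add: Let_def algebra_simps)
next
  case False
  then have less: "LP x1 x2 < LQ x3 x2" using neq by simp
  have "((\<lambda>t. ln (C.surv_dens (- ln (1 - P.cond_surv (t * x1) (t * x2))) (- ln (1 - Q.cond_surv (t * x3) (t * x2)))) / t)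
    \<longlongrightarrow> (s2 + 1) * ((LP x1 x2 - x2) - (LQ x3 x2 - x2)) + (LP x1 x2 - x2)) at_top"
    using less P.L_gt_snd[of x1 x2] x
    by (intro C.surv_dens_ln_rate_less ray_pos P.cond_surv_ray Q.cond_surv_ray) auto
  from ln_vine_formula_rate[OF x this] less show ?thesis by (simp add: Let_def algebra_simps)
qed

text \<open>With equal rates \<open>p / q\<close> is constant on the ray, hence the angle \<open>b / (a + b)\<close> at which \<open>\<kappa>\<close> is
  evaluated converges to an interior point.\<close>
lemma ln_vine_formula_rate_eq:
  assumes x: "0 < x1" "0 < x2" "0 < x3" and eq: "LP x1 x2 = LQ x3 x2"
    and \<kappa>: "\<And>t. 0 < t \<Longrightarrow> t < 1 \<Longrightarrow> isCont \<kappa>C t" "\<And>t. 0 < t \<Longrightarrow> t < 1 \<Longrightarrow> 0 < \<kappa>C t"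
  shows "((\<lambda>t. - ln (vine_formula (t * x1) (t * x2) (t * x3)) / t) \<longlongrightarrow> LP x1 x2) at_top"
proof -
  let ?p = "\<lambda>t. P.cond_surv (t * x1) (t * x2)" and ?q = "\<lambda>t. Q.cond_surv (t * x3) (t * x2)"
  let ?a = "\<lambda>t. - ln (1 - ?p t)" and ?b = "\<lambda>t. - ln (1 - ?q t)"
  define \<beta>P where "\<beta>P = BP (x2 / (x1 + x2))"
  define \<beta>Q where "\<beta>Q = BQ (x2 / (x3 + x2))"
  have \<beta>: "0 < \<beta>P" "0 < \<beta>Q"
    unfolding \<beta>P_def \<beta>Q_def using P.B_pos Q.B_pos x by auto
  have "((\<lambda>t. (?b t / ?q t) * \<beta>Q / ((?a t / ?p t) * \<beta>P + (?b t / ?q t) * \<beta>Q)) \<longlongrightarrow> 1 * \<beta>Q / (1 * \<beta>P + 1 * \<beta>Q)) at_top"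
    using \<beta> by (intro tendsto_intros P.cond_surv_ray Q.cond_surv_ray x) auto
  moreover have "\<forall>\<^sub>F t in at_top. (?b t / ?q t) * \<beta>Q / ((?a t / ?p t) * \<beta>P + (?b t / ?q t) * \<beta>Q) = ?b t / (?a t + ?b t)"
    using eventually_gt_at_top[of 0]
  proof eventually_elim
    case (elim t)
    define e where "e = exp (- t * (LP x1 x2 - x2))"
    have "?p t = \<beta>P * e" "?q t = \<beta>Q * e"
      using elim x eq by (simp_all add: P.cond_surv_scale Q.cond_surv_scale \<beta>P_def \<beta>Q_def e_def)
    then have "(?b t / ?q t) * \<beta>Q = ?b t / e" "(?a t / ?p t) * \<beta>P = ?a t / e"
      using \<beta> by auto
    moreover have "e \<noteq> 0" by (simp add: e_def)
    moreover have "b / e / (a / e + b / e) = b / (a + b)" if "e \<noteq> 0" for a b e :: real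
      using that by (simp flip: add_divide_distrib)
    ultimately show ?case by (simp only:)
  qed
  ultimately have T: "((\<lambda>t. ?b t / (?a t + ?b t)) \<longlongrightarrow> \<beta>Q / (\<beta>P + \<beta>Q)) at_top"
    by (auto intro: Lim_transform_eventually)
  have "((\<lambda>t. ln (C.surv_dens (?a t) (?b t)) / t) \<longlongrightarrow> LP x1 x2 - x2) at_top"
  proof (rule C.surv_dens_ln_rate_equal[OF ray_pos[OF x] _ _ _ T])
    show "((\<lambda>t. ln (?b t) / t) \<longlongrightarrow> - (LP x1 x2 - x2)) at_top"
      using Q.cond_surv_ray(2)[of x3 x2] x eq by simp
    show "((\<lambda>t. ln (?a t) / t) \<longlongrightarrow> - (LP x1 x2 - x2)) at_top"
      by (intro P.cond_surv_ray x)
  qed (use \<beta> x P.L_gt_snd[of x1 x2] in \<open>auto intro!: \<kappa> simp: field_simps\<close>)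
  from ln_vine_formula_rate[OF x this] eq show ?thesis by (simp add: algebra_simps)
qed

end

section \<open>Survival probabilities of the vine\<close>

lemma nn_integral_greaterThan_eq_atLeast:
  fixes f :: "real \<Rightarrow> ennreal"
  shows "(\<integral>\<^sup>+x. f x * indicator {a<..} x \<partial>lborel) = (\<integral>\<^sup>+x. f x * indicator {a..} x \<partial>lborel)"
  by (rule nn_integral_cong_AE, rule eventually_mono[OF AE_lborel_singleton[of a]])
    (auto split: split_indicator)

lemma nn_integral_FTC_greaterThan:
  fixes f F :: "real \<Rightarrow> real"
  assumes meas: "(\<lambda>x. f x * indicator {a<..} x) \<in> borel_measurable borel"
    and deriv: "\<And>x. a \<le> x \<Longrightarrow> (F has_real_derivative f x) (at x)"
    and nonneg: "\<And>x. a \<le> x \<Longrightarrow> 0 \<le> f x"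
    and lim: "(F \<longlongrightarrow> T) at_top"
  shows "(\<integral>\<^sup>+x. ennreal (f x) * indicator {a<..} x \<partial>lborel) = ennreal (T - F a)"
proof -
  define g where "g x = f x * indicator {a<..} x + f a * indicator {a} x" for x
  have g: "g x = f x" if "a \<le> x" for x using that by (cases "x = a") (auto simp: g_def)
  have "(\<integral>\<^sup>+x. ennreal (g x) * indicator {a..} x \<partial>lborel) = ennreal (T - F a)"
    by (rule nn_integral_FTC_atLeast) (use assms in \<open>auto simp: g, auto simp: g_def\<close>)
  also have "(\<integral>\<^sup>+x. ennreal (g x) * indicator {a..} x \<partial>lborel)
      = (\<integral>\<^sup>+x. ennreal (f x) * indicator {a..} x \<partial>lborel)"
    by (intro nn_integral_cong) (auto simp: g split: split_indicator)
  finally show ?thesis by (simp add: nn_integral_greaterThan_eq_atLeast)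
qed

context vine
begin

definition vine_dens :: "real \<times> real \<times> real \<Rightarrow> real" where
  "vine_dens = (\<lambda>(x1, x2, x3). if 0 < x1 \<and> 0 < x2 \<and> 0 < x3 then vine_formula x1 x2 x3 else 0)"

abbreviation p where "p x y \<equiv> P.cond_surv x y"
abbreviation q where "q x y \<equiv> Q.cond_surv x y"

text \<open>The density with its first argument integrated from \<open>z\<close> to infinity.\<close>
definition partial_tail :: "real \<Rightarrow> real \<Rightarrow> real \<Rightarrow> real" where
  "partial_tail z x2 x3 = exp (- x2) * (exp x2 * Q.surv_dens x3 x2) * (1 - C.cond_surv (- ln (1 - p z x2)) (- ln (1 - q x3 x2)))"

lemma one_minus_pq: assumes "0 < x" "0 < y"
  shows "0 < 1 - p x y" "1 - p x y < 1" "0 < - ln (1 - p x y)"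
    "0 < 1 - q x y" "1 - q x y < 1" "0 < - ln (1 - q x y)"
  using P.cond_surv_bounds[OF assms] Q.cond_surv_bounds[OF assms] by auto

lemma vine_formula_nonneg:
  assumes "0 < x1" "0 < x2" "0 < x3" shows "0 \<le> vine_formula x1 x2 x3"
proof -
  note u = one_minus_pq[of x1 x2] one_minus_pq[of x3 x2]
  have "0 < P.surv_dens x1 x2" "0 < Q.surv_dens x3 x2" "0 < C.surv_dens (- ln (1 - p x1 x2)) (- ln (1 - q x3 x2))"
    using assms u by (auto intro!: P.surv_dens_pos Q.surv_dens_pos C.surv_dens_pos)
  then show ?thesis unfolding vine_formula_def using u assms by (intro mult_nonneg_nonneg divide_nonneg_nonneg) auto
qed

text \<open>In \<open>x1\<close> the density is an exact derivative: the factor \<open>exp x2 * P.surv_dens x1 x2\<close> is the derivative of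
  \<open>1 - p x1 x2\<close>, at which the second-argument derivative of \<open>C13\<close> is differentiated.\<close>
lemma integral_vine_formula_fst:
  assumes "0 < z" "0 < x2" "0 < x3" and meas: "(\<lambda>x1. vine_dens (x1, x2, x3)) \<in> borel_measurable borel"
  shows "(\<integral>\<^sup>+x1. ennreal (vine_dens (x1, x2, x3)) * indicator {z<..} x1 \<partial>lborel) = ennreal (partial_tail z x2 x3)"
proof -
  let ?c = "exp (- x2) * (exp x2 * Q.surv_dens x3 x2)" and ?v = "1 - q x3 x2"
  let ?F = "\<lambda>x1. ?c * C.cond_surv (- ln (1 - p x1 x2)) (- ln ?v)"
  have "(\<integral>\<^sup>+x1. ennreal (vine_dens (x1, x2, x3)) * indicator {z<..} x1 \<partial>lborel) = ennreal (?c * 1 - ?F z)"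
  proof (rule nn_integral_FTC_greaterThan)
    show "(\<lambda>x. vine_dens (x, x2, x3) * indicator {z<..} x) \<in> borel_measurable borel"
      using meas by measurable
    fix x1 assume "z \<le> x1"
    then have x1: "0 < x1" using assms by simp
    note u = one_minus_pq[OF x1 assms(2)] one_minus_pq[OF assms(3,2)]
    have "((\<lambda>x1. 1 - p x1 x2) has_real_derivative 0 - - (exp x2 * P.surv_dens x1 x2)) (at x1)"
      using x1 assms by (intro DERIV_diff DERIV_const P.has_derivative_cond_surv)
    then have "((\<lambda>x1. C.cond_surv (- ln (1 - p x1 x2)) (- ln ?v)) has_real_derivative
        C.surv_dens (- ln (1 - p x1 x2)) (- ln ?v) / ((1 - p x1 x2) * ?v) * (0 - - (exp x2 * P.surv_dens x1 x2))) (at x1)"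
      by (intro DERIV_chain2[where f="\<lambda>u. C.cond_surv (- ln u) (- ln ?v)"] C.has_derivative_cond_surv_ln u)
    then have "(?F has_real_derivative
        ?c * (C.surv_dens (- ln (1 - p x1 x2)) (- ln ?v) / ((1 - p x1 x2) * ?v) * (0 - - (exp x2 * P.surv_dens x1 x2)))) (at x1)"
      by (rule DERIV_cmult)
    then show "(?F has_real_derivative vine_dens (x1, x2, x3)) (at x1)"
      using x1 assms by (simp add: vine_dens_def vine_formula_def mult_ac)
    show "0 \<le> vine_dens (x1, x2, x3)" using x1 assms by (simp add: vine_dens_def vine_formula_nonneg)
  next
    have "((\<lambda>x1. - ln (1 - p x1 x2)) \<longlongrightarrow> - ln (1 - 0)) at_top"
      using assms by (intro tendsto_intros P.tendsto_cond_surv_at_top) auto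
    then have "((\<lambda>x1. C.cond_surv (- ln (1 - p x1 x2)) (- ln ?v)) \<longlongrightarrow> 1) at_top"
    proof (intro C.tendsto_cond_surv_0)
      show "\<forall>\<^sub>F x1 in at_top. 0 < - ln (1 - p x1 x2)"
        using eventually_gt_at_top[of 0] by eventually_elim (use one_minus_pq(3)[OF _ assms(2)] in auto)
    qed (use one_minus_pq[OF assms(3,2)] in auto)
    then show "(?F \<longlongrightarrow> ?c * 1) at_top" by (intro tendsto_intros)
  qed
  then show ?thesis by (simp add: partial_tail_def right_diff_distrib)
qed

lemma partial_tail_nonneg:
  assumes "0 < z" "0 < x2" "0 < x3" shows "0 \<le> partial_tail z x2 x3"
proof -
  note u = one_minus_pq[OF assms(1,2)] one_minus_pq[OF assms(3,2)]
  have "0 < Q.surv_dens x3 x2" using assms by (intro Q.surv_dens_pos)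
  moreover have "C.cond_surv (- ln (1 - p z x2)) (- ln (1 - q x3 x2)) < 1"
    using u by (intro C.cond_surv_bounds)
  ultimately show ?thesis by (simp add: partial_tail_def)
qed

text \<open>The same argument in \<open>x3\<close>, now with the copula \<open>C13\<close> itself as the antiderivative.\<close>
lemma integral_partial_tail:
  assumes "0 < z" "0 < x2" "0 < w" and meas: "(\<lambda>x3. partial_tail z x2 x3 * indicator {w<..} x3) \<in> borel_measurable borel"
  shows "(\<integral>\<^sup>+x3. ennreal (partial_tail z x2 x3) * indicator {w<..} x3 \<partial>lborel)
    = ennreal (exp (- x2) * C.joint_tail (p z x2) (q w x2))"
proof -
  let ?u = "1 - p z x2"
  let ?F = "\<lambda>x3. exp (- x2) * ((1 - q x3 x2) - C.ev ?u (1 - q x3 x2))"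
  note u = one_minus_pq[OF assms(1,2)]
  have "(\<integral>\<^sup>+x3. ennreal (partial_tail z x2 x3) * indicator {w<..} x3 \<partial>lborel) = ennreal (exp (- x2) * ((1 - 0) - ?u) - ?F w)"
  proof (rule nn_integral_FTC_greaterThan[OF meas])
    fix x3 assume "w \<le> x3"
    then have x3: "0 < x3" using assms by simp
    note v = one_minus_pq[OF x3 assms(2)]
    have d: "((\<lambda>x3. 1 - q x3 x2) has_real_derivative 0 - - (exp x2 * Q.surv_dens x3 x2)) (at x3)"
      using x3 assms by (intro DERIV_diff DERIV_const Q.has_derivative_cond_surv)
    have "((\<lambda>x3. C.ev ?u (1 - q x3 x2)) has_real_derivative
        C.cond_surv (- ln ?u) (- ln (1 - q x3 x2)) * (0 - - (exp x2 * Q.surv_dens x3 x2))) (at x3)"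
      by (intro DERIV_chain2[where f="\<lambda>v. C.ev ?u v"] C.has_derivative_ev_snd u v d)
    from DERIV_cmult[OF DERIV_diff[OF d this], of "exp (- x2)"]
    show "(?F has_real_derivative partial_tail z x2 x3) (at x3)"
      by (simp add: partial_tail_def algebra_simps)
    show "0 \<le> partial_tail z x2 x3" using x3 assms by (intro partial_tail_nonneg)
  next
    have "((\<lambda>x3. - ln (1 - q x3 x2)) \<longlongrightarrow> - ln (1 - 0)) at_top"
      using assms by (intro tendsto_intros Q.tendsto_cond_surv_at_top) auto
    moreover have "\<forall>\<^sub>F x3 in at_top. 0 \<le> - ln (1 - q x3 x2)"
      using eventually_gt_at_top[of 0] by eventually_elim (use one_minus_pq(6)[OF _ assms(2)] in \<open>auto intro: less_imp_le\<close>)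
    ultimately have "((\<lambda>x3. LC (- ln ?u) (- ln (1 - q x3 x2))) \<longlongrightarrow> LC (- ln ?u) 0) at_top"
      using u by (intro C.tendsto_L) auto
    then have "((\<lambda>x3. C.ev ?u (1 - q x3 x2)) \<longlongrightarrow> exp (- LC (- ln ?u) 0)) at_top"
      unfolding C.ev_def by (intro tendsto_intros)
    moreover have "exp (- LC (- ln ?u) 0) = ?u" using u by (simp add: C.L_axis)
    ultimately have "((\<lambda>x3. C.ev ?u (1 - q x3 x2)) \<longlongrightarrow> ?u) at_top" by simp
    then show "(?F \<longlongrightarrow> exp (- x2) * ((1 - 0) - ?u)) at_top"
      using assms by (intro tendsto_intros Q.tendsto_cond_surv_at_top)
  qed
  also have "exp (- x2) * ((1 - 0) - ?u) - ?F w = exp (- x2) * C.joint_tail (p z x2) (q w x2)"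
    by (simp add: C.joint_tail_def algebra_simps)
  finally show ?thesis .
qed

text \<open>The order of integration is \<open>x1\<close>, \<open>x3\<close>, \<open>x2\<close>: the mixed derivative inside the density is taken with respect
  to the second argument of \<open>C13\<close> first, so it has to be undone in the first argument first.\<close>
lemma joint_survival:
  assumes meas: "vine_dens \<in> borel_measurable (lborel \<Otimes>\<^sub>M (lborel \<Otimes>\<^sub>M lborel))"
    and z: "0 < z1" "0 \<le> z2" "0 < z3"
  shows "(\<integral>\<^sup>+x. ennreal (vine_dens x) * indicator {(x1, x2, x3). z1 < x1 \<and> z2 < x2 \<and> z3 < x3} x
      \<partial>(lborel \<Otimes>\<^sub>M (lborel \<Otimes>\<^sub>M lborel)))
    = (\<integral>\<^sup>+y. ennreal (exp (- y) * C.joint_tail (p z1 y) (q z3 y)) * indicator {z2<..} y \<partial>lborel)"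
proof -
  let ?S = "{(x1, x2, x3). z1 < x1 \<and> z2 < x2 \<and> z3 < x3} :: (real \<times> real \<times> real) set"
  let ?N = "lborel \<Otimes>\<^sub>M lborel :: (real \<times> real) measure"
  interpret N: sigma_finite_measure ?N
    unfolding lborel_prod by (rule lborel.sigma_finite_measure_axioms)
  interpret pair_sigma_finite "lborel :: real measure" ?N ..
  have S: "?S = {z1<..} \<times> {z2<..} \<times> {z3<..}" by auto
  have Smeas: "?S \<in> sets (lborel \<Otimes>\<^sub>M ?N)" unfolding S by (intro pair_measureI) auto
  define F where "F x = ennreal (vine_dens x) * indicator ?S x" for x
  have F: "F \<in> borel_measurable (lborel \<Otimes>\<^sub>M ?N)"
    unfolding F_def using meas Smeas by measurable
  have sec: "(\<lambda>x1. vine_dens (x1, x2, x3)) \<in> borel_measurable borel" for x2 x3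
    using measurable_compose[OF _ meas, of "\<lambda>x1. (x1, x2, x3)" borel] by measurable
  have inner: "(\<integral>\<^sup>+x1. F (x1, x2, x3) \<partial>lborel) = ennreal (partial_tail z1 x2 x3) * indicator {z3<..} x3 * indicator {z2<..} x2" for x2 x3
  proof (cases "z2 < x2 \<and> z3 < x3")
    case True
    then have "F (x1, x2, x3) = ennreal (vine_dens (x1, x2, x3)) * indicator {z1<..} x1" for x1
      by (simp add: F_def split: split_indicator)
    then show ?thesis using integral_vine_formula_fst[OF z(1) _ _ sec, of x2 x3] True z by simp
  qed (auto simp: F_def)
  have G: "(\<lambda>(x2, x3). \<integral>\<^sup>+x1. F (x1, x2, x3) \<partial>lborel) \<in> borel_measurable ?N"
  proof -
    have "case_prod (\<lambda>y x1. F (x1, y)) \<in> borel_measurable (?N \<Otimes>\<^sub>M lborel)"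
      using measurable_compose[OF measurable_pair_swap' F] by (simp add: case_prod_beta)
    from lborel.borel_measurable_nn_integral[OF this] show ?thesis
      by (simp add: case_prod_beta)
  qed
  have "(\<integral>\<^sup>+x. F x \<partial>(lborel \<Otimes>\<^sub>M ?N)) = (\<integral>\<^sup>+y. \<integral>\<^sup>+x1. F (x1, y) \<partial>lborel \<partial>?N)"
    by (rule nn_integral_snd[OF F, symmetric])
  also have "\<dots> = (\<integral>\<^sup>+y. (case y of (x2, x3) \<Rightarrow> \<integral>\<^sup>+x1. F (x1, x2, x3) \<partial>lborel) \<partial>?N)"
    by (intro nn_integral_cong) auto
  also have "\<dots> = (\<integral>\<^sup>+x2. \<integral>\<^sup>+x3. (\<integral>\<^sup>+x1. F (x1, x2, x3) \<partial>lborel) \<partial>lborel \<partial>lborel)"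
    by (subst lborel.nn_integral_fst[OF G, symmetric]) simp
  also have "\<dots> = (\<integral>\<^sup>+x2. ennreal (exp (- x2) * C.joint_tail (p z1 x2) (q z3 x2)) * indicator {z2<..} x2 \<partial>lborel)"
  proof (intro nn_integral_cong)
    fix x2 :: real
    show "(\<integral>\<^sup>+x3. (\<integral>\<^sup>+x1. F (x1, x2, x3) \<partial>lborel) \<partial>lborel) = ennreal (exp (- x2) * C.joint_tail (p z1 x2) (q z3 x2)) * indicator {z2<..} x2"
    proof (cases "z2 < x2")
      case True
      then have i: "(\<integral>\<^sup>+x1. F (x1, x2, x3) \<partial>lborel) = ennreal (partial_tail z1 x2 x3) * indicator {z3<..} x3" for x3
        by (simp add: inner)
      have "(\<lambda>x3. case (x2, x3) of (x2, x3) \<Rightarrow> \<integral>\<^sup>+x1. F (x1, x2, x3) \<partial>lborel) \<in> borel_measurable borel"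
        by (rule measurable_compose[OF _ G]) simp
      then have "(\<lambda>x3. ennreal (partial_tail z1 x2 x3) * indicator {z3<..} x3) \<in> borel_measurable borel"
        by (simp add: i)
      then have "(\<lambda>x3. enn2real (ennreal (partial_tail z1 x2 x3) * indicator {z3<..} x3)) \<in> borel_measurable borel"
        by (rule measurable_compose) simp
      moreover have "enn2real (ennreal (partial_tail z1 x2 x3) * indicator {z3<..} x3) = partial_tail z1 x2 x3 * indicator {z3<..} x3" for x3
        using partial_tail_nonneg[of z1 x2 x3] True z by (simp split: split_indicator)
      ultimately show ?thesis using integral_partial_tail[of z1 x2 z3] True z by (simp add: i)
    qed (simp add: inner)
  qed
  finally show ?thesis by (simp add: F_def)
qed

end

section \<open>The diagonal tail of all three components\<close>

context stable_tail_density
begin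

lemma continuous_on_joint_tail:
  assumes "continuous_on S u" "continuous_on S v" "\<And>i. i \<in> S \<Longrightarrow> 0 < u i \<and> u i < 1" "\<And>i. i \<in> S \<Longrightarrow> 0 < v i \<and> v i < 1"
  shows "continuous_on S (\<lambda>i. joint_tail (u i) (v i))"
proof -
  have "0 \<le> - ln (1 - u i)" "0 \<le> - ln (1 - v i)" "1 - u i \<noteq> 0" "1 - v i \<noteq> 0" if "i \<in> S" for i
    using assms(3,4)[OF that] by auto
  then show ?thesis
    unfolding joint_tail_def ev_def using assms
    by (intro continuous_intros continuous_on_L) auto
qed

text \<open>The form of \<open>joint_tail_asymp\<close> used for pointwise limits.\<close>
lemma joint_tail_ratio:
  assumes "(u \<longlongrightarrow> 0) F" "(v \<longlongrightarrow> 0) F" "\<forall>\<^sub>F i in F. 0 < u i" "\<forall>\<^sub>F i in F. 0 < v i"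
  shows "((\<lambda>i. joint_tail (u i) (v i) / tail_copula (u i) (v i)) \<longlongrightarrow> 1) F"
proof (rule tendstoI)
  fix e :: real assume "0 < e"
  then have e: "0 < e / 2" by simp
  obtain d where d: "0 < d" "d < 1"
    "\<And>p q. 0 < p \<Longrightarrow> p \<le> d \<Longrightarrow> 0 < q \<Longrightarrow> q \<le> d \<Longrightarrow> (1 - e / 2) * tail_copula p q \<le> joint_tail p q \<and> joint_tail p q \<le> (1 + e / 2) * tail_copula p q"
    using joint_tail_asymp[OF e] by blast
  show "\<forall>\<^sub>F i in F. dist (joint_tail (u i) (v i) / tail_copula (u i) (v i)) 1 < e"
    using assms(3,4) order_tendstoD(2)[OF assms(1) d(1)] order_tendstoD(2)[OF assms(2) d(1)]
  proof eventually_elim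
    case (elim i)
    then have pos: "0 < tail_copula (u i) (v i)" by (intro tail_copula_pos)
    have "(1 - e / 2) * tail_copula (u i) (v i) \<le> joint_tail (u i) (v i)" "joint_tail (u i) (v i) \<le> (1 + e / 2) * tail_copula (u i) (v i)"
      using d(3)[of "u i" "v i"] elim by auto
    then have "1 - e / 2 \<le> joint_tail (u i) (v i) / tail_copula (u i) (v i)" "joint_tail (u i) (v i) / tail_copula (u i) (v i) \<le> 1 + e / 2"
      using pos by (simp_all add: pos_le_divide_eq pos_divide_le_eq)
    then show ?case using \<open>0 < e\<close> unfolding dist_real_def by linarith
  qed
qed

lemma tendsto_tail_copula:
  assumes "(u \<longlongrightarrow> a) F" "(v \<longlongrightarrow> b) F" "\<forall>\<^sub>F i in F. 0 < u i" "\<forall>\<^sub>F i in F. 0 < v i" "0 < a" "0 < b"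
  shows "((\<lambda>i. tail_copula (u i) (v i)) \<longlongrightarrow> tail_copula a b) F"
  unfolding tail_copula_def using assms
  by (intro tendsto_intros tendsto_L) (auto elim: eventually_mono)

text \<open>When the second argument dominates, exceedance of the second level is no further restriction.\<close>
lemma tendsto_tail_copula_at_top:
  assumes u: "(u \<longlongrightarrow> a) F" "\<forall>\<^sub>F i in F. 0 < u i" and v: "filterlim v at_top F"
  shows "((\<lambda>i. tail_copula (u i) (v i)) \<longlongrightarrow> a) F"
proof (rule tendsto_sandwich)
  have v0: "\<forall>\<^sub>F i in F. 0 < v i" using v by (simp add: filterlim_at_top_dense)
  show "\<forall>\<^sub>F i in F. tail_copula (u i) (v i) \<le> u i" by (simp add: tail_copula_le)
  show "\<forall>\<^sub>F i in F. u i * (1 - A (1 / (u i / v i + 1))) \<le> tail_copula (u i) (v i)"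
    using u(2) v0
  proof eventually_elim
    case (elim i)
    have T: "1 / (u i / v i + 1) = v i / (u i + v i)" using elim by (simp add: field_simps)
    have "L (u i) (v i) = u i * A (v i / (u i + v i)) + v i * B (v i / (u i + v i))"
      using elim by (intro L_eq) auto
    also have "\<dots> \<le> u i * A (v i / (u i + v i)) + v i * 1"
      using elim angle_in_unit[of "u i" "v i"] by (intro add_left_mono mult_left_mono B_bounds) auto
    finally show ?case unfolding T tail_copula_def by (simp add: algebra_simps)
  qed
  have "((\<lambda>i. u i / v i) \<longlongrightarrow> 0) F"
    using v by (intro tendsto_divide_0[OF u(1)]) (simp add: filterlim_at_top_imp_at_infinity)
  then have "((\<lambda>i. 1 / (u i / v i + 1)) \<longlongrightarrow> 1 / (0 + 1)) F"
    by (intro tendsto_intros) auto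
  then have "((\<lambda>i. A (1 / (u i / v i + 1))) \<longlongrightarrow> A (1 / (0 + 1))) F"
    by (rule isCont_tendsto_compose[OF contA])
  then have "((\<lambda>i. u i * (1 - A (1 / (u i / v i + 1)))) \<longlongrightarrow> a * (1 - A (1 / (0 + 1)))) F"
    by (intro tendsto_intros u)
  then show "((\<lambda>i. u i * (1 - A (1 / (u i / v i + 1)))) \<longlongrightarrow> a) F" by simp
qed (rule u)

lemma tendsto_tail_copula_at_top':
  assumes u: "filterlim u at_top F" and v: "(v \<longlongrightarrow> b) F" "\<forall>\<^sub>F i in F. 0 < v i"
  shows "((\<lambda>i. tail_copula (u i) (v i)) \<longlongrightarrow> b) F"
  using stable_tail_density.tendsto_tail_copula_at_top[OF reflect_density v u]
  unfolding stable_tail_density.tail_copula_def[OF reflect_density] tail_copula_def by (simp add: add.commute)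

text \<open>The exponential density with rate \<open>B (1/2)\<close>: the limit law of the excess of the second variable over \<open>x\<close>
  given that both variables exceed \<open>x\<close>.\<close>
definition diag_limit :: "real \<Rightarrow> real" where "diag_limit y = B (1/2) * exp (- (y * B (1/2)))"

text \<open>\<open>exp (- (x + y)) * cond_surv x (x + y)\<close> is the density at \<open>x + y\<close> of the second variable on the event that the
  first exceeds \<open>x\<close>; it is divided by \<open>exp (- L x x)\<close>, the probability that both exceed \<open>x\<close>.\<close>
definition diag_profile :: "real \<Rightarrow> real \<Rightarrow> real" where
  "diag_profile x y = exp (x * L 1 1) * exp (- (x + y)) * cond_surv x (x + y)"

lemma diag_profile_eq: "diag_profile x y = B ((x + y) / (x + (x + y))) * exp (- (L x (x + y) - x * L 1 1))"
  by (simp add: diag_profile_def cond_surv_def algebra_simps flip: exp_add)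

lemma diag_limit_pos: "0 < diag_limit y" using B_pos by (simp add: diag_limit_def)

text \<open>Convexity: this is what provides an integrable bound that does not depend on \<open>x\<close>.\<close>
lemma diag_increment_ge:
  assumes "0 < x" "0 \<le> y" shows "y * B (1/2) \<le> L x (x + y) - x * L 1 1"
  using L_diff_ge[of x x x "x + y"] L_homogeneous[of x 1 1] assms by simp

lemma diag_profile_le: "0 < x \<Longrightarrow> 0 \<le> y \<Longrightarrow> diag_profile x y \<le> exp (- (y * B (1/2)))"
  unfolding diag_profile_eq using diag_increment_ge[of x y] angle_in_unit[of x "x + y"]
  by (intro order_trans[OF mult_left_le_one_le]) (auto intro!: B_bounds)

lemma diag_profile_pos: "0 < x \<Longrightarrow> 0 \<le> y \<Longrightarrow> 0 < diag_profile x y"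
  by (simp add: diag_profile_def cond_surv_bounds)

lemma tendsto_diag_angle: "((\<lambda>x. (x + y) / (x + (x + y))) \<longlongrightarrow> (1/2 :: real)) at_top"
proof (rule Lim_transform_eventually)
  have "((\<lambda>x::real. (1 + y / x) / (2 + y / x)) \<longlongrightarrow> (1 + 0) / (2 + 0)) at_top"
    by (intro tendsto_intros tendsto_const_over_t) auto
  then show "((\<lambda>x. (1 + y / x) / (2 + y / x)) \<longlongrightarrow> 1/2) at_top" by simp
  show "\<forall>\<^sub>F x in at_top. (1 + y / x) / (2 + y / x) = (x + y) / (x + (x + y))"
    using eventually_gt_at_top[of 0]
  proof eventually_elim
    case (elim x)
    then have "1 + y / x = (x + y) / x" "2 + y / x = (x + (x + y)) / x" by (auto simp: field_simps)
    then show ?case using elim by simp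
  qed
qed

lemma tendsto_diag_profile: assumes "0 \<le> y" shows "((\<lambda>x. diag_profile x y) \<longlongrightarrow> diag_limit y) at_top"
proof -
  note T = isCont_tendsto_compose[OF contB tendsto_diag_angle[of y]]
  have "((\<lambda>x. L x (x + y) - x * L 1 1) \<longlongrightarrow> y * B (1/2)) at_top"
  proof (rule tendsto_sandwich)
    show "\<forall>\<^sub>F x in at_top. y * B (1/2) \<le> L x (x + y) - x * L 1 1"
      using eventually_gt_at_top[of 0] by eventually_elim (use diag_increment_ge assms in auto)
    show "\<forall>\<^sub>F x in at_top. L x (x + y) - x * L 1 1 \<le> y * B ((x + y) / (x + (x + y)))"
      using eventually_gt_at_top[of 0]
    proof eventually_elim
      case (elim x)
      then show ?case
        using L_diff_ge[of x "x + y" x x] L_homogeneous[of x 1 1] assms by simp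
    qed
    show "((\<lambda>x. y * B ((x + y) / (x + (x + y)))) \<longlongrightarrow> y * B (1/2)) at_top"
      by (intro tendsto_intros T)
  qed (rule tendsto_const)
  then show ?thesis unfolding diag_profile_eq diag_limit_def by (intro tendsto_intros T)
qed

lemma L_1_1_gt: "1 < L 1 1" using L_gt_snd[of 1 1] by simp

lemma tendsto_cond_surv_diag: assumes "0 \<le> y" shows "((\<lambda>x. cond_surv x (x + y)) \<longlongrightarrow> 0) at_top"
proof -
  have "((\<lambda>x. exp (- (x * (L 1 1 - 1)))) \<longlongrightarrow> 0) at_top"
    using L_1_1_gt by (intro tendsto_exp_decay) simp
  then have "((\<lambda>x. diag_profile x y * exp y * exp (- (x * (L 1 1 - 1)))) \<longlongrightarrow> diag_limit y * exp y * 0) at_top"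
    by (intro tendsto_mult tendsto_diag_profile assms tendsto_const)
  moreover have "diag_profile x y * exp y * exp (- (x * (L 1 1 - 1))) = cond_surv x (x + y)" for x
  proof -
    have "exp (x * L 1 1) * exp (- (x + y)) * exp y * exp (- (x * (L 1 1 - 1))) = 1"
      by (simp add: algebra_simps flip: exp_add)
    then show ?thesis by (simp add: diag_profile_def mult_ac)
  qed
  ultimately show ?thesis by simp
qed

end

lemma exp_nn_integral: assumes "0 < \<beta>"
  shows "(\<integral>\<^sup>+y. ennreal (exp (- (y * \<beta>))) * indicator {a<..} y \<partial>lborel) = ennreal (exp (- (a * \<beta>)) / \<beta>)"
proof -
  have "(\<integral>\<^sup>+y. ennreal (exp (- (y * \<beta>))) * indicator {a<..} y \<partial>lborel) = ennreal (0 - - exp (- (a * \<beta>)) / \<beta>)"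
  proof (rule nn_integral_FTC_greaterThan)
    have "((\<lambda>y. exp (- (y * \<beta>))) \<longlongrightarrow> 0) at_top"
      using assms by (rule tendsto_exp_decay)
    then have "((\<lambda>y. - exp (- (y * \<beta>)) / \<beta>) \<longlongrightarrow> - 0 / \<beta>) at_top"
      using assms by (intro tendsto_intros) auto
    then show "((\<lambda>y. - exp (- (y * \<beta>)) / \<beta>) \<longlongrightarrow> 0) at_top" by simp
  qed (use assms in \<open>auto intro!: derivative_eq_intros\<close>)
  then show ?thesis by simp
qed

lemma exp_integrable: "0 < \<beta> \<Longrightarrow> integrable lborel (\<lambda>y. exp (- (y * \<beta>)) * indicat_real {a<..} y)"
  using exp_nn_integral[of \<beta> a]
  by (intro integrableI_nonneg) (auto simp: ennreal_mult'' ennreal_indicator)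

context vine
begin

text \<open>By \<open>joint_survival\<close>, the density at \<open>y\<close> of the second component on the event that the first and
  third components exceed \<open>x\<close>.\<close>
definition tail_slice :: "real \<Rightarrow> real \<Rightarrow> real" where
  "tail_slice x y = exp (- y) * C.joint_tail (p x y) (q x y)"

definition tail_prob :: "real \<Rightarrow> real \<Rightarrow> real" where
  "tail_prob x z = (\<integral>y. tail_slice x y * indicator {z<..} y \<partial>lborel)"

lemma tail_slice_bounds:
  assumes "0 < x" "0 < y"
  shows "0 < tail_slice x y" "tail_slice x y \<le> exp (- y) * p x y" "tail_slice x y \<le> exp (- y) * q x y" "tail_slice x y \<le> exp (- y)"
proof -
  note b = P.cond_surv_bounds[OF assms] Q.cond_surv_bounds[OF assms]
  have c: "0 < C.joint_tail (p x y) (q x y)" "C.joint_tail (p x y) (q x y) \<le> p x y" "C.joint_tail (p x y) (q x y) \<le> q x y"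
    using b by (auto intro!: C.joint_tail_pos C.joint_tail_le)
  then show "0 < tail_slice x y" "tail_slice x y \<le> exp (- y) * p x y" "tail_slice x y \<le> exp (- y) * q x y"
    by (auto simp: tail_slice_def)
  show "tail_slice x y \<le> exp (- y)" using c b by (simp add: tail_slice_def)
qed

lemma continuous_on_tail_slice:
  assumes "continuous_on S u" "continuous_on S v" "\<And>i. i \<in> S \<Longrightarrow> 0 < u i" "\<And>i. i \<in> S \<Longrightarrow> 0 < v i"
  shows "continuous_on S (\<lambda>i. tail_slice (u i) (v i))"
  unfolding tail_slice_def using assms
  by (intro continuous_intros C.continuous_on_joint_tail P.continuous_on_cond_surv Q.continuous_on_cond_surv)
    (auto simp: P.cond_surv_bounds Q.cond_surv_bounds)

lemma tail_slice_measurable: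
  assumes "0 < x" "S \<in> sets borel" "S \<subseteq> {0<..}" shows "(\<lambda>y. tail_slice x y * indicator S y) \<in> borel_measurable borel"
proof -
  have "continuous_on S (tail_slice x)"
    using assms by (intro continuous_on_tail_slice continuous_intros) auto
  from borel_measurable_continuous_on_indicator[OF assms(2) this]
  show ?thesis by (simp add: mult.commute)
qed

lemma tail_slice_integrable:
  assumes "0 < x" "S \<in> sets borel" "S \<subseteq> {0<..}" shows "integrable lborel (\<lambda>y. tail_slice x y * indicator S y)"
proof (rule Bochner_Integration.integrable_bound[OF exp_integrable[of 1 0]])
  show "AE y in lborel. norm (tail_slice x y * indicator S y) \<le> norm (exp (- (y * 1)) * indicat_real {0<..} y)"
  proof (intro always_eventually allI)
    fix y show "norm (tail_slice x y * indicator S y) \<le> norm (exp (- (y * 1)) * indicat_real {0<..} y)"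
      using assms tail_slice_bounds[of x y] by (cases "y \<in> S") auto
  qed
qed (use tail_slice_measurable assms in auto)

lemma nn_integral_tail_slice:
  assumes "0 < x" "0 \<le> z"
  shows "(\<integral>\<^sup>+y. ennreal (tail_slice x y) * indicator {z<..} y \<partial>lborel) = ennreal (tail_prob x z)"
proof -
  have "(\<integral>\<^sup>+y. ennreal (tail_slice x y) * indicator {z<..} y \<partial>lborel) = (\<integral>\<^sup>+y. ennreal (tail_slice x y * indicator {z<..} y) \<partial>lborel)"
    by (intro nn_integral_cong) (auto split: split_indicator)
  also have "\<dots> = ennreal (tail_prob x z)"
    unfolding tail_prob_def using assms tail_slice_bounds(1)[of x]
    by (intro nn_integral_eq_integral tail_slice_integrable always_eventually)
      (auto split: split_indicator intro: less_imp_le)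
  finally show ?thesis .
qed

lemma tail_prob_le:
  assumes "0 < x" "0 < z" shows "tail_prob x z \<le> exp (- LP x z)"
proof -
  have "ennreal (tail_prob x z) = (\<integral>\<^sup>+y. ennreal (tail_slice x y) * indicator {z<..} y \<partial>lborel)"
    using nn_integral_tail_slice[of x z] assms by simp
  also have "\<dots> \<le> (\<integral>\<^sup>+y. ennreal (exp (- y) * p x y) * indicator {z..} y \<partial>lborel)"
    using assms tail_slice_bounds(2)[of x] by (intro nn_integral_mono) (auto split: split_indicator intro!: ennreal_leI)
  also have "\<dots> = ennreal (exp (- LP x z))" using assms by (rule P.nn_integral_cond_surv)
  finally show ?thesis by simp
qed

lemma tail_prob_nonneg: "0 < x \<Longrightarrow> 0 \<le> z \<Longrightarrow> 0 \<le> tail_prob x z"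
  unfolding tail_prob_def using tail_slice_bounds(1)[of x]
  by (intro Bochner_Integration.integral_nonneg) (auto split: split_indicator intro: less_imp_le)

text \<open>After the substitution \<open>y \<mapsto> x + y\<close> and multiplication by \<open>exp (m * x)\<close>, the integrand is equivalent to the
  tail copula of the two rescaled profiles. If \<open>V12 1 1 = V23 1 1\<close> both profiles converge;
  otherwise the one with the smaller value diverges and the tail copula tends to the limit of the other. In
  each case the profile with the larger value dominates the integrand.\<close>
lemma tail_prob_diag_limit: "\<exists>K>0. ((\<lambda>x. tail_prob x x * exp (max (LP 1 1) (LQ 1 1) * x)) \<longlongrightarrow> K) at_top"
proof -
  let ?l = "LP 1 1" and ?m = "LQ 1 1"
  define m where "m = max ?l ?m"
  \<comment> \<open>the pointwise limit and the rate of the dominating function in the three cases\<close>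
  define \<Lambda> where "\<Lambda> y = (if ?l = ?m then C.tail_copula (P.diag_limit y) (Q.diag_limit y) else if ?m < ?l then P.diag_limit y else Q.diag_limit y)" for y
  define \<beta> where "\<beta> = (if ?m \<le> ?l then BP (1/2) else BQ (1/2))"
  have \<beta>: "0 < \<beta>" using P.B_pos[of "1/2"] Q.B_pos[of "1/2"] by (simp add: \<beta>_def)
  define s where "s x y = exp (m * x) * tail_slice x (x + y) * indicator {0<..} y" for x y
  have Pg: "exp (m * x) * (exp (- (x + y)) * p x (x + y)) = exp ((m - ?l) * x) * P.diag_profile x y"
    and Qg: "exp (m * x) * (exp (- (x + y)) * q x (x + y)) = exp ((m - ?m) * x) * Q.diag_profile x y" for x y
    unfolding P.diag_profile_def Q.diag_profile_def mult.assoc[symmetric]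
    by (simp_all add: algebra_simps flip: exp_add)
  have lim: "((\<lambda>x. s x y) \<longlongrightarrow> \<Lambda> y * indicator {0<..} y) at_top" for y
  proof (cases "0 < y")
    case True
    define a where "a x = exp ((m - ?l) * x) * P.diag_profile x y" for x
    define b where "b x = exp ((m - ?m) * x) * Q.diag_profile x y" for x
    have pos: "\<forall>\<^sub>F x in at_top. 0 < a x" "\<forall>\<^sub>F x in at_top. 0 < b x"
      using eventually_gt_at_top[of 0] by (eventually_elim, use True in \<open>simp add: a_def b_def P.diag_profile_pos Q.diag_profile_pos\<close>)+
    have top: "filterlim (\<lambda>x. exp (c * x) * f x) at_top at_top" if "0 < c" "(f \<longlongrightarrow> k) at_top" "0 < k" for c k :: real and f
    proof -
      have "filterlim (\<lambda>x. c * x) at_top at_top"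
        using that by (intro filterlim_tendsto_pos_mult_at_top[OF tendsto_const _ filterlim_ident]) auto
      then have "filterlim (\<lambda>x. exp (c * x)) at_top at_top" by (rule filterlim_compose[OF exp_at_top])
      then show ?thesis by (rule filterlim_at_top_mult_tendsto_pos[OF that(2,3)])
    qed
    note dgs = P.tendsto_diag_profile[OF less_imp_le[OF True]] Q.tendsto_diag_profile[OF less_imp_le[OF True]]
    have Rlim: "((\<lambda>x. C.tail_copula (a x) (b x)) \<longlongrightarrow> \<Lambda> y) at_top"
    proof (cases ?l ?m rule: linorder_cases)
      case equal
      then have "(a \<longlongrightarrow> P.diag_limit y) at_top" "(b \<longlongrightarrow> Q.diag_limit y) at_top"
        using dgs by (simp_all add: a_def[abs_def] b_def[abs_def] m_def)
      then show ?thesis using equal pos by (simp add: \<Lambda>_def C.tendsto_tail_copula P.diag_limit_pos Q.diag_limit_pos)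
    next
      case less
      then have "(b \<longlongrightarrow> Q.diag_limit y) at_top"
        using dgs by (simp add: b_def[abs_def] m_def)
      moreover have "filterlim a at_top at_top" unfolding a_def
        using less by (intro top[OF _ dgs(1) P.diag_limit_pos]) (auto simp: m_def)
      ultimately show ?thesis using less pos by (simp add: \<Lambda>_def C.tendsto_tail_copula_at_top')
    next
      case greater
      then have "(a \<longlongrightarrow> P.diag_limit y) at_top"
        using dgs by (simp add: a_def[abs_def] m_def)
      moreover have "filterlim b at_top at_top" unfolding b_def
        using greater by (intro top[OF _ dgs(2) Q.diag_limit_pos]) (auto simp: m_def)
      ultimately show ?thesis using greater pos by (simp add: \<Lambda>_def C.tendsto_tail_copula_at_top)
    qed
    have ratio: "((\<lambda>x. C.joint_tail (p x (x + y)) (q x (x + y)) / C.tail_copula (p x (x + y)) (q x (x + y))) \<longlongrightarrow> 1) at_top"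
    proof (rule C.joint_tail_ratio)
      show "\<forall>\<^sub>F x in at_top. 0 < p x (x + y)" "\<forall>\<^sub>F x in at_top. 0 < q x (x + y)"
        using eventually_gt_at_top[of 0]
        by (eventually_elim, use True in \<open>simp add: P.cond_surv_bounds Q.cond_surv_bounds\<close>)+
    qed (use True in \<open>auto intro!: P.tendsto_cond_surv_diag Q.tendsto_cond_surv_diag\<close>)
    have "((\<lambda>x. C.joint_tail (p x (x + y)) (q x (x + y)) / C.tail_copula (p x (x + y)) (q x (x + y)) * C.tail_copula (a x) (b x)) \<longlongrightarrow> 1 * \<Lambda> y) at_top"
      by (intro tendsto_mult ratio Rlim)
    moreover have "\<forall>\<^sub>F x in at_top. C.joint_tail (p x (x + y)) (q x (x + y)) / C.tail_copula (p x (x + y)) (q x (x + y)) * C.tail_copula (a x) (b x) = s x y"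
      using eventually_gt_at_top[of 0]
    proof eventually_elim
      case (elim x)
      then have xy: "0 < x + y" using True by simp
      define \<sigma> where "\<sigma> = exp (m * x) * exp (- (x + y))"
      have "a x = \<sigma> * p x (x + y)" "b x = \<sigma> * q x (x + y)"
        using Pg[of x y] Qg[of x y] by (simp_all add: a_def b_def \<sigma>_def mult.assoc)
      moreover have pq: "0 < p x (x + y)" "0 < q x (x + y)"
        using P.cond_surv_bounds Q.cond_surv_bounds elim xy by auto
      ultimately have "C.tail_copula (a x) (b x) = \<sigma> * C.tail_copula (p x (x + y)) (q x (x + y))"
        by (simp add: C.tail_copula_homogeneous \<sigma>_def)
      then show ?case
        using C.tail_copula_pos[OF pq] True by (simp add: s_def tail_slice_def \<sigma>_def)
    qed
    ultimately show ?thesis using True by (auto intro: Lim_transform_eventually)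
  qed (simp add: s_def)
  have \<Lambda>_pos: "0 < \<Lambda> y" for y by (simp add: \<Lambda>_def P.diag_limit_pos Q.diag_limit_pos C.tail_copula_pos)
  have diag_limit_cont: "continuous_on UNIV P.diag_limit" "continuous_on UNIV Q.diag_limit"
    unfolding P.diag_limit_def Q.diag_limit_def by (intro continuous_intros)+
  have "continuous_on UNIV \<Lambda>"
  proof -
    have "continuous_on UNIV (\<lambda>y. C.tail_copula (P.diag_limit y) (Q.diag_limit y))"
      unfolding C.tail_copula_def using diag_limit_cont P.diag_limit_pos Q.diag_limit_pos
      by (intro continuous_intros C.continuous_on_L) (auto simp: less_imp_le)
    then show ?thesis
      using diag_limit_cont by (cases ?l ?m rule: linorder_cases) (simp_all add: \<Lambda>_def[abs_def])
  qed
  then have \<Lambda>_meas: "\<Lambda> \<in> borel_measurable borel" by (rule borel_measurable_continuous_onI)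
  have s_meas: "s x \<in> borel_measurable borel" if "0 < x" for x
  proof -
    have "continuous_on {0<..} (\<lambda>y. exp (m * x) * tail_slice x (x + y))"
      using that by (intro continuous_intros continuous_on_tail_slice) auto
    from borel_measurable_continuous_on_indicator[OF _ this]
    show ?thesis by (simp add: s_def[abs_def] mult.commute)
  qed
  have bound: "norm (s x y) \<le> exp (- (y * \<beta>)) * indicator {0<..} y" if "0 < x" for x y
  proof (cases "0 < y")
    case True
    note gb = tail_slice_bounds[of x "x + y"]
    have g0: "0 < tail_slice x (x + y)" using gb(1) that True by simp
    have "exp (m * x) * tail_slice x (x + y) \<le> exp (- (y * \<beta>))"
    proof (cases "?m \<le> ?l")
      case le: True
      have "exp (m * x) * tail_slice x (x + y) \<le> exp (m * x) * (exp (- (x + y)) * p x (x + y))"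
        using gb(2) that True by (intro mult_left_mono) auto
      also have "\<dots> \<le> exp (- (y * \<beta>))"
        unfolding Pg using P.diag_profile_le[of x y] that True le by (simp add: m_def \<beta>_def)
      finally show ?thesis .
    next
      case le: False
      have "exp (m * x) * tail_slice x (x + y) \<le> exp (m * x) * (exp (- (x + y)) * q x (x + y))"
        using gb(3) that True by (intro mult_left_mono) auto
      also have "\<dots> \<le> exp (- (y * \<beta>))"
        unfolding Qg using Q.diag_profile_le[of x y] that True le by (simp add: m_def \<beta>_def)
      finally show ?thesis .
    qed
    then show ?thesis using True g0 by (simp add: s_def)
  qed (simp add: s_def)
  \<comment> \<open>dominated convergence asks for measurable integrands for every parameter, so the nonpositive ones are cut off\<close>
  define s' where "s' x y = (if 0 < x then s x y else 0)" for x y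
  have s'_meas: "s' x \<in> borel_measurable lborel" for x
    using s_meas[of x] by (cases "0 < x") (auto simp: s'_def[abs_def])
  have \<Lambda>'_meas: "(\<lambda>y. \<Lambda> y * indicator {0<..} y) \<in> borel_measurable lborel"
    using \<Lambda>_meas by simp
  have lim': "AE y in lborel. ((\<lambda>x. s' x y) \<longlongrightarrow> \<Lambda> y * indicator {0<..} y) at_top"
  proof (intro always_eventually allI)
    fix y
    have "\<forall>\<^sub>F x in at_top. s x y = s' x y"
      using eventually_gt_at_top[of 0] by eventually_elim (simp add: s'_def)
    with lim[of y] show "((\<lambda>x. s' x y) \<longlongrightarrow> \<Lambda> y * indicator {0<..} y) at_top"
      by (rule Lim_transform_eventually)
  qed
  have bound': "\<forall>\<^sub>F x in at_top. AE y in lborel. norm (s' x y) \<le> exp (- (y * \<beta>)) * indicator {0<..} y"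
    using eventually_gt_at_top[of 0] by eventually_elim (use bound in \<open>simp add: s'_def\<close>)
  define K where "K = (\<integral>y. \<Lambda> y * indicator {0<..} y \<partial>lborel)"
  note dct = \<Lambda>'_meas s'_meas exp_integrable[OF \<beta>, of 0] lim' bound'
  have int_s: "((\<lambda>x. \<integral>y. s' x y \<partial>lborel) \<longlongrightarrow> K) at_top"
    unfolding K_def by (rule integral_dominated_convergence_at_top[OF dct])
  have int_\<Lambda>: "integrable lborel (\<lambda>y. \<Lambda> y * indicator {0<..} y)"
    by (rule integrable_dominated_convergence_at_top[OF dct])
  have "K \<noteq> 0"
  proof
    assume "K = 0"
    then have "AE y in lborel. \<Lambda> y * indicator {0<..} y = 0"
      unfolding K_def using \<Lambda>_pos
      by (subst (asm) integral_nonneg_eq_0_iff_AE[OF int_\<Lambda>])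
        (auto intro!: always_eventually less_imp_le split: split_indicator)
    then have "AE y in lborel. y \<notin> {0<..<1::real}"
    proof (rule eventually_mono)
      fix y :: real assume "\<Lambda> y * indicator {0<..} y = 0"
      then show "y \<notin> {0<..<1}" using \<Lambda>_pos[of y] by (auto simp: indicator_def)
    qed
    then have "{0<..<1::real} \<in> null_sets lborel"
      by (subst (asm) AE_iff_null) (auto simp: greaterThanLessThan_def greaterThan_def lessThan_def Int_def)
    then show False by (auto simp: null_sets_def)
  qed
  moreover have "0 \<le> K"
    unfolding K_def using \<Lambda>_pos
    by (intro Bochner_Integration.integral_nonneg) (auto intro: less_imp_le split: split_indicator)
  ultimately have "0 < K" by simp
  have "\<forall>\<^sub>F x in at_top. (\<integral>y. s' x y \<partial>lborel) = tail_prob x x * exp (m * x)"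
    using eventually_gt_at_top[of 0]
  proof eventually_elim
    case (elim x)
    have "tail_prob x x = (\<integral>y. tail_slice x (x + y) * indicator {0<..} y \<partial>lborel)"
      unfolding tail_prob_def
      by (subst lborel_integral_real_affine[of 1 _ x])
        (auto intro!: Bochner_Integration.integral_cong split: split_indicator)
    then have "tail_prob x x * exp (m * x) = (\<integral>y. exp (m * x) * (tail_slice x (x + y) * indicator {0<..} y) \<partial>lborel)"
      by (simp add: mult.commute)
    also have "\<dots> = (\<integral>y. s' x y \<partial>lborel)"
      using elim by (intro Bochner_Integration.integral_cong) (auto simp: s'_def s_def)
    finally show ?case by simp
  qed
  with int_s have "((\<lambda>x. tail_prob x x * exp (m * x)) \<longlongrightarrow> K) at_top"
    by (rule Lim_transform_eventually)
  with \<open>0 < K\<close> show ?thesis unfolding m_def by blast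
qed

end

section \<open>Shifting the threshold of the first and third components\<close>

context stable_tail_density
begin

text \<open>Regular variation of \<open>B\<close> at 0: a relative change of the argument close to 1 changes the value by a factor
  close to 1, uniformly near 0.\<close>
lemma B_slow:
  assumes "0 < w" "w < 1"
  obtains t0 c where "0 < t0" "t0 < 1" "0 < c" "c < 1"
    "\<And>t t'. 0 < t' \<Longrightarrow> t' \<le> t \<Longrightarrow> t \<le> t0 \<Longrightarrow> c * t \<le> t' \<Longrightarrow> (1 - w) * B t \<le> B t'"
proof -
  \<comment> \<open>chosen such that \<open>(1 - v)^2 / (1 + v) \<ge> 1 - w\<close>\<close>
  define v where "v = w / 4"
  have v: "0 < v" "v < 1" using assms by (auto simp: v_def)
  obtain k where k: "k > 0" "((\<lambda>t. B t / t powr (s2 + 1)) \<longlongrightarrow> k) (at_right 0)"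
    using B_asymp by blast
  have "\<forall>\<^sub>F t in at_right 0. k * (1 - v) < B t / t powr (s2 + 1)" "\<forall>\<^sub>F t in at_right 0. B t / t powr (s2 + 1) < k * (1 + v)"
    using v k(1) by (auto intro!: order_tendstoD[OF k(2)])
  then have "\<forall>\<^sub>F t in at_right 0. k * (1 - v) < B t / t powr (s2 + 1) \<and> B t / t powr (s2 + 1) < k * (1 + v)"
    by (rule eventually_conj)
  then obtain d where d: "d > 0" "\<And>t. 0 < t \<Longrightarrow> t < d \<Longrightarrow> k * (1 - v) < B t / t powr (s2 + 1) \<and> B t / t powr (s2 + 1) < k * (1 + v)"
    unfolding eventually_at_right_field by blast
  have "((\<lambda>c. c powr (s2 + 1)) \<longlongrightarrow> 1 powr (s2 + 1)) (at_left (1::real))"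
    by (intro tendsto_intros) auto
  then have "\<forall>\<^sub>F c in at_left 1. 1 - v < c powr (s2 + 1)"
    using v by (intro order_tendstoD(1)) auto
  then have "\<exists>c. (1 - v < c powr (s2 + 1)) \<and> 0 < c \<and> c < 1"
    by (intro eventually_happens'[OF _ eventually_conj[OF _ eventually_at_left_1_gt_0]]) auto
  then obtain c where c: "1 - v < c powr (s2 + 1)" "0 < c" "c < 1" by blast
  show ?thesis
  proof (rule that[of "min (d / 2) (1 / 2)" c])
    fix t t' assume t: "0 < t'" "t' \<le> t" "t \<le> min (d / 2) (1 / 2)" "c * t \<le> t'"
    then have tt: "0 < t" "t < d" "t' < d" using d(1) by auto
    have pos: "0 < t powr (s2 + 1)" "0 < t' powr (s2 + 1)" using tt t by auto
    have 1: "B t \<le> k * (1 + v) * t powr (s2 + 1)"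
      using d(2)[OF tt(1,2)] pos by (simp add: pos_divide_less_eq less_imp_le)
    have 2: "k * (1 - v) * t' powr (s2 + 1) \<le> B t'"
      using d(2)[OF t(1) tt(3)] pos by (simp add: pos_less_divide_eq less_imp_le)
    have "(1 - v) * t powr (s2 + 1) \<le> c powr (s2 + 1) * t powr (s2 + 1)"
      using c by (intro mult_right_mono) auto
    also have "\<dots> = (c * t) powr (s2 + 1)" using c tt by (simp add: powr_mult)
    also have "\<dots> \<le> t' powr (s2 + 1)" using t c tt s_gt by (intro powr_mono2) auto
    finally have 3: "(1 - v) * t powr (s2 + 1) \<le> t' powr (s2 + 1)" .
    have "(1 - w) * (1 + v) \<le> (1 - v) * (1 - v)" using v by (simp add: v_def algebra_simps)
    then have "((1 - w) * (1 + v)) * (k * t powr (s2 + 1)) \<le> ((1 - v) * (1 - v)) * (k * t powr (s2 + 1))"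
      using k by (intro mult_right_mono) auto
    also have "\<dots> = k * (1 - v) * ((1 - v) * t powr (s2 + 1))" by (simp add: algebra_simps)
    also have "\<dots> \<le> k * (1 - v) * t' powr (s2 + 1)" using 3 k v by (intro mult_left_mono) auto
    also have "\<dots> \<le> B t'" by (rule 2)
    finally have 4: "(1 - w) * (k * (1 + v) * t powr (s2 + 1)) \<le> B t'" by (simp add: algebra_simps)
    have "(1 - w) * B t \<le> (1 - w) * (k * (1 + v) * t powr (s2 + 1))"
      using 1 assms by (intro mult_left_mono) auto
    then show "(1 - w) * B t \<le> B t'" using 4 by linarith
  qed (use d c in auto)
qed

text \<open>For \<open>y \<le> \<epsilon> * x\<close> the angle \<open>y / (x + y)\<close> is small. Hence \<open>L\<close> grows with slope \<open>A\<close> close to 1 in its first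
  argument, and \<open>B\<close> hardly changes by \<open>B_slow\<close>.\<close>
lemma cond_surv_shift:
  assumes w: "0 < w" "w < 1" and \<delta>: "0 < \<delta>"
  obtains \<epsilon> X where "0 < \<epsilon>" "\<epsilon> \<le> 1/2" "0 < X"
    "\<And>x y. X \<le> x \<Longrightarrow> 0 < y \<Longrightarrow> y \<le> \<epsilon> * x \<Longrightarrow> (1 - w) * exp (- \<delta>) * cond_surv x y \<le> cond_surv (x + \<delta>) y"
    "\<And>x y. X \<le> x \<Longrightarrow> 0 < y \<Longrightarrow> y \<le> \<epsilon> * x \<Longrightarrow> cond_surv (x + \<delta>) y \<le> (1 + w) * exp (- \<delta>) * cond_surv x y"
proof -
  obtain t0 c where t0: "0 < t0" "t0 < 1" "0 < c" "c < 1"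
    "\<And>t t'. 0 < t' \<Longrightarrow> t' \<le> t \<Longrightarrow> t \<le> t0 \<Longrightarrow> c * t \<le> t' \<Longrightarrow> (1 - w) * B t \<le> B t'"
    using B_slow[OF w] by blast
  have "(A \<longlongrightarrow> A 0) (at 0)" using contA[of 0] by (simp add: isCont_def)
  then have "(A \<longlongrightarrow> 1) (at_right 0)" by (auto intro: tendsto_mono[OF at_le])
  then have "((\<lambda>e. exp (- (\<delta> * A e))) \<longlongrightarrow> exp (- (\<delta> * 1))) (at_right 0)"
    by (intro tendsto_intros)
  then have "\<forall>\<^sub>F e in at_right 0. exp (- (\<delta> * A e)) < (1 + w) * exp (- \<delta>)"
    using w by (intro order_tendstoD(2)) auto
  then have "\<exists>e. (exp (- (\<delta> * A e)) < (1 + w) * exp (- \<delta>)) \<and> 0 < e \<and> e < 1"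
    by (intro eventually_happens'[OF _ eventually_conj[OF _ eventually_at_right_0_lt_1]]) auto
  then obtain e where e: "exp (- (\<delta> * A e)) < (1 + w) * exp (- \<delta>)" "0 < e" "e < 1" by blast
  define \<epsilon> where "\<epsilon> = min (1/2) (min e t0)"
  \<comment> \<open>from here on \<open>x / (x + \<delta>) \<ge> c\<close>\<close>
  define X where "X = max 1 (c * \<delta> / (1 - c))"
  have \<epsilon>: "0 < \<epsilon>" "\<epsilon> \<le> 1/2" "\<epsilon> \<le> e" "\<epsilon> \<le> t0"
    using e t0 by (auto simp: \<epsilon>_def)
  have X: "0 < X" by (simp add: X_def)
  have T: "0 < y / (x + y)" "y / (x + y) \<le> \<epsilon>" "y / (x + \<delta> + y) \<le> y / (x + y)" "0 < y / (x + \<delta> + y)"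
    "c * (y / (x + y)) \<le> y / (x + \<delta> + y)"
    if xy: "X \<le> x" "0 < y" "y \<le> \<epsilon> * x" for x y
  proof -
    have x: "0 < x" using xy X by simp
    show "0 < y / (x + y)" "0 < y / (x + \<delta> + y)" using x xy \<delta> by auto
    have "y \<le> \<epsilon> * (x + y)" using xy x \<epsilon> by (simp add: distrib_left add_increasing2)
    then show "y / (x + y) \<le> \<epsilon>" using x xy by (simp add: pos_divide_le_eq)
    show "y / (x + \<delta> + y) \<le> y / (x + y)" using x xy \<delta> by (intro divide_left_mono) auto
    have "c * \<delta> / (1 - c) \<le> x" using xy by (simp add: X_def)
    then have "c * \<delta> \<le> x * (1 - c)" using t0 by (simp add: pos_divide_le_eq)
    also have "\<dots> \<le> (x + y) * (1 - c)" using t0 xy by (intro mult_right_mono) auto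
    finally have "c * (x + \<delta> + y) \<le> x + y" by (simp add: algebra_simps)
    then have "c * (x + \<delta> + y) * y \<le> (x + y) * y" using xy by (intro mult_right_mono) auto
    then show "c * (y / (x + y)) \<le> y / (x + \<delta> + y)" using x xy \<delta> by (simp add: field_simps)
  qed
  show ?thesis
  proof (rule that[OF \<epsilon>(1,2) X])
    fix x y assume xy: "X \<le> x" "0 < y" "y \<le> \<epsilon> * x"
    note T = T[OF xy]
    have x: "0 < x" using xy X by simp
    have "(1 - w) * B (y / (x + y)) \<le> B (y / (x + \<delta> + y))" using T \<epsilon> by (intro t0) auto
    moreover have "L (x + \<delta>) y \<le> L x y + \<delta>" using x xy \<delta> by (intro L_add_fst_le) auto
    then have "exp (- \<delta>) * exp (y - L x y) \<le> exp (y - L (x + \<delta>) y)" by (simp flip: exp_add)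
    ultimately have "((1 - w) * B (y / (x + y))) * (exp (- \<delta>) * exp (y - L x y)) \<le> cond_surv (x + \<delta>) y"
      unfolding cond_surv_def using T by (intro mult_mono) (auto intro: B_bounds)
    then show "(1 - w) * exp (- \<delta>) * cond_surv x y \<le> cond_surv (x + \<delta>) y"
      by (simp add: cond_surv_def mult_ac)
    have "\<delta> * A (y / (x + y)) \<le> L (x + \<delta>) y - L x y"
      using L_diff_ge[of x y "x + \<delta>" y] x xy by simp
    moreover have "\<delta> * A e \<le> \<delta> * A (y / (x + y))"
      using antimonoA[of "y / (x + y)" e] T \<epsilon> \<delta> by (intro mult_left_mono) auto
    ultimately have "exp (y - L (x + \<delta>) y) \<le> exp (- (\<delta> * A e)) * exp (y - L x y)"
      by (simp flip: exp_add)
    also have "\<dots> \<le> ((1 + w) * exp (- \<delta>)) * exp (y - L x y)"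
      using e by (intro mult_right_mono) auto
    finally have "cond_surv (x + \<delta>) y \<le> B (y / (x + y)) * (((1 + w) * exp (- \<delta>)) * exp (y - L x y))"
      unfolding cond_surv_def using T by (intro mult_mono monoB) (auto intro: B_bounds)
    then show "cond_surv (x + \<delta>) y \<le> (1 + w) * exp (- \<delta>) * cond_surv x y"
      by (simp add: cond_surv_def mult_ac)
  qed
qed

lemma cond_surv_le_near:
  assumes "0 < x" "0 < y" "y \<le> 1/2 * x" shows "cond_surv x y \<le> exp (- (x / 2))"
proof -
  have "cond_surv x y \<le> exp (y - L x y)" using assms by (intro cond_surv_bounds)
  also have "\<dots> \<le> exp (- (x / 2))" using L_ge_fst[of x y] assms by simp
  finally show ?thesis .
qed

end

context vine
begin

text \<open>The factors of \<open>p\<close> and \<open>q\<close> pass to the tail copula by monotonicity and homogeneity, at the cost of the relative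
  errors collected below.\<close>
lemma tail_slice_shift:
  assumes \<omega>: "0 < \<omega>" "\<omega> < 1" and \<delta>: "0 < \<delta>"
  obtains \<epsilon> X where "0 < \<epsilon>" "\<epsilon> \<le> 1/2" "0 < X"
    "\<And>x y. X \<le> x \<Longrightarrow> 0 < y \<Longrightarrow> y \<le> \<epsilon> * x \<Longrightarrow> \<bar>tail_slice (x + \<delta>) y - exp (- \<delta>) * tail_slice x y\<bar> \<le> \<omega> * tail_slice x y"
proof -
  \<comment> \<open>chosen such that \<open>(1 + w)^2 / (1 - w) \<le> 1 + \<omega>\<close> and \<open>(1 - w)^2 / (1 + w) \<ge> 1 - \<omega>\<close>\<close>
  define w where "w = \<omega> / 8"
  have w: "0 < w" "w < 1/8" using \<omega> by (auto simp: w_def)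
  then have w1: "w < 1" by simp
  have om: "\<omega> = 8 * w" by (simp add: w_def)
  obtain e1 X1 where 1: "0 < e1" "e1 \<le> 1/2" "0 < X1"
    "\<And>x y. X1 \<le> x \<Longrightarrow> 0 < y \<Longrightarrow> y \<le> e1 * x \<Longrightarrow> (1 - w) * exp (- \<delta>) * p x y \<le> p (x + \<delta>) y"
    "\<And>x y. X1 \<le> x \<Longrightarrow> 0 < y \<Longrightarrow> y \<le> e1 * x \<Longrightarrow> p (x + \<delta>) y \<le> (1 + w) * exp (- \<delta>) * p x y"
    using P.cond_surv_shift[OF w(1) w1 \<delta>] by blast
  obtain e2 X2 where 2: "0 < e2" "e2 \<le> 1/2" "0 < X2"
    "\<And>x y. X2 \<le> x \<Longrightarrow> 0 < y \<Longrightarrow> y \<le> e2 * x \<Longrightarrow> (1 - w) * exp (- \<delta>) * q x y \<le> q (x + \<delta>) y"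
    "\<And>x y. X2 \<le> x \<Longrightarrow> 0 < y \<Longrightarrow> y \<le> e2 * x \<Longrightarrow> q (x + \<delta>) y \<le> (1 + w) * exp (- \<delta>) * q x y"
    using Q.cond_surv_shift[OF w(1) w1 \<delta>] by blast
  obtain d where d: "0 < d" "d < 1"
    "\<And>p q. 0 < p \<Longrightarrow> p \<le> d \<Longrightarrow> 0 < q \<Longrightarrow> q \<le> d \<Longrightarrow> (1 - w) * C.tail_copula p q \<le> C.joint_tail p q \<and> C.joint_tail p q \<le> (1 + w) * C.tail_copula p q"
    using C.joint_tail_asymp[OF w(1)] by blast
  \<comment> \<open>beyond \<open>- 2 * ln d\<close> the bound \<open>exp (- x / 2)\<close> on \<open>p\<close> and \<open>q\<close> is at most \<open>d\<close>\<close>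
  define X where "X = max (max X1 X2) (2 * - ln d)"
  define \<epsilon> where "\<epsilon> = min e1 e2"
  have \<epsilon>: "0 < \<epsilon>" "\<epsilon> \<le> 1/2" "\<epsilon> \<le> e1" "\<epsilon> \<le> e2"
    using 1 2 by (auto simp: \<epsilon>_def)
  have X: "0 < X" "X1 \<le> X" "X2 \<le> X" "2 * - ln d \<le> X" using 1 by (auto simp: X_def)
  show ?thesis
  proof (rule that[OF \<epsilon>(1,2) X(1)])
    fix x y assume xy: "X \<le> x" "0 < y" "y \<le> \<epsilon> * x"
    have x: "0 < x" using xy X by simp
    have "\<epsilon> * x \<le> e1 * x" "\<epsilon> * x \<le> e2 * x" "\<epsilon> * x \<le> 1/2 * x"
      using \<epsilon> x by (simp_all add: mult_right_mono)
    then have near: "y \<le> e1 * x" "y \<le> e2 * x" "y \<le> 1/2 * x"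
      using xy by linarith+
    define l where "l = exp (- \<delta>)"
    have l: "0 < l" "l < 1" using \<delta> by (auto simp: l_def)
    have small: "p x' y \<le> d" "q x' y \<le> d" if "x \<le> x'" for x'
    proof -
      have "exp (- (x' / 2)) \<le> exp (ln d)" using that X xy by simp
      then have "exp (- (x' / 2)) \<le> d" using d by simp
      then show "p x' y \<le> d" "q x' y \<le> d"
        using P.cond_surv_le_near[of x' y] Q.cond_surv_le_near[of x' y] x xy near that by auto
    qed
    note b = P.cond_surv_bounds(1)[OF x xy(2)] Q.cond_surv_bounds(1)[OF x xy(2)]
      P.cond_surv_bounds(1)[of "x + \<delta>" y] Q.cond_surv_bounds(1)[of "x + \<delta>" y]
    have pos: "0 < p x y" "0 < q x y" "0 < p (x + \<delta>) y" "0 < q (x + \<delta>) y"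
      using b x xy \<delta> by auto
    let ?R = "C.tail_copula (p x y) (q x y)" and ?R' = "C.tail_copula (p (x + \<delta>) y) (q (x + \<delta>) y)"
    let ?c = "C.joint_tail (p x y) (q x y)" and ?c' = "C.joint_tail (p (x + \<delta>) y) (q (x + \<delta>) y)"
    have R0: "0 < ?R" using pos by (intro C.tail_copula_pos)
    have c: "(1 - w) * ?R \<le> ?c" "?c \<le> (1 + w) * ?R"
      using d(3)[OF pos(1) small(1) pos(2) small(2)] by auto
    have c': "(1 - w) * ?R' \<le> ?c'" "?c' \<le> (1 + w) * ?R'"
      using d(3)[OF pos(3) small(1) pos(4) small(2)] \<delta> by auto
    have "?R' \<le> C.tail_copula ((1 + w) * l * p x y) ((1 + w) * l * q x y)"
      using 1(5)[of x y] 2(5)[of x y] xy X near pos by (intro C.tail_copula_mono) (auto simp: l_def)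
    also have "\<dots> = (1 + w) * l * ?R" using w l pos by (intro C.tail_copula_homogeneous) auto
    finally have R'_le: "?R' \<le> (1 + w) * l * ?R" .
    have "(1 - w) * l * ?R = C.tail_copula ((1 - w) * l * p x y) ((1 - w) * l * q x y)"
      using w l pos by (intro C.tail_copula_homogeneous[symmetric]) auto
    also have "\<dots> \<le> ?R'"
      using 1(4)[of x y] 2(4)[of x y] xy X near pos w by (intro C.tail_copula_mono) (auto simp: l_def)
    finally have R'_ge: "(1 - w) * l * ?R \<le> ?R'" .
    have joint_tail0: "0 \<le> ?c" using R0 w by (intro order_trans[OF mult_nonneg_nonneg c(1)]) auto
    have lR: "0 \<le> l * ?R" using l R0 by simp
    have up: "?c' \<le> (1 + \<omega>) * l * ?c"
    proof -
      have "?c' \<le> (1 + w) * ((1 + w) * l * ?R)"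
        using w by (intro order_trans[OF c'(2) mult_left_mono[OF R'_le]]) auto
      also have "\<dots> = ((1 + w) * (1 + w)) * (l * ?R)" by (simp add: algebra_simps)
      also have "\<dots> \<le> ((1 + \<omega>) * (1 - w)) * (l * ?R)"
      proof (intro mult_right_mono lR)
        have "w * w \<le> w * (1/8)" using w by (intro mult_left_mono) auto
        then show "(1 + w) * (1 + w) \<le> (1 + \<omega>) * (1 - w)" using w by (simp add: om algebra_simps)
      qed
      also have "\<dots> = (1 + \<omega>) * l * ((1 - w) * ?R)" by (simp add: algebra_simps)
      also have "\<dots> \<le> (1 + \<omega>) * l * ?c" using c(1) \<omega> l by (intro mult_left_mono) auto
      finally show ?thesis .
    qed
    have lo: "(1 - \<omega>) * l * ?c \<le> ?c'"
    proof -
      have "(1 - \<omega>) * l * ?c \<le> (1 - \<omega>) * l * ((1 + w) * ?R)"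
        using c(2) \<omega> l by (intro mult_left_mono) auto
      also have "\<dots> = ((1 - \<omega>) * (1 + w)) * (l * ?R)" by (simp add: algebra_simps)
      also have "\<dots> \<le> ((1 - w) * (1 - w)) * (l * ?R)"
      proof (intro mult_right_mono lR)
        show "(1 - \<omega>) * (1 + w) \<le> (1 - w) * (1 - w)" using w by (simp add: om algebra_simps)
      qed
      also have "\<dots> = (1 - w) * ((1 - w) * l * ?R)" by (simp add: algebra_simps)
      also have "\<dots> \<le> (1 - w) * ?R'" using R'_ge w by (intro mult_left_mono) auto
      also have "\<dots> \<le> ?c'" by (rule c'(1))
      finally show ?thesis .
    qed
    have "\<omega> * l * ?c \<le> \<omega> * ?c" using l \<omega> joint_tail0 by (intro mult_right_mono) auto
    then have "\<bar>?c' - l * ?c\<bar> \<le> \<omega> * ?c"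
      using up lo by (simp add: algebra_simps abs_le_iff)
    then have "exp (- y) * \<bar>?c' - l * ?c\<bar> \<le> exp (- y) * (\<omega> * ?c)"
      by (intro mult_left_mono) auto
    moreover have "tail_slice (x + \<delta>) y - exp (- \<delta>) * tail_slice x y = exp (- y) * (?c' - l * ?c)"
      by (simp add: tail_slice_def l_def algebra_simps)
    then have "\<bar>tail_slice (x + \<delta>) y - exp (- \<delta>) * tail_slice x y\<bar> = exp (- y) * \<bar>?c' - l * ?c\<bar>"
      by (simp add: abs_mult)
    ultimately show "\<bar>tail_slice (x + \<delta>) y - exp (- \<delta>) * tail_slice x y\<bar> \<le> \<omega> * tail_slice x y"
      by (simp add: tail_slice_def mult_ac)
  qed
qed

end

section \<open>Slow variation\<close>

context stable_tail_density
begin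

text \<open>\<open>L 1 (2 * e)\<close> tends to \<open>L 1 0 = 1\<close>.\<close>
lemma L_near_axis: assumes "1 < c" obtains e where "0 < e" "e < 1/4" "L 1 (2 * e) < c"
proof -
  have "((\<lambda>e. L 1 (2 * e)) \<longlongrightarrow> L 1 (2 * 0)) (at_right 0)"
    using eventually_at_right_0_lt_1
    by (intro tendsto_L tendsto_intros) (auto elim: eventually_mono)
  then have "\<forall>\<^sub>F e in at_right 0. L 1 (2 * e) < c"
    using assms by (intro order_tendstoD(2)) (auto simp: L_axis)
  moreover have "\<forall>\<^sub>F e::real in at_right 0. 0 < e \<and> e < 1/4"
    by (rule eventually_mono[OF eventually_at_right_real[of 0 "1/4"]]) auto
  ultimately have "\<exists>e. L 1 (2 * e) < c \<and> 0 < e \<and> e < 1/4"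
    by (intro eventually_happens'[OF _ eventually_conj]) auto
  then show ?thesis using that by blast
qed

lemma cond_surv_ge_near:
  assumes "0 < x" "0 < e" "e * x \<le> y" "y \<le> 2 * e * x"
  shows "B (e / (1 + e)) * exp (- (x * L 1 (2 * e))) \<le> exp (- y) * cond_surv x y"
proof -
  have y: "0 < y" using assms mult_pos_pos[of e x] by linarith
  have "e / (1 + e) \<le> y / (x + y)" using assms y by (simp add: field_simps)
  then have B: "B (e / (1 + e)) \<le> B (y / (x + y))" by (rule monoB)
  have "L x y \<le> L (x * 1) (x * (2 * e))"
    using assms y by (intro order_trans[OF L_mono_snd[of x y "2 * e * x"]]) (auto simp: mult_ac)
  also have "\<dots> = x * L 1 (2 * e)" using assms by (intro L_homogeneous) auto
  finally have "exp (- (x * L 1 (2 * e))) \<le> exp (- L x y)" by simp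
  with B have "B (e / (1 + e)) * exp (- (x * L 1 (2 * e))) \<le> B (y / (x + y)) * exp (- L x y)"
    using B_pos[of "y / (x + y)"] assms y by (intro mult_mono) auto
  also have "\<dots> = exp (- y) * cond_surv x y" by (simp add: cond_surv_def exp_diff exp_minus field_simps)
  finally show ?thesis .
qed

end

context vine
begin

lemma integral_interval_mono:
  assumes "0 < x" "0 \<le> a" "a \<le> b" and le: "\<And>y. a < y \<Longrightarrow> y \<le> b \<Longrightarrow> c \<le> tail_slice x y"
  shows "c * (b - a) \<le> (\<integral>y. tail_slice x y * indicator {a<..b} y \<partial>lborel)"
proof -
  have "(\<integral>y. c * indicator {a<..b} y \<partial>lborel) \<le> (\<integral>y. tail_slice x y * indicator {a<..b} y \<partial>lborel)"
    using assms by (intro integral_mono tail_slice_integrable) (auto split: split_indicator)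
  then show ?thesis using assms by (simp add: mult.commute)
qed

lemma tail_prob_split:
  assumes "0 < x" "0 \<le> b"
  shows "tail_prob x 0 = (\<integral>y. tail_slice x y * indicator {0<..b} y \<partial>lborel) + tail_prob x b"
proof -
  have "tail_prob x 0 = (\<integral>y. tail_slice x y * indicator {0<..b} y + tail_slice x y * indicator {b<..} y \<partial>lborel)"
    unfolding tail_prob_def using assms by (intro Bochner_Integration.integral_cong) (auto split: split_indicator)
  also have "\<dots> = (\<integral>y. tail_slice x y * indicator {0<..b} y \<partial>lborel) + tail_prob x b"
    unfolding tail_prob_def using assms by (intro Bochner_Integration.integral_add tail_slice_integrable) auto
  finally show ?thesis .
qed

text \<open>On \<open>e * x < y \<le> 2 * e * x\<close> the integrand is bounded below by a multiple of \<open>exp (- x * m)\<close>, with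
  \<open>m\<close> as close to 1 as wanted when \<open>e\<close> is small.\<close>
lemma tail_prob_ge:
  assumes "1 < c"
  shows "\<exists>c'>0. \<exists>m<c. \<exists>X>0. \<forall>x\<ge>X. c' * exp (- (x * m)) \<le> tail_prob x 0"
proof -
  obtain e1 where e1: "0 < e1" "e1 < 1/4" "LP 1 (2 * e1) < c" using P.L_near_axis[OF assms] by blast
  obtain e2 where e2: "0 < e2" "e2 < 1/4" "LQ 1 (2 * e2) < c" using Q.L_near_axis[OF assms] by blast
  define e where "e = min e1 e2"
  have e: "0 < e" "e < 1/4" using e1 e2 by (auto simp: e_def)
  have "LP 1 (2 * e) \<le> LP 1 (2 * e1)" "LQ 1 (2 * e) \<le> LQ 1 (2 * e2)"
    using e by (auto intro!: P.L_mono_snd Q.L_mono_snd simp: e_def)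
  then have L: "LP 1 (2 * e) < c" "LQ 1 (2 * e) < c" using e1 e2 by auto
  define m where "m = max (LP 1 (2 * e)) (LQ 1 (2 * e))"
  define k where "k = min (BP (e / (1 + e))) (BQ (e / (1 + e)))"
  have k: "0 < k" using e P.B_pos Q.B_pos by (simp add: k_def)
  have \<rho>: "0 < C.\<rho>" by (rule C.\<rho>_pos)
  \<comment> \<open>the interval has length at least 1, and \<open>p\<close> and \<open>q\<close> are at most \<open>1/2\<close> on it\<close>
  define X where "X = max (1 / e) (2 * ln 2)"
  have X: "0 < X" using e by (simp add: X_def less_max_iff_disj)
  have all: "1/4 * C.\<rho> * k * exp (- (x * m)) \<le> tail_prob x 0" if x: "X \<le> x" for x
  proof -
    have x0: "0 < x" using x X by simp
    have ex: "1 \<le> e * x"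
    proof -
      have "1 / e \<le> x" using x by (simp add: X_def)
      then show ?thesis using e by (simp add: pos_divide_le_eq mult.commute)
    qed
    let ?c = "1/4 * C.\<rho> * k * exp (- (x * m))"
    have c0: "0 \<le> ?c" using k \<rho> by simp
    have lower: "?c \<le> tail_slice x y" if y: "e * x < y" "y \<le> 2 * e * x" for y
    proof -
      have y0: "0 < y" using y ex by linarith
      have "2 * e * x \<le> 1/2 * x" using e x0 by (intro mult_right_mono) auto
      then have near: "y \<le> 1/2 * x" using y by simp
      have "exp (- (x / 2)) \<le> exp (ln (1/2))" using x by (simp add: X_def ln_div)
      then have "exp (- (x / 2)) \<le> 1/2" by (subst (asm) exp_ln) auto
      then have half: "p x y \<le> 1/2" "q x y \<le> 1/2"
        using P.cond_surv_le_near[OF x0 y0 near] Q.cond_surv_le_near[OF x0 y0 near] by auto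
      have pos: "0 < p x y" "0 < q x y"
        using P.cond_surv_bounds[OF x0 y0] Q.cond_surv_bounds[OF x0 y0] by auto
      have "k * exp (- (x * m)) \<le> BP (e / (1 + e)) * exp (- (x * LP 1 (2 * e)))"
        "k * exp (- (x * m)) \<le> BQ (e / (1 + e)) * exp (- (x * LQ 1 (2 * e)))"
        using k x0 e by (auto intro!: mult_mono P.B_bounds Q.B_bounds simp: k_def m_def)
      then have "k * exp (- (x * m)) \<le> exp (- y) * p x y" "k * exp (- (x * m)) \<le> exp (- y) * q x y"
        using P.cond_surv_ge_near[of x e y] Q.cond_surv_ge_near[of x e y] x0 e y by auto
      then have "k * exp (- (x * m)) \<le> exp (- y) * min (p x y) (q x y)" by (simp add: min_def)
      then have "1/4 * C.\<rho> * (k * exp (- (x * m))) \<le> 1/4 * C.\<rho> * (exp (- y) * min (p x y) (q x y))"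
        using \<rho> by (intro mult_left_mono) auto
      also have "\<dots> = exp (- y) * (1/4 * (C.\<rho> * min (p x y) (q x y)))" by simp
      also have "\<dots> \<le> exp (- y) * ((1 - p x y) * (1 - q x y) * C.tail_copula (p x y) (q x y))"
      proof (intro mult_left_mono mult_mono C.tail_copula_ge pos)
        have "1/2 * (1/2) \<le> (1 - p x y) * (1 - q x y)" using half by (intro mult_mono) auto
        then show "1/4 \<le> (1 - p x y) * (1 - q x y)" by simp
      qed (use half pos \<rho> in auto)
      also have "\<dots> \<le> tail_slice x y"
        unfolding tail_slice_def using half pos by (intro mult_left_mono C.joint_tail_ge) auto
      finally show ?thesis by simp
    qed
    have "?c \<le> ?c * (2 * e * x - e * x)" using ex c0 by (simp add: mult_le_cancel_left1)
    also have "\<dots> \<le> (\<integral>y. tail_slice x y * indicator {e * x<..2 * e * x} y \<partial>lborel)"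
      using x0 e lower by (intro integral_interval_mono) auto
    also have "\<dots> \<le> tail_prob x 0"
      unfolding tail_prob_def
    proof (intro integral_mono tail_slice_integrable x0)
      show "{e * x<..2 * e * x} \<subseteq> {0<..}" using ex by auto
      fix y
      have "0 < e * x" using ex by linarith
      then show "tail_slice x y * indicator {e * x<..2 * e * x} y \<le> tail_slice x y * indicator {0<..} y"
        using tail_slice_bounds(1)[OF x0, of y] by (auto split: split_indicator)
    qed auto
    finally show "1/4 * C.\<rho> * k * exp (- (x * m)) \<le> tail_prob x 0" .
  qed
  have "0 < 1/4 * C.\<rho> * k" "m < c" using k \<rho> L by (auto simp: m_def)
  then show ?thesis using X all by blast
qed

lemma tail_prob_pos_eventually: "\<forall>\<^sub>F x in at_top. 0 < tail_prob x 0"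
proof -
  have one_less_two: "(1::real) < 2" by simp
  obtain c' X m where "0 < c'" "m < 2" "0 < X" and ge: "\<forall>x\<ge>X. c' * exp (- (x * m)) \<le> tail_prob x 0"
    using tail_prob_ge[OF one_less_two] by blast
  show ?thesis
    using eventually_ge_at_top[of X]
  proof eventually_elim
    case (elim x)
    have "0 < c' * exp (- (x * m))" using \<open>0 < c'\<close> by simp
    also have "\<dots> \<le> tail_prob x 0" using ge elim by simp
    finally show ?case .
  qed
qed

text \<open>Since \<open>L12 1 \<epsilon> > 1\<close>, the preceding lower bound has a strictly smaller rate.\<close>
lemma far_negligible:
  assumes "0 < \<epsilon>"
  shows "((\<lambda>x. exp (- LP x (\<epsilon> * x)) / tail_prob x 0) \<longlongrightarrow> 0) at_top"
proof -
  have "1 < LP 1 \<epsilon>" using P.L_gt_fst[of 1 \<epsilon>] assms by simp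
  then obtain c' X m where c': "0 < c'" "m < LP 1 \<epsilon>" "0 < X"
    and ge: "\<forall>x\<ge>X. c' * exp (- (x * m)) \<le> tail_prob x 0"
    using tail_prob_ge by blast
  show ?thesis
  proof (rule tendsto_sandwich[OF _ _ tendsto_const])
    show "\<forall>\<^sub>F x in at_top. 0 \<le> exp (- LP x (\<epsilon> * x)) / tail_prob x 0"
      using tail_prob_pos_eventually by eventually_elim simp
    show "\<forall>\<^sub>F x in at_top. exp (- LP x (\<epsilon> * x)) / tail_prob x 0 \<le> 1 / c' * exp (- (x * (LP 1 \<epsilon> - m)))"
      using eventually_ge_at_top[of X] tail_prob_pos_eventually
    proof eventually_elim
      case (elim x)
      then have x: "0 < x" using c' by simp
      have "LP x (\<epsilon> * x) = x * LP 1 \<epsilon>"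
        using P.L_homogeneous[of x 1 \<epsilon>] x assms by (simp add: mult.commute)
      then have "exp (- LP x (\<epsilon> * x)) / tail_prob x 0 \<le> exp (- (x * LP 1 \<epsilon>)) / (c' * exp (- (x * m)))"
        using ge[rule_format, of x] elim c' by (simp add: divide_left_mono)
      also have "\<dots> = 1 / c' * exp (- (x * (LP 1 \<epsilon> - m)))"
        by (simp add: exp_diff exp_minus field_simps)
      finally show ?case .
    qed
    have "((\<lambda>x. exp (- (x * (LP 1 \<epsilon> - m)))) \<longlongrightarrow> 0) at_top"
      using c' by (intro tendsto_exp_decay) simp
    from tendsto_mult_right_zero[OF this]
    show "((\<lambda>x. 1 / c' * exp (- (x * (LP 1 \<epsilon> - m)))) \<longlongrightarrow> 0) at_top" .
  qed
qed

text \<open>Both integrals are cut at \<open>y = \<epsilon> * x\<close>; \<open>tail_slice_shift\<close> compares the lower parts, \<open>far_negligible\<close> discards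
  the upper ones.\<close>
lemma tail_prob_shift_ratio:
  assumes \<delta>: "0 < \<delta>"
  shows "((\<lambda>x. tail_prob (x + \<delta>) 0 / tail_prob x 0) \<longlongrightarrow> exp (- \<delta>)) at_top"
proof (rule tendstoI)
  fix r :: real assume r: "0 < r"
  define \<omega> where "\<omega> = min (1/2) (r / 4)"
  have \<omega>: "0 < \<omega>" "\<omega> < 1" "3 * \<omega> < r" using r by (auto simp: \<omega>_def min_def)
  obtain \<epsilon> X where \<epsilon>: "0 < \<epsilon>" "\<epsilon> \<le> 1/2" "0 < X"
    and shift: "\<And>x y. X \<le> x \<Longrightarrow> 0 < y \<Longrightarrow> y \<le> \<epsilon> * x \<Longrightarrow> \<bar>tail_slice (x + \<delta>) y - exp (- \<delta>) * tail_slice x y\<bar> \<le> \<omega> * tail_slice x y"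
    using tail_slice_shift[OF \<omega>(1,2) \<delta>] by blast
  have far: "\<forall>\<^sub>F x in at_top. exp (- LP x (\<epsilon> * x)) / tail_prob x 0 < \<omega>"
    using order_tendstoD(2)[OF far_negligible[OF \<epsilon>(1)] \<omega>(1)] .
  show "\<forall>\<^sub>F x in at_top. dist (tail_prob (x + \<delta>) 0 / tail_prob x 0) (exp (- \<delta>)) < r"
    using far tail_prob_pos_eventually eventually_ge_at_top[of X]
  proof eventually_elim
    case (elim x)
    then have x: "0 < x" using \<epsilon> by simp
    have ex: "0 < \<epsilon> * x" using x \<epsilon> by simp
    let ?S = "{0<..\<epsilon> * x}"
    let ?N = "\<integral>y. tail_slice x y * indicator ?S y \<partial>lborel" and ?N' = "\<integral>y. tail_slice (x + \<delta>) y * indicator ?S y \<partial>lborel"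
    have int: "integrable lborel (\<lambda>y. tail_slice x y * indicator ?S y)" "integrable lborel (\<lambda>y. tail_slice (x + \<delta>) y * indicator ?S y)"
      using x \<delta> by (auto intro!: tail_slice_integrable)
    have eq: "?N' - exp (- \<delta>) * ?N = (\<integral>y. tail_slice (x + \<delta>) y * indicator ?S y - exp (- \<delta>) * (tail_slice x y * indicator ?S y) \<partial>lborel)"
      using int by simp
    have "\<bar>?N' - exp (- \<delta>) * ?N\<bar> \<le> (\<integral>y. \<omega> * (tail_slice x y * indicator ?S y) \<partial>lborel)"
      unfolding eq
    proof (rule order_trans[OF integral_abs_bound integral_mono])
      show "integrable lborel (\<lambda>y. \<bar>tail_slice (x + \<delta>) y * indicator ?S y - exp (- \<delta>) * (tail_slice x y * indicator ?S y)\<bar>)"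
        by (intro integrable_abs Bochner_Integration.integrable_diff int integrable_mult_right impI)
      show "integrable lborel (\<lambda>y. \<omega> * (tail_slice x y * indicator ?S y))"
        by (intro int integrable_mult_right impI)
      fix y
      show "\<bar>tail_slice (x + \<delta>) y * indicator ?S y - exp (- \<delta>) * (tail_slice x y * indicator ?S y)\<bar> \<le> \<omega> * (tail_slice x y * indicator ?S y)"
        using shift[of x y] elim(3) by (cases "y \<in> ?S") simp_all
    qed
    then have N: "\<bar>?N' - exp (- \<delta>) * ?N\<bar> \<le> \<omega> * ?N"
      unfolding integral_mult_right_zero .
    have s: "tail_prob x 0 = ?N + tail_prob x (\<epsilon> * x)" "tail_prob (x + \<delta>) 0 = ?N' + tail_prob (x + \<delta>) (\<epsilon> * x)"
      using x ex \<delta> by (auto intro!: tail_prob_split)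
    have nonneg: "0 \<le> tail_prob x (\<epsilon> * x)" "0 \<le> tail_prob (x + \<delta>) (\<epsilon> * x)"
      using x ex \<delta> by (auto intro!: tail_prob_nonneg)
    have E: "exp (- LP x (\<epsilon> * x)) \<le> \<omega> * tail_prob x 0"
      using elim by (simp add: pos_divide_less_eq)
    have f1: "tail_prob x (\<epsilon> * x) \<le> \<omega> * tail_prob x 0"
      using tail_prob_le[OF x ex] E by simp
    have "LP x (\<epsilon> * x) \<le> LP (x + \<delta>) (\<epsilon> * x)"
      using x ex \<delta> by (intro P.L_mono_fst) auto
    then have f2: "tail_prob (x + \<delta>) (\<epsilon> * x) \<le> \<omega> * tail_prob x 0"
      using tail_prob_le[of "x + \<delta>" "\<epsilon> * x"] x ex \<delta> E
      by (smt (verit) exp_le_cancel_iff)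
    have l: "0 < exp (- \<delta>)" "exp (- \<delta>) < 1" using \<delta> by auto
    have f1': "exp (- \<delta>) * tail_prob x (\<epsilon> * x) \<le> \<omega> * tail_prob x 0" "0 \<le> exp (- \<delta>) * tail_prob x (\<epsilon> * x)"
      using mult_right_mono[of "exp (- \<delta>)" 1 "tail_prob x (\<epsilon> * x)"] l nonneg f1 by auto
    have "\<omega> * ?N \<le> \<omega> * tail_prob x 0" using s nonneg \<omega> by (intro mult_left_mono) auto
    then have N2: "\<bar>?N' - exp (- \<delta>) * ?N\<bar> \<le> \<omega> * tail_prob x 0" using N by linarith
    have "tail_prob (x + \<delta>) 0 - exp (- \<delta>) * tail_prob x 0 = (?N' - exp (- \<delta>) * ?N) + tail_prob (x + \<delta>) (\<epsilon> * x) - exp (- \<delta>) * tail_prob x (\<epsilon> * x)"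
      unfolding s by (simp add: algebra_simps)
    then have "\<bar>tail_prob (x + \<delta>) 0 - exp (- \<delta>) * tail_prob x 0\<bar> \<le> 3 * (\<omega> * tail_prob x 0)"
      using N2 f1' f2 nonneg by linarith
    also have "\<dots> < r * tail_prob x 0" using \<omega> elim by (simp flip: mult.assoc)
    finally have "\<bar>tail_prob (x + \<delta>) 0 - exp (- \<delta>) * tail_prob x 0\<bar> < r * tail_prob x 0" .
    moreover have "tail_prob (x + \<delta>) 0 / tail_prob x 0 - exp (- \<delta>) = (tail_prob (x + \<delta>) 0 - exp (- \<delta>) * tail_prob x 0) / tail_prob x 0"
      using elim by (simp add: field_simps)
    ultimately show ?case using elim by (simp add: dist_real_def pos_divide_less_eq)
  qed
qed

end

text \<open>The substitution \<open>y = exp x\<close> turns the shift by \<open>\<delta> = ln c\<close> into multiplication by \<open>c\<close>; factors \<open>c < 1\<close> are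
  obtained by inverting the ratio.\<close>
lemma slowly_varying_from_shift:
  fixes S :: "real \<Rightarrow> real"
  assumes anti: "\<And>x y. x \<le> y \<Longrightarrow> S y \<le> S x"
    and pos: "\<forall>\<^sub>F x in at_top. 0 < S x"
    and shift: "\<And>\<delta>. 0 < \<delta> \<Longrightarrow> ((\<lambda>x. S (x + \<delta>) / S x) \<longlongrightarrow> exp (- \<delta>)) at_top"
  shows "slowly_varying (\<lambda>y. y * S (ln y))"
proof -
  let ?L = "\<lambda>y. y * S (ln y)"
  have "(\<lambda>x. - S x) \<in> borel_measurable borel"
    using anti by (intro borel_measurable_mono monoI) simp
  then have "(\<lambda>x. - (- S x)) \<in> borel_measurable borel" by (rule borel_measurable_uminus)
  then have S: "S \<in> borel_measurable borel" by simp
  have meas: "?L \<in> borel_measurable borel"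
    by (intro borel_measurable_times measurable_compose[OF _ S]) auto
  have Lpos: "\<forall>\<^sub>F y in at_top. 0 < ?L y"
    using ln_at_top[unfolded filterlim_iff, rule_format, OF pos] eventually_gt_at_top[of 0]
    by eventually_elim simp
  have gt: "((\<lambda>y. ?L (c * y) / ?L y) \<longlongrightarrow> 1) at_top" if c: "1 < c" for c
  proof -
    have "((\<lambda>y. S (ln y + ln c) / S (ln y)) \<longlongrightarrow> exp (- ln c)) at_top"
      by (rule filterlim_compose[OF shift ln_at_top]) (use c in simp)
    from tendsto_mult[OF tendsto_const[of c] this]
    have "((\<lambda>y. c * (S (ln y + ln c) / S (ln y))) \<longlongrightarrow> 1) at_top"
      using c by (simp add: exp_minus)
    moreover have "\<forall>\<^sub>F y in at_top. c * (S (ln y + ln c) / S (ln y)) = ?L (c * y) / ?L y"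
      using eventually_gt_at_top[of 0] by eventually_elim (use c in \<open>simp add: ln_mult_pos add.commute\<close>)
    ultimately show ?thesis by (rule Lim_transform_eventually)
  qed
  have "((\<lambda>y. ?L (c * y) / ?L y) \<longlongrightarrow> 1) at_top" if c: "0 < c" for c
  proof (cases c "1 :: real" rule: linorder_cases)
    case less
    have "filterlim (\<lambda>y. c * y) at_top at_top"
      using c by (intro filterlim_tendsto_pos_mult_at_top[OF tendsto_const _ filterlim_ident])
    from filterlim_compose[OF gt[of "1 / c"] this] less c
    have "((\<lambda>y. ?L y / ?L (c * y)) \<longlongrightarrow> 1) at_top" by simp
    from tendsto_inverse[OF this] show ?thesis by (simp add: divide_inverse mult.commute)
  next
    case equal
    have "\<forall>\<^sub>F y in at_top. 1 = ?L (c * y) / ?L y"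
      using Lpos by eventually_elim (use equal in auto)
    with tendsto_const show ?thesis by (rule Lim_transform_eventually)
  qed (rule gt)
  with meas Lpos show ?thesis unfolding slowly_varying_def by blast
qed

section \<open>Gauge function and coefficients of tail dependence\<close>

context spectral
begin

lemma inverted_ev_copula_eq: "inverted_ev_copula H = S.iev"
  by (intro ext) (simp add: inverted_ev_copula_def S.iev_def exponent_measure_eq)

lemma ev_copula_eq: "ev_copula H = S.ev"
  by (intro ext) (simp add: ev_copula_def S.ev_def exponent_measure_eq)

end

locale spectral_vine =
  S12: spectral H12 h12 s1_12 s2_12 + S23: spectral H23 h23 s1_23 s2_23 + S13: spectral H13 h13 s1_13 s2_13
  for H12 h12 s1_12 s2_12 H23 h23 s1_23 s2_23 H13 h13 s1_13 s2_13
begin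

sublocale V: vine "stdf H12" "upper_mass H12" "lower_mass H12" "\<lambda>t. t * deriv (lower_mass H12) t" s1_12 s2_12
  "\<lambda>x y. stdf H23 y x" "\<lambda>t. lower_mass H23 (1 - t)" "\<lambda>t. upper_mass H23 (1 - t)"
    "\<lambda>t. (1 - t) * deriv (lower_mass H23) (1 - t)" s2_23 s1_23
  "stdf H13" "upper_mass H13" "lower_mass H13" "\<lambda>t. t * deriv (lower_mass H13) t" s1_13 s2_13
  by (intro vine.intro S12.S.stable_tail_density_axioms S23.S.reflect_density S13.S.stable_tail_density_axioms)

text \<open>All derivatives in the definition of the vine density are evaluated by the copula lemmas; the powers
  of \<open>exp\<close> from the change to exponential margins combine into the form of \<open>vine_formula\<close>.\<close>
lemma vine_density_eq:
  "vine_density (inverted_ev_copula H12) (inverted_ev_copula H23) (ev_copula H13) = V.vine_dens"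
proof (rule ext)
  fix x :: "real \<times> real \<times> real"
  obtain x1 x2 x3 where x: "x = (x1, x2, x3)" by (cases x)
  show "vine_density (inverted_ev_copula H12) (inverted_ev_copula H23) (ev_copula H13) x = V.vine_dens x"
  proof (cases "0 < x1 \<and> 0 < x2 \<and> 0 < x3")
    case True
    then have pos: "0 < x1" "0 < x2" "0 < x3" by auto
    have d1: "deriv (\<lambda>v. inverted_ev_copula H12 (exp_cdf x1) v) (exp_cdf x2) = 1 - S12.T.cond_surv x1 x2"
      unfolding S12.inverted_ev_copula_eq
      using S12.S.has_derivative_iev_snd[of "exp_cdf x1" x2] pos by (intro DERIV_imp_deriv) auto
    have d2: "deriv (\<lambda>u. inverted_ev_copula H23 u (exp_cdf x3)) (exp_cdf x2) = 1 - V.Q.cond_surv x3 x2"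
      unfolding S23.inverted_ev_copula_eq
      using S23.S.has_derivative_iev_fst[of x2 "exp_cdf x3"] pos by (intro DERIV_imp_deriv) auto
    have c12: "copula_density (inverted_ev_copula H12) (exp_cdf x1) (exp_cdf x2) = exp (x1 + x2) * S12.S.surv_dens x1 x2"
      unfolding S12.inverted_ev_copula_eq using pos by (intro S12.S.copula_density_iev)
    have c23: "copula_density (inverted_ev_copula H23) (exp_cdf x2) (exp_cdf x3) = exp (x2 + x3) * V.Q.surv_dens x3 x2"
      unfolding S23.inverted_ev_copula_eq S23.S.surv_dens_reflect[OF pos(3,2)]
      using pos by (intro S23.S.copula_density_iev)
    have c13: "copula_density (ev_copula H13) (1 - S12.T.cond_surv x1 x2) (1 - V.Q.cond_surv x3 x2)
        = S13.S.surv_dens (- ln (1 - S12.T.cond_surv x1 x2)) (- ln (1 - V.Q.cond_surv x3 x2)) / ((1 - S12.T.cond_surv x1 x2) * (1 - V.Q.cond_surv x3 x2))"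
      unfolding S13.ev_copula_eq using V.one_minus_pq[OF pos(1,2)] V.one_minus_pq[OF pos(3,2)]
      by (intro S13.S.copula_density_ev)
    have "exp (- x1) * exp (- x2) * exp (- x3) * (exp (x1 + x2) * a) * (exp (x2 + x3) * b) * c
        = exp (- x2) * (exp x2 * a) * (exp x2 * b) * c" for a b c :: real
    proof -
      have "exp (- x1) * exp (- x2) * exp (- x3) * exp (x1 + x2) * exp (x2 + x3) = exp (- x2) * exp x2 * exp x2"
        by (simp flip: exp_add)
      then show ?thesis by (simp add: mult_ac)
    qed
    then show ?thesis
      using True by (simp add: x vine_density_def V.vine_dens_def V.vine_formula_def d1 d2 c12 c23 c13)
  next
    case False
    then show ?thesis unfolding x vine_density_def V.vine_dens_def by (simp only: prod.case if_False)
  qed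
qed

abbreviation gauge where "gauge \<equiv> vine_gauge H12 H23 s1_13 s2_13"

text \<open>This form avoids the case distinction and is visibly continuous.\<close>
lemma gauge_eq: "gauge (x1, x2, x3) =
    max (stdf H12 x1 x2) (stdf H23 x2 x3) + (1 + s1_13) * max 0 (stdf H12 x1 x2 - stdf H23 x2 x3)
      + (1 + s2_13) * max 0 (stdf H23 x2 x3 - stdf H12 x1 x2)"
  by (simp add: vine_gauge_def stdf_def Let_def max_def min_def algebra_simps)

lemma continuous_gauge: "continuous_on closed_orthant gauge"
proof -
  have c: "continuous_on closed_orthant (\<lambda>x. stdf H12 (fst x) (fst (snd x)))"
    "continuous_on closed_orthant (\<lambda>x. stdf H23 (fst (snd x)) (snd (snd x)))"
    by (auto intro!: S12.T.continuous_on_L S23.T.continuous_on_L continuous_intros simp: closed_orthant_def)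
  have "gauge = (\<lambda>x. max (stdf H12 (fst x) (fst (snd x))) (stdf H23 (fst (snd x)) (snd (snd x)))
      + (1 + s1_13) * max 0 (stdf H12 (fst x) (fst (snd x)) - stdf H23 (fst (snd x)) (snd (snd x)))
      + (1 + s2_13) * max 0 (stdf H23 (fst (snd x)) (snd (snd x)) - stdf H12 (fst x) (fst (snd x))))"
    by (auto simp: gauge_eq)
  then show ?thesis by (simp only:) (intro continuous_intros c)
qed

lemma gauge_homogeneous:
  assumes "x \<in> closed_orthant" "0 < t" shows "gauge (t *\<^sub>R x) = t * gauge x"
proof -
  obtain x1 x2 x3 where x: "x = (x1, x2, x3)" by (cases x)
  then have pos: "0 \<le> x1" "0 \<le> x2" "0 \<le> x3" using assms by (auto simp: closed_orthant_def)
  have m: "max (t * a) (t * b) = t * max a b" "max 0 (t * a - t * b) = t * max 0 (a - b)" for a b :: real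
    using assms(2) by (auto simp: max_def mult_le_cancel_left_pos right_diff_distrib)
  show ?thesis
    using assms(2) pos by (simp add: x gauge_eq S12.T.L_homogeneous S23.T.L_homogeneous m distrib_left)
qed

lemma gauge_asymp:
  assumes x: "0 < x1" "0 < x2" "0 < x3"
    and lim: "((\<lambda>t. - ln (V.vine_formula (t * x1) (t * x2) (t * x3)) / t) \<longlongrightarrow> gauge (x1, x2, x3)) at_top"
  shows "(\<lambda>t. - ln (V.vine_dens (t *\<^sub>R (x1, x2, x3)))) \<sim>[at_top] (\<lambda>t. t * gauge (x1, x2, x3))"
proof -
  have "0 < max (stdf H12 x1 x2) (stdf H23 x2 x3)"
    using S12.T.L_ge_fst[of x1 x2] x by (simp add: less_max_iff_disj)
  moreover have "0 \<le> (1 + s1_13) * max 0 (stdf H12 x1 x2 - stdf H23 x2 x3)"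
    "0 \<le> (1 + s2_13) * max 0 (stdf H23 x2 x3 - stdf H12 x1 x2)"
    using S13.S.s_gt by simp_all
  ultimately have g: "0 < gauge (x1, x2, x3)" by (simp add: gauge_eq)
  have "((\<lambda>t. - ln (V.vine_formula (t * x1) (t * x2) (t * x3)) / t / gauge (x1, x2, x3)) \<longlongrightarrow>
      gauge (x1, x2, x3) / gauge (x1, x2, x3)) at_top"
    using g by (intro tendsto_divide lim tendsto_const) auto
  moreover have "\<forall>\<^sub>F t in at_top. - ln (V.vine_formula (t * x1) (t * x2) (t * x3)) / t / gauge (x1, x2, x3)
      = - ln (V.vine_dens (t *\<^sub>R (x1, x2, x3))) / (t * gauge (x1, x2, x3))"
    using eventually_gt_at_top[of 0] by eventually_elim (use x in \<open>simp add: V.vine_dens_def\<close>)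
  ultimately have "((\<lambda>t. - ln (V.vine_dens (t *\<^sub>R (x1, x2, x3))) / (t * gauge (x1, x2, x3))) \<longlongrightarrow> 1) at_top"
    using g by (auto intro: Lim_transform_eventually)
  then show ?thesis by (rule asymp_equivI')
qed

lemma gauge_function:
  assumes "D \<subseteq> open_orthant"
    and eq: "\<And>x1 x2 x3. (x1, x2, x3) \<in> D \<Longrightarrow> stdf H12 x1 x2 = stdf H23 x2 x3 \<Longrightarrow>
      continuous_on {0<..<1} h13 \<and> (\<forall>w\<in>{0<..<1}. 0 < h13 w)"
  shows "gauge_function_on D V.vine_dens gauge"
  unfolding gauge_function_on_def
proof (intro conjI ballI allI impI continuous_gauge gauge_homogeneous)
  fix x assume "x \<in> D"
  obtain x1 x2 x3 where x: "x = (x1, x2, x3)" by (cases x)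
  have pos: "0 < x1" "0 < x2" "0 < x3"
    using assms(1) \<open>x \<in> D\<close> by (auto simp: x open_orthant_def)
  have "((\<lambda>t. - ln (V.vine_formula (t * x1) (t * x2) (t * x3)) / t) \<longlongrightarrow> gauge (x1, x2, x3)) at_top"
  proof (cases "stdf H12 x1 x2 = stdf H23 x2 x3")
    case True
    then have "continuous_on {0<..<1} h13" "\<forall>w\<in>{0<..<1}. 0 < h13 w"
      using eq \<open>x \<in> D\<close> x by auto
    note \<kappa> = S13.deriv_B_interior[OF this]
    from V.ln_vine_formula_rate_eq[OF pos True \<kappa>] show ?thesis using True by (simp add: gauge_eq)
  next
    case False
    from V.ln_vine_formula_rate_neq[OF pos this] show ?thesis
      by (simp add: vine_gauge_def stdf_def Let_def)
  qed
  from gauge_asymp[OF pos this] show "(\<lambda>t. - ln (V.vine_dens (t *\<^sub>R x))) \<sim>[at_top] (\<lambda>t. t * gauge x)"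
  by (simp add: x)
qed

lemma vine_dens_nonneg: "0 \<le> V.vine_dens x"
  by (cases x) (auto simp: V.vine_dens_def V.vine_formula_nonneg)

lemma survival_probability:
  assumes joint: "distributed M (lborel \<Otimes>\<^sub>M (lborel \<Otimes>\<^sub>M lborel)) Y (\<lambda>x. ennreal (V.vine_dens x))"
    and z: "0 < z1" "0 \<le> z2" "0 < z3" "z1 = z3"
  shows "measure M (Y -` {(x1, x2, x3). z1 < x1 \<and> z2 < x2 \<and> z3 < x3} \<inter> space M) = V.tail_prob z1 z2"
proof -
  let ?S = "{(x1, x2, x3). z1 < x1 \<and> z2 < x2 \<and> z3 < x3} :: (real \<times> real \<times> real) set"
  let ?N = "lborel \<Otimes>\<^sub>M (lborel \<Otimes>\<^sub>M lborel) :: (real \<times> real \<times> real) measure"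
  have "(\<lambda>x. ennreal (V.vine_dens x)) \<in> borel_measurable ?N"
    using joint by (rule distributed_borel_measurable)
  then have "(\<lambda>x. enn2real (ennreal (V.vine_dens x))) \<in> borel_measurable ?N"
    by (rule measurable_compose) simp
  then have meas: "V.vine_dens \<in> borel_measurable ?N" by (simp add: vine_dens_nonneg)
  have "?S = {z1<..} \<times> {z2<..} \<times> {z3<..}" by auto
  also have "\<dots> \<in> sets ?N" by (intro pair_measureI) auto
  finally have "emeasure M (Y -` ?S \<inter> space M) = (\<integral>\<^sup>+x. ennreal (V.vine_dens x) * indicator ?S x \<partial>?N)"
    by (rule distributed_emeasure[OF joint])
  also have "\<dots> = (\<integral>\<^sup>+y. ennreal (V.tail_slice z1 y) * indicator {z2<..} y \<partial>lborel)"
    unfolding V.joint_survival[OF meas z(1-3)] V.tail_slice_def using z(4) by simp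
  also have "\<dots> = ennreal (V.tail_prob z1 z2)" using z by (intro V.nn_integral_tail_slice)
  finally show ?thesis using V.tail_prob_nonneg[of z1 z2] z by (simp add: measure_def)
qed

end

theorem mainTheorem7:
  fixes M :: "'a measure" and X :: "nat \<Rightarrow> 'a \<Rightarrow> real"
    and H12 H23 H13 :: "real measure"
    and h12 h23 h13 :: "real \<Rightarrow> real"
    and s1_12 s2_12 s1_23 s2_23 s1_13 s2_13 :: real
    and f :: "real \<times> real \<times> real \<Rightarrow> real"
  assumes "spectral_distribution H12" "spectral_distribution H23" "spectral_distribution H13"
    and "exponent_measure_differentiable H12" "exponent_measure_differentiable H23"
      "exponent_measure_differentiable H13"
    and "spectral_density H12 h12" "spectral_density H23 h23" "spectral_density H13 h13"
    and "spectral_tails h12 s1_12 s2_12" "spectral_tails h23 s1_23 s2_23"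
      "spectral_tails h13 s1_13 s2_13"
    and f: "f = vine_density (inverted_ev_copula H12) (inverted_ev_copula H23) (ev_copula H13)"
    and "prob_space M"
    and margins: "\<And>i. i \<in> {1, 2, 3} \<Longrightarrow> distributed M lborel (X i) (exponential_density 1)"
    and joint: "distributed M (lborel \<Otimes>\<^sub>M (lborel \<Otimes>\<^sub>M lborel))
      (\<lambda>\<omega>. (X 1 \<omega>, X 2 \<omega>, X 3 \<omega>)) (\<lambda>x. ennreal (f x))"
  shows
    \<comment> \<open>Rays on which the two exponent measures agree need \<open>h13\<close> not to oscillate or vanish in the
      interior of the unit interval: there the limit relation evaluates \<open>h13\<close> at angles that
      converge to an interior point.\<close>
    "gauge_function_on
       {(x1, x2, x3) \<in> open_orthant.
          exponent_measure H12 (inverse x1) (inverse x2) \<noteq> exponent_measure H23 (inverse x2) (inverse x3)}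
       f (vine_gauge H12 H23 s1_13 s2_13)
     \<and> (continuous_on {0<..<1} h13 \<and> (\<forall>w\<in>{0<..<1}. 0 < h13 w) \<longrightarrow>
          gauge_function_on open_orthant f (vine_gauge H12 H23 s1_13 s2_13))
     \<and> tail_dependence_coefficient M X {1, 2, 3}
         (min (inverse (exponent_measure H12 1 1)) (inverse (exponent_measure H23 1 1)))
     \<and> tail_dependence_coefficient M X {1, 3} 1"
proof -
  interpret prob_space M by fact
  interpret spectral_vine H12 h12 s1_12 s2_12 H23 h23 s1_23 s2_23 H13 h13 s1_13 s2_13
    using assms by (intro spectral_vine.intro spectral.intro)
  have f_eq: "f = V.vine_dens" by (simp add: f vine_density_eq)
  let ?Y = "\<lambda>\<omega>. (X 1 \<omega>, X 2 \<omega>, X 3 \<omega>)"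
  note joint' = joint[unfolded f_eq]
  have X_meas: "X i \<in> borel_measurable M" if "i \<in> {1, 2, 3}" for i
    using distributed_measurable[OF margins[OF that]] by simp

  have gauge1: "gauge_function_on
       {(x1, x2, x3) \<in> open_orthant.
          exponent_measure H12 (inverse x1) (inverse x2) \<noteq> exponent_measure H23 (inverse x2) (inverse x3)}
       f gauge"
    unfolding f_eq by (rule gauge_function) (auto simp: stdf_def)
  have gauge2: "continuous_on {0<..<1} h13 \<and> (\<forall>w\<in>{0<..<1}. 0 < h13 w) \<longrightarrow>
          gauge_function_on open_orthant f gauge"
    unfolding f_eq using gauge_function[of open_orthant] by blast

  have tail123: "tail_dependence_coefficient M X {1, 2, 3}
         (min (inverse (exponent_measure H12 1 1)) (inverse (exponent_measure H23 1 1)))"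
  proof -
    define m where "m = max (stdf H12 1 1) (stdf H23 1 1)"
    have ge1: "1 \<le> stdf H12 1 1" "1 \<le> stdf H23 1 1" by (rule S12.T.L_ge_fst S23.T.L_ge_fst)+
    have \<eta>: "min (inverse (exponent_measure H12 1 1)) (inverse (exponent_measure H23 1 1)) = inverse m"
      using ge1 by (auto simp: m_def stdf_def min_def max_def)
    obtain K where K: "0 < K" "((\<lambda>x. V.tail_prob x x * exp (m * x)) \<longlongrightarrow> K) at_top"
      using V.tail_prob_diag_limit unfolding m_def by blast
    have "((\<lambda>x. V.tail_prob x x * exp (m * x) / K) \<longlongrightarrow> K / K) at_top"
      using K by (intro tendsto_divide tendsto_const) auto
    moreover have "\<forall>\<^sub>F x in at_top. V.tail_prob x x * exp (m * x) / K
        = measure M {\<omega> \<in> space M. \<forall>i\<in>{1, 2, 3}. X i \<omega> > x} / (K * exp (- x / inverse m))"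
      using eventually_gt_at_top[of 0]
    proof eventually_elim
      case (elim x)
      have "{\<omega> \<in> space M. \<forall>i\<in>{1, 2, 3}. X i \<omega> > x}
          = ?Y -` {(x1, x2, x3). x < x1 \<and> x < x2 \<and> x < x3} \<inter> space M" by auto
      then show ?case
        using survival_probability[OF joint', of x x x] elim
        by (simp add: exp_minus divide_inverse mult_ac)
    qed
    ultimately have "((\<lambda>x. measure M {\<omega> \<in> space M. \<forall>i\<in>{1, 2, 3}. X i \<omega> > x} / (K * exp (- x / inverse m))) \<longlongrightarrow> 1) at_top"
      using K by (auto intro: Lim_transform_eventually)
    then have "(\<lambda>x. measure M {\<omega> \<in> space M. \<forall>i\<in>{1, 2, 3}. X i \<omega> > x})
         \<sim>[at_top] (\<lambda>x. K * exp (- x / inverse m))" by (rule asymp_equivI')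
    moreover have "slowly_varying (\<lambda>_. K)"
      using K by (simp add: slowly_varying_def)
    moreover have "0 < inverse m" "inverse m \<le> 1" using ge1 by (auto simp: m_def inverse_le_1_iff)
    ultimately show ?thesis unfolding \<eta> tail_dependence_coefficient_def by blast
  qed

  have tail13: "tail_dependence_coefficient M X {1, 3} 1"
  proof -
    \<comment> \<open>the slowly varying function is \<open>y * S (ln y)\<close>\<close>
    define S where "S x = measure M {\<omega> \<in> space M. \<forall>i\<in>{1, 3}. X i \<omega> > x}" for x
    have sets: "{\<omega> \<in> space M. \<forall>i\<in>{1, 3}. X i \<omega> > x} \<in> sets M" for x
      using X_meas[of 1] X_meas[of 3] by simp
    have anti: "S y \<le> S x" if "x \<le> y" for x y
      unfolding S_def using that sets by (intro finite_measure_mono) auto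
    have S_eq: "S x = V.tail_prob x 0" if x: "0 < x" for x
    proof -
      let ?E = "{\<omega> \<in> space M. \<forall>i\<in>{1, 3}. X i \<omega> > x}"
      let ?E' = "?Y -` {(x1, x2, x3). x < x1 \<and> 0 < x2 \<and> x < x3} \<inter> space M"
      have "AE \<omega> in M. 0 < X 2 \<omega>"
      proof -
        have "{x :: real \<times> real \<times> real. 0 < fst (snd x)} = UNIV \<times> {0<..} \<times> UNIV" by auto
        also have "\<dots> \<in> sets (lborel \<Otimes>\<^sub>M (lborel \<Otimes>\<^sub>M lborel))"
          by (intro pair_measureI) auto
        finally have "Measurable.pred (lborel \<Otimes>\<^sub>M (lborel \<Otimes>\<^sub>M lborel)) (\<lambda>x :: real \<times> real \<times> real. 0 < fst (snd x))"
          by (simp add: pred_def space_pair_measure)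
        then have "(AE \<omega> in M. 0 < fst (snd (?Y \<omega>))) \<longleftrightarrow>
            (AE x in lborel \<Otimes>\<^sub>M (lborel \<Otimes>\<^sub>M lborel). 0 < ennreal (V.vine_dens x) \<longrightarrow> 0 < fst (snd x))"
          by (rule distributed_AE2[OF joint'])
        then show ?thesis by (auto simp: V.vine_dens_def intro!: always_eventually split: if_splits)
      qed
      then have ae: "AE \<omega> in M. \<omega> \<in> ?E \<longleftrightarrow> \<omega> \<in> ?E'" by eventually_elim auto
      have "?E' = {\<omega> \<in> space M. x < X 1 \<omega> \<and> 0 < X 2 \<omega> \<and> x < X 3 \<omega>}" by auto
      also have "\<dots> \<in> sets M" using X_meas[of 1] X_meas[of 2] X_meas[of 3] by simp
      finally have "measure M ?E = measure M ?E'"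
        using ae sets by (intro finite_measure_eq_AE)
      then show ?thesis using survival_probability[OF joint', of x 0 x] x by (simp add: S_def)
    qed
    have ev: "\<forall>\<^sub>F x in at_top. V.tail_prob x 0 = S x"
      using eventually_gt_at_top[of 0] by eventually_elim (simp add: S_eq)
    have "slowly_varying (\<lambda>y. y * S (ln y))"
    proof (rule slowly_varying_from_shift[OF anti])
      show "\<forall>\<^sub>F x in at_top. 0 < S x"
        using ev V.tail_prob_pos_eventually by eventually_elim simp
      fix \<delta> :: real assume \<delta>: "0 < \<delta>"
      have "\<forall>\<^sub>F x in at_top. V.tail_prob (x + \<delta>) 0 / V.tail_prob x 0 = S (x + \<delta>) / S x"
        using eventually_gt_at_top[of 0] by eventually_elim (use \<delta> in \<open>simp add: S_eq\<close>)
      with V.tail_prob_shift_ratio[OF \<delta>] show "((\<lambda>x. S (x + \<delta>) / S x) \<longlongrightarrow> exp (- \<delta>)) at_top"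
        by (rule Lim_transform_eventually)
    qed
    moreover have "exp x * S (ln (exp x)) * exp (- x / 1) = S x" for x
      by (simp add: exp_minus)
    then have "S \<sim>[at_top] (\<lambda>x. exp x * S (ln (exp x)) * exp (- x / 1))"
      by (simp only: asymp_equiv_refl)
    ultimately show ?thesis
      unfolding tail_dependence_coefficient_def S_def[abs_def] by auto
  qed

  from gauge1 gauge2 tail123 tail13 show ?thesis by blast
qed

end
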